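(* Let $\mathcal{E}$ be a deflation-exact category having admissible kernels. The Yoneda embedding $\mathbb{Y}\colon\mathcal{E}\to\operatorname{mod}_{\mathsf{adm}}(\mathcal{E})$ induces an equivalence $\mathcal{E}\simeq\operatorname{mod}_{\mathsf{adm}}(\mathcal{E})/\operatorname{eff}(\mathcal{E})$; that is, the composition of $\mathbb{Y}$ with the quotient functor $Q\colon\operatorname{mod}_{\mathsf{adm}}(\mathcal{E})\to\operatorname{mod}_{\mathsf{adm}}(\mathcal{E})/\operatorname{eff}(\mathcal{E})$ is an equivalence.
   Context: All categories are essentially small and additive, all functors are additive. A \emph{conflation category} is an additive category with a chosen class, closed under isomorphisms, of kernel-cokernel pairs called \emph{conflations}; the kernel part of a conflation is an \emph{inflation}, the cokernel part a \emph{deflation}. A morphism is \emph{admissible} if it is a deflation followed by an inflation. A conflation category is \emph{deflation-exact} if (R0) every map $X\to 0$ is a deflation, (R1) compositions of deflations are deflations, (R2) pullbacks of deflations along arbitrary morphisms exist and are deflations. It \emph{has admissible kernels} if every morphism has a kernel and every kernel is an inflation. $\operatorname{Mod}(\mathcal{E})$ is the category of contravariant additive functors $\mathcal{E}\to\mathbf{Ab}$, $\mathbb{Y}(E)=\operatorname{Hom}(-,E)$ the Yoneda functor, and $\operatorname{mod}(\mathcal{E})$ the full subcategory of functors isomorphic to $\operatorname{coker}\mathbb{Y}(f)$ for a morphism $f$ in $\mathcal{E}$; it is abelian as $\mathcal{E}$ has kernels. $\operatorname{mod}_{\mathsf{adm}}(\mathcal{E})$ is the full subcategory of $\operatorname{mod}(\mathcal{E})$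 of functors isomorphic to $\operatorname{coker}\mathbb{Y}(f)$ with $f$ an admissible morphism in $\mathcal{E}$; $\operatorname{eff}(\mathcal{E})\subseteq\operatorname{mod}_{\mathsf{adm}}(\mathcal{E})$ is the full subcategory of those isomorphic to $\operatorname{coker}\mathbb{Y}(f)$ with $f$ a deflation in $\mathcal{E}$. The conflations in $\operatorname{mod}_{\mathsf{adm}}(\mathcal{E})$ are the short exact sequences of $\operatorname{mod}(\mathcal{E})$ with all terms in $\operatorname{mod}_{\mathsf{adm}}(\mathcal{E})$; this is a deflation-exact structure. The quotient $\operatorname{mod}_{\mathsf{adm}}(\mathcal{E})/\operatorname{eff}(\mathcal{E})$ is the localization of $\operatorname{mod}_{\mathsf{adm}}(\mathcal{E})$ at the set of weak isomorphisms, i.e. finite compositions of inflations with cokernel in $\operatorname{eff}(\mathcal{E})$ and deflations with kernel in $\operatorname{eff}(\mathcal{E})$, endowed with the smallest conflation structure for which the localization functor $Q$ maps conflations to conflations. *)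

theory Defs
  imports "HOL-Algebra.Group"
begin

section \<open>Categories\<close>

record ('o, 'a) cat =
  Obj :: "'o set"
  Arr :: "'a set"
  Dom :: "'a \<Rightarrow> 'o"
  Cod :: "'a \<Rightarrow> 'o"
  Idn :: "'o \<Rightarrow> 'a"
  Cmp :: "'a \<Rightarrow> 'a \<Rightarrow> 'a"  \<comment> \<open>\<open>Cmp C g f\<close> is \<open>g\<close> after \<open>f\<close>\<close>

definition Hom :: "('o, 'a, 'm) cat_scheme \<Rightarrow> 'o \<Rightarrow> 'o \<Rightarrow> 'a set" where
  "Hom C A B = {f \<in> Arr C. Dom C f = A \<and> Cod C f = B}"

locale category =
  fixes C :: "('o, 'a, 'm) cat_scheme"
  assumes Dom_Obj: "f \<in> Arr C \<Longrightarrow> Dom C f \<in> Obj C"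
    and Cod_Obj: "f \<in> Arr C \<Longrightarrow> Cod C f \<in> Obj C"
    and Idn_Hom: "A \<in> Obj C \<Longrightarrow> Idn C A \<in> Hom C A A"
    and Cmp_Hom: "f \<in> Hom C A B \<Longrightarrow> g \<in> Hom C B D \<Longrightarrow> Cmp C g f \<in> Hom C A D"
    and Cmp_Idn: "f \<in> Hom C A B \<Longrightarrow> Cmp C f (Idn C A) = f"
    and Idn_Cmp: "f \<in> Hom C A B \<Longrightarrow> Cmp C (Idn C B) f = f"
    and Cmp_assoc: "f \<in> Hom C A B \<Longrightarrow> g \<in> Hom C B D \<Longrightarrow> h \<in> Hom C D D' \<Longrightarrow>
      Cmp C h (Cmp C g f) = Cmp C (Cmp C h g) f"

definition full_subcat :: "('o, 'a, 'm) cat_scheme \<Rightarrow> 'o set \<Rightarrow> ('o, 'a, 'm) cat_scheme" where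
  "full_subcat C S =
    C\<lparr>Obj := Obj C \<inter> S, Arr := {f \<in> Arr C. Dom C f \<in> S \<and> Cod C f \<in> S}\<rparr>"

definition is_iso :: "('o, 'a, 'm) cat_scheme \<Rightarrow> 'a \<Rightarrow> bool" where
  "is_iso C f \<longleftrightarrow> f \<in> Arr C \<and>
    (\<exists>g \<in> Hom C (Cod C f) (Dom C f).
      Cmp C g f = Idn C (Dom C f) \<and> Cmp C f g = Idn C (Cod C f))"

definition is_zero :: "('o, 'a, 'm) cat_scheme \<Rightarrow> 'o \<Rightarrow> bool" where
  "is_zero C Z \<longleftrightarrow> Z \<in> Obj C \<and>
    (\<forall>A \<in> Obj C. (\<exists>!f. f \<in> Hom C A Z) \<and> (\<exists>!f. f \<in> Hom C Z A))"

text \<open>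
  Zero morphisms are those factoring through a zero object. In an additive category this is
  the neutral element of the Hom group; the formulation also applies to categories that do not
  carry an addition as part of their data.
\<close>

definition zero_arr :: "('o, 'a, 'm) cat_scheme \<Rightarrow> 'a \<Rightarrow> bool" where
  "zero_arr C f \<longleftrightarrow> f \<in> Arr C \<and>
    (\<exists>Z g h. is_zero C Z \<and> g \<in> Hom C (Dom C f) Z \<and> h \<in> Hom C Z (Cod C f) \<and> f = Cmp C h g)"

definition is_kernel :: "('o, 'a, 'm) cat_scheme \<Rightarrow> 'a \<Rightarrow> 'a \<Rightarrow> bool" where
  "is_kernel C k f \<longleftrightarrow> f \<in> Arr C \<and> k \<in> Arr C \<and> Cod C k = Dom C f \<and> zero_arr C (Cmp C f k) \<and>
    (\<forall>h \<in> Arr C. Cod C h = Dom C f \<and> zero_arr C (Cmp C f h) \<longrightarrow>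
      (\<exists>!u. u \<in> Hom C (Dom C h) (Dom C k) \<and> Cmp C k u = h))"

definition is_cokernel :: "('o, 'a, 'm) cat_scheme \<Rightarrow> 'a \<Rightarrow> 'a \<Rightarrow> bool" where
  "is_cokernel C c f \<longleftrightarrow> f \<in> Arr C \<and> c \<in> Arr C \<and> Dom C c = Cod C f \<and> zero_arr C (Cmp C c f) \<and>
    (\<forall>h \<in> Arr C. Dom C h = Cod C f \<and> zero_arr C (Cmp C h f) \<longrightarrow>
      (\<exists>!u. u \<in> Hom C (Cod C c) (Cod C h) \<and> Cmp C u c = h))"

definition kernel_cokernel_pair :: "('o, 'a, 'm) cat_scheme \<Rightarrow> 'a \<Rightarrow> 'a \<Rightarrow> bool" where
  "kernel_cokernel_pair C i p \<longleftrightarrow> is_kernel C i p \<and> is_cokernel C p i"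

text \<open>\<open>is_pullback C p f p' f'\<close>: the square \<open>p \<circ> f' = f \<circ> p'\<close> is cartesian.\<close>

definition is_pullback :: "('o, 'a, 'm) cat_scheme \<Rightarrow> 'a \<Rightarrow> 'a \<Rightarrow> 'a \<Rightarrow> 'a \<Rightarrow> bool" where
  "is_pullback C p f p' f' \<longleftrightarrow>
    {p, f, p', f'} \<subseteq> Arr C \<and> Cod C p = Cod C f \<and>
    Dom C p' = Dom C f' \<and> Cod C p' = Dom C f \<and> Cod C f' = Dom C p \<and>
    Cmp C p f' = Cmp C f p' \<and>
    (\<forall>a \<in> Arr C. \<forall>b \<in> Arr C.
      Dom C a = Dom C b \<and> Cod C a = Dom C f \<and> Cod C b = Dom C p \<and> Cmp C p b = Cmp C f a \<longrightarrow>
      (\<exists>!u. u \<in> Hom C (Dom C a) (Dom C p') \<and> Cmp C p' u = a \<and> Cmp C f' u = b))"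


section \<open>Functors and equivalences\<close>

definition is_functor ::
  "('o, 'a, 'm) cat_scheme \<Rightarrow> ('p, 'b, 'n) cat_scheme \<Rightarrow> ('o \<Rightarrow> 'p) \<Rightarrow> ('a \<Rightarrow> 'b) \<Rightarrow> bool" where
  "is_functor C D Fo Fa \<longleftrightarrow>
    category C \<and> category D \<and>
    (\<forall>A \<in> Obj C. Fo A \<in> Obj D \<and> Fa (Idn C A) = Idn D (Fo A)) \<and>
    (\<forall>f \<in> Arr C. Fa f \<in> Hom D (Fo (Dom C f)) (Fo (Cod C f))) \<and>
    (\<forall>f \<in> Arr C. \<forall>g \<in> Arr C. Cod C f = Dom C g \<longrightarrow> Fa (Cmp C g f) = Cmp D (Fa g) (Fa f))"

definition natural_iso ::
  "('o, 'a, 'm) cat_scheme \<Rightarrow> ('p, 'b, 'n) cat_scheme \<Rightarrow>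
    ('o \<Rightarrow> 'p) \<Rightarrow> ('a \<Rightarrow> 'b) \<Rightarrow> ('o \<Rightarrow> 'p) \<Rightarrow> ('a \<Rightarrow> 'b) \<Rightarrow> ('o \<Rightarrow> 'b) \<Rightarrow> bool" where
  "natural_iso C D Fo Fa Go Ga \<tau> \<longleftrightarrow>
    (\<forall>A \<in> Obj C. \<tau> A \<in> Hom D (Fo A) (Go A) \<and> is_iso D (\<tau> A)) \<and>
    (\<forall>f \<in> Arr C. Cmp D (\<tau> (Cod C f)) (Fa f) = Cmp D (Ga f) (\<tau> (Dom C f)))"

definition is_equivalence ::
  "('o, 'a, 'm) cat_scheme \<Rightarrow> ('p, 'b, 'n) cat_scheme \<Rightarrow> ('o \<Rightarrow> 'p) \<Rightarrow> ('a \<Rightarrow> 'b) \<Rightarrow> bool" where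
  "is_equivalence C D Fo Fa \<longleftrightarrow>
    is_functor C D Fo Fa \<and>
    (\<exists>Go Ga. is_functor D C Go Ga \<and>
      (\<exists>\<eta>. natural_iso C C (\<lambda>A. A) (\<lambda>f. f) (Go \<circ> Fo) (Ga \<circ> Fa) \<eta>) \<and>
      (\<exists>\<epsilon>. natural_iso D D (Fo \<circ> Go) (Fa \<circ> Ga) (\<lambda>A. A) (\<lambda>f. f) \<epsilon>))"


section \<open>Additive categories\<close>

record ('o, 'a) addcat = "('o, 'a) cat" +
  Add :: "'a \<Rightarrow> 'a \<Rightarrow> 'a"
  Zero :: "'o \<Rightarrow> 'o \<Rightarrow> 'a"

definition hom_group :: "('o, 'a, 'm) addcat_scheme \<Rightarrow> 'o \<Rightarrow> 'o \<Rightarrow> 'a monoid" where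
  "hom_group E A B = \<lparr>carrier = Hom E A B, mult = Add E, one = Zero E A B\<rparr>"

locale additive_category = category E for E :: "('o, 'a, 'm) addcat_scheme" +
  assumes hom_comm_group: "A \<in> Obj E \<Longrightarrow> B \<in> Obj E \<Longrightarrow> comm_group (hom_group E A B)"
    and Cmp_Add_left: "f \<in> Hom E A B \<Longrightarrow> g \<in> Hom E B D \<Longrightarrow> g' \<in> Hom E B D \<Longrightarrow>
      Cmp E (Add E g g') f = Add E (Cmp E g f) (Cmp E g' f)"
    and Cmp_Add_right: "f \<in> Hom E A B \<Longrightarrow> f' \<in> Hom E A B \<Longrightarrow> g \<in> Hom E B D \<Longrightarrow>
      Cmp E g (Add E f f') = Add E (Cmp E g f) (Cmp E g f')"
    and ex_zero: "\<exists>Z. is_zero E Z"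
    and ex_biproduct: "A \<in> Obj E \<Longrightarrow> B \<in> Obj E \<Longrightarrow>
      \<exists>P \<in> Obj E. \<exists>i \<in> Hom E A P. \<exists>j \<in> Hom E B P. \<exists>p \<in> Hom E P A. \<exists>q \<in> Hom E P B.
        Cmp E p i = Idn E A \<and> Cmp E q j = Idn E B \<and>
        Cmp E q i = Zero E A B \<and> Cmp E p j = Zero E B A \<and>
        Add E (Cmp E i p) (Cmp E j q) = Idn E P"


section \<open>Conflation categories\<close>

text \<open>A conflation is represented by the pair of its inflation and its deflation.\<close>

definition conflation_structure :: "('o, 'a, 'm) cat_scheme \<Rightarrow> ('a \<times> 'a) set \<Rightarrow> bool" where
  "conflation_structure C K \<longleftrightarrow>
    (\<forall>(i, p) \<in> K. kernel_cokernel_pair C i p) \<and>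
    (\<forall>(i, p) \<in> K. \<forall>i' \<in> Arr C. \<forall>p' \<in> Arr C. \<forall>a b c.
      Cod C i' = Dom C p' \<and> is_iso C a \<and> is_iso C b \<and> is_iso C c \<and>
      a \<in> Hom C (Dom C i) (Dom C i') \<and> b \<in> Hom C (Cod C i) (Cod C i') \<and>
      c \<in> Hom C (Cod C p) (Cod C p') \<and>
      Cmp C b i = Cmp C i' a \<and> Cmp C c p = Cmp C p' b \<longrightarrow> (i', p') \<in> K)"

definition inflation :: "('a \<times> 'a) set \<Rightarrow> 'a \<Rightarrow> bool" where
  "inflation K i \<longleftrightarrow> (\<exists>p. (i, p) \<in> K)"

definition deflation :: "('a \<times> 'a) set \<Rightarrow> 'a \<Rightarrow> bool" where
  "deflation K p \<longleftrightarrow> (\<exists>i. (i, p) \<in> K)"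

definition admissible :: "('o, 'a, 'm) cat_scheme \<Rightarrow> ('a \<times> 'a) set \<Rightarrow> 'a \<Rightarrow> bool" where
  "admissible C K f \<longleftrightarrow>
    (\<exists>p i. deflation K p \<and> inflation K i \<and> Cod C p = Dom C i \<and> f = Cmp C i p)"

text \<open>
  Every category here is small, its objects and arrows forming sets; an essentially small
  category is one equivalent to such a category.
\<close>

locale deflation_exact = additive_category E
  for E :: "('o, 'a, 'm) addcat_scheme" +
  fixes K :: "('a \<times> 'a) set"
  assumes conflations: "conflation_structure E K"
    and R0: "is_zero E Z \<Longrightarrow> f \<in> Arr E \<Longrightarrow> Cod E f = Z \<Longrightarrow> deflation K f"
    and R1: "deflation K p \<Longrightarrow> deflation K q \<Longrightarrow> Cod E p = Dom E q \<Longrightarrow> deflation K (Cmp E q p)"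
    and R2_ex: "deflation K p \<Longrightarrow> f \<in> Arr E \<Longrightarrow> Cod E f = Cod E p \<Longrightarrow>
      \<exists>p' f'. is_pullback E p f p' f'"
    and R2_deflation: "deflation K p \<Longrightarrow> is_pullback E p f p' f' \<Longrightarrow> deflation K p'"

definition has_admissible_kernels :: "('o, 'a, 'm) cat_scheme \<Rightarrow> ('a \<times> 'a) set \<Rightarrow> bool" where
  "has_admissible_kernels C K \<longleftrightarrow>
    (\<forall>f \<in> Arr C. \<exists>k. is_kernel C k f) \<and> (\<forall>f k. is_kernel C k f \<longrightarrow> inflation K k)"

definition smallest_conflation_structure ::
  "('o, 'a, 'm) cat_scheme \<Rightarrow> ('a \<times> 'a) set \<Rightarrow> ('a \<times> 'a) set" where
  "smallest_conflation_structure C S = \<Inter>{K. conflation_structure C K \<and> S \<subseteq> K}"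


section \<open>Modules over an additive category\<close>

text \<open>
  A contravariant functor from \<open>E\<close> to abelian groups: \<open>Val\<close> is its action on objects and
  \<open>Act\<close> its action on arrows. Only the values on \<open>Obj E\<close> and \<open>Arr E\<close> matter; two functors that
  differ elsewhere are distinct but isomorphic objects of \<open>Mod_cat\<close>.
\<close>

record ('o, 'a, 'u) presheaf =
  Val :: "'o \<Rightarrow> 'u monoid"
  Act :: "'a \<Rightarrow> 'u \<Rightarrow> 'u"

definition additive_presheaf ::
  "('o, 'a, 'm) addcat_scheme \<Rightarrow> ('o, 'a, 'u) presheaf \<Rightarrow> bool" where
  "additive_presheaf E F \<longleftrightarrow>
    (\<forall>A \<in> Obj E. comm_group (Val F A)) \<and>
    (\<forall>f \<in> Arr E. Act F f \<in> hom (Val F (Cod E f)) (Val F (Dom E f))) \<and>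
    (\<forall>A \<in> Obj E. \<forall>x \<in> carrier (Val F A). Act F (Idn E A) x = x) \<and>
    (\<forall>f \<in> Arr E. \<forall>g \<in> Arr E. Cod E f = Dom E g \<longrightarrow>
      (\<forall>x \<in> carrier (Val F (Cod E g)). Act F (Cmp E g f) x = Act F f (Act F g x))) \<and>
    (\<forall>A \<in> Obj E. \<forall>B \<in> Obj E. \<forall>f \<in> Hom E A B. \<forall>g \<in> Hom E A B. \<forall>x \<in> carrier (Val F B).
      Act F (Add E f g) x = Act F f x \<otimes>\<^bsub>Val F A\<^esub> Act F g x)"

text \<open>
  The components of a natural transformation are extensional functions, so that equality of
  transformations is equality of their values.
\<close>

definition natural_transformation ::
  "('o, 'a, 'm) addcat_scheme \<Rightarrow> ('o, 'a, 'u) presheaf \<Rightarrow> ('o, 'a, 'u) presheaf \<Rightarrow>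
    ('o \<Rightarrow> 'u \<Rightarrow> 'u) \<Rightarrow> bool" where
  "natural_transformation E F G \<eta> \<longleftrightarrow>
    \<eta> \<in> extensional (Obj E) \<and>
    (\<forall>A \<in> Obj E. \<eta> A \<in> hom (Val F A) (Val G A) \<inter> extensional (carrier (Val F A))) \<and>
    (\<forall>f \<in> Arr E. \<forall>x \<in> carrier (Val F (Cod E f)).
      \<eta> (Dom E f) (Act F f x) = Act G f (\<eta> (Cod E f) x))"

type_synonym ('o, 'a, 'u) presheaf_arr =
  "('o, 'a, 'u) presheaf \<times> ('o \<Rightarrow> 'u \<Rightarrow> 'u) \<times> ('o, 'a, 'u) presheaf"

text \<open>
  The universe from which the abelian groups are taken is the type \<open>'u\<close>: their carriers are
  subsets of \<open>'u\<close>. From the Yoneda functor on, \<open>'u\<close> is the type \<open>'a\<close> of which \<open>Arr E\<close> is a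
  subset. This is large enough: the values of a cokernel of \<open>Hom(-, A) \<rightarrow> Hom(-, B)\<close> are quotients
  of the groups \<open>Hom(X, B)\<close> and hence have isomorphic copies carried by subsets of \<open>'a\<close>. It may
  also be as large as one wants, since \<open>Arr E\<close> need not exhaust \<open>'a\<close>.
\<close>

definition Mod_cat ::
  "('o, 'a, 'm) addcat_scheme \<Rightarrow> (('o, 'a, 'u) presheaf, ('o, 'a, 'u) presheaf_arr) cat" where
  "Mod_cat E =
    \<lparr>Obj = {F. additive_presheaf E F},
     Arr = {(F, \<eta>, G). additive_presheaf E F \<and> additive_presheaf E G \<and>
       natural_transformation E F G \<eta>},
     Dom = (\<lambda>(F, \<eta>, G). F),
     Cod = (\<lambda>(F, \<eta>, G). G),
     Idn = (\<lambda>F. (F, (\<lambda>A \<in> Obj E. \<lambda>x \<in> carrier (Val F A). x), F)),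
     Cmp = (\<lambda>(G', \<theta>, H) (F, \<eta>, G).
       (F, (\<lambda>A \<in> Obj E. \<lambda>x \<in> carrier (Val F A). \<theta> A (\<eta> A x)), H))\<rparr>"

definition yoneda_obj :: "('o, 'a, 'm) addcat_scheme \<Rightarrow> 'o \<Rightarrow> ('o, 'a, 'a) presheaf" where
  "yoneda_obj E B = \<lparr>Val = (\<lambda>A. hom_group E A B), Act = (\<lambda>f u. Cmp E u f)\<rparr>"

definition yoneda_arr :: "('o, 'a, 'm) addcat_scheme \<Rightarrow> 'a \<Rightarrow> ('o, 'a, 'a) presheaf_arr" where
  "yoneda_arr E f =
    (yoneda_obj E (Dom E f),
     (\<lambda>A \<in> Obj E. \<lambda>u \<in> Hom E A (Dom E f). Cmp E f u),
     yoneda_obj E (Cod E f))"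

text \<open>
  The functors isomorphic to \<open>coker \<bbbY>(f)\<close> for some \<open>f \<in> S\<close>, i.e. the targets of cokernels
  of \<open>\<bbbY>(f)\<close> in \<open>Mod_cat E\<close>.
\<close>

definition yoneda_cokernels ::
  "('o, 'a, 'm) addcat_scheme \<Rightarrow> 'a set \<Rightarrow> ('o, 'a, 'a) presheaf set" where
  "yoneda_cokernels E S = {F. \<exists>f \<in> S. \<exists>c. is_cokernel (Mod_cat E) c (yoneda_arr E f) \<and> Cod (Mod_cat E) c = F}"

definition mod_fp ::
  "('o, 'a, 'm) addcat_scheme \<Rightarrow> (('o, 'a, 'a) presheaf, ('o, 'a, 'a) presheaf_arr) cat" where
  "mod_fp E = full_subcat (Mod_cat E) (yoneda_cokernels E (Arr E))"

definition mod_adm ::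
  "('o, 'a, 'm) addcat_scheme \<Rightarrow> ('a \<times> 'a) set \<Rightarrow>
    (('o, 'a, 'a) presheaf, ('o, 'a, 'a) presheaf_arr) cat" where
  "mod_adm E K = full_subcat (mod_fp E) (yoneda_cokernels E {f. admissible E K f})"

definition eff :: "('o, 'a, 'm) addcat_scheme \<Rightarrow> ('a \<times> 'a) set \<Rightarrow> ('o, 'a, 'a) presheaf set" where
  "eff E K = Obj (mod_adm E K) \<inter> yoneda_cokernels E {f. deflation K f}"

text \<open>Short exact sequences of the abelian category \<open>mod_fp E\<close> with all terms in \<open>mod_adm E K\<close>.\<close>

definition adm_conflations ::
  "('o, 'a, 'm) addcat_scheme \<Rightarrow> ('a \<times> 'a) set \<Rightarrow>
    (('o, 'a, 'a) presheaf_arr \<times> ('o, 'a, 'a) presheaf_arr) set" where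
  "adm_conflations E K =
    {(i, p). kernel_cokernel_pair (mod_fp E) i p \<and>
      {Dom (mod_fp E) i, Cod (mod_fp E) i, Cod (mod_fp E) p} \<subseteq> Obj (mod_adm E K)}"


section \<open>Localization of a category at a set of arrows\<close>

text \<open>
  The Gabriel--Zisman construction: an arrow of the localization of \<open>C\<close> at \<open>W\<close> is a class of
  zigzags of arrows of \<open>C\<close> and formal inverses of elements of \<open>W\<close>, modulo the congruence
  generated by \<open>elementary_zigzag\<close>. Zigzags are read in the direction of travel, so that \<open>[Fwd f, Fwd g]\<close>
  stands for \<open>g \<circ> f\<close>.
\<close>

datatype 'a zstep = Fwd 'a | Bwd 'a

fun zigzag :: "('o, 'a, 'm) cat_scheme \<Rightarrow> 'a set \<Rightarrow> 'o \<Rightarrow> 'a zstep list \<Rightarrow> 'o \<Rightarrow> bool" where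
  "zigzag C W x [] y \<longleftrightarrow> x \<in> Obj C \<and> x = y"
| "zigzag C W x (Fwd f # p) y \<longleftrightarrow> f \<in> Arr C \<and> Dom C f = x \<and> zigzag C W (Cod C f) p y"
| "zigzag C W x (Bwd s # p) y \<longleftrightarrow> s \<in> Arr C \<inter> W \<and> Cod C s = x \<and> zigzag C W (Dom C s) p y"

inductive elementary_zigzag ::
  "('o, 'a, 'm) cat_scheme \<Rightarrow> 'a set \<Rightarrow> 'a zstep list \<Rightarrow> 'a zstep list \<Rightarrow> bool"
  for C W where
  "x \<in> Obj C \<Longrightarrow> elementary_zigzag C W [Fwd (Idn C x)] []"
| "f \<in> Arr C \<Longrightarrow> g \<in> Arr C \<Longrightarrow> Cod C f = Dom C g \<Longrightarrow>
    elementary_zigzag C W [Fwd f, Fwd g] [Fwd (Cmp C g f)]"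
| "s \<in> W \<Longrightarrow> elementary_zigzag C W [Fwd s, Bwd s] []"
| "s \<in> W \<Longrightarrow> elementary_zigzag C W [Bwd s, Fwd s] []"

inductive_set zigzag_eq ::
  "('o, 'a, 'm) cat_scheme \<Rightarrow> 'a set \<Rightarrow> 'o \<Rightarrow> 'o \<Rightarrow> ('a zstep list \<times> 'a zstep list) set"
  for C W x y where
  refl: "zigzag C W x p y \<Longrightarrow> (p, p) \<in> zigzag_eq C W x y"
| step: "elementary_zigzag C W l r \<Longrightarrow> zigzag C W x (u @ l @ v) y \<Longrightarrow> zigzag C W x (u @ r @ v) y \<Longrightarrow>
    (u @ l @ v, u @ r @ v) \<in> zigzag_eq C W x y"
| sym: "(p, q) \<in> zigzag_eq C W x y \<Longrightarrow> (q, p) \<in> zigzag_eq C W x y"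
| trans: "(p, q) \<in> zigzag_eq C W x y \<Longrightarrow> (q, r) \<in> zigzag_eq C W x y \<Longrightarrow> (p, r) \<in> zigzag_eq C W x y"

definition zigzag_class ::
  "('o, 'a, 'm) cat_scheme \<Rightarrow> 'a set \<Rightarrow> 'o \<Rightarrow> 'a zstep list \<Rightarrow> 'o \<Rightarrow> 'o \<times> 'a zstep list set \<times> 'o" where
  "zigzag_class C W x p y = (x, zigzag_eq C W x y `` {p}, y)"

definition localization ::
  "('o, 'a, 'm) cat_scheme \<Rightarrow> 'a set \<Rightarrow> ('o, 'o \<times> 'a zstep list set \<times> 'o) cat" where
  "localization C W =
    \<lparr>Obj = Obj C,
     Arr = {zigzag_class C W x p y | x p y. zigzag C W x p y},
     Dom = (\<lambda>(x, P, y). x),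
     Cod = (\<lambda>(x, P, y). y),
     Idn = (\<lambda>x. zigzag_class C W x [] x),
     Cmp = (\<lambda>(y', Q, z) (x, P, y).
       (x, \<Union>p \<in> P. \<Union>q \<in> Q. zigzag_eq C W x z `` {p @ q}, z))\<rparr>"

text \<open>The localization functor is the identity on objects.\<close>

definition loc_obj :: "'o \<Rightarrow> 'o" where
  "loc_obj x = x"

definition loc_arr ::
  "('o, 'a, 'm) cat_scheme \<Rightarrow> 'a set \<Rightarrow> 'a \<Rightarrow> 'o \<times> 'a zstep list set \<times> 'o" where
  "loc_arr C W f = zigzag_class C W (Dom C f) [Fwd f] (Cod C f)"


section \<open>The quotient of \<open>mod_adm\<close> by \<open>eff\<close>\<close>

inductive_set weak_isos ::
  "('o, 'a, 'm) addcat_scheme \<Rightarrow> ('a \<times> 'a) set \<Rightarrow> ('o, 'a, 'a) presheaf_arr set"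
  for E K where
  ident: "F \<in> Obj (mod_adm E K) \<Longrightarrow> Idn (mod_adm E K) F \<in> weak_isos E K"
| infl: "(i, p) \<in> adm_conflations E K \<Longrightarrow> Cod (mod_adm E K) p \<in> eff E K \<Longrightarrow> i \<in> weak_isos E K"
| defl: "(i, p) \<in> adm_conflations E K \<Longrightarrow> Dom (mod_adm E K) i \<in> eff E K \<Longrightarrow> p \<in> weak_isos E K"
| comp: "s \<in> weak_isos E K \<Longrightarrow> t \<in> weak_isos E K \<Longrightarrow>
    Cod (mod_adm E K) s = Dom (mod_adm E K) t \<Longrightarrow> Cmp (mod_adm E K) t s \<in> weak_isos E K"

type_synonym ('o, 'a) quot_arr =
  "('o, 'a, 'a) presheaf \<times> ('o, 'a, 'a) presheaf_arr zstep list set \<times> ('o, 'a, 'a) presheaf"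

definition quot ::
  "('o, 'a, 'm) addcat_scheme \<Rightarrow> ('a \<times> 'a) set \<Rightarrow>
    (('o, 'a, 'a) presheaf, ('o, 'a) quot_arr) cat" where
  "quot E K = localization (mod_adm E K) (weak_isos E K)"

definition Q_obj :: "('o, 'a, 'a) presheaf \<Rightarrow> ('o, 'a, 'a) presheaf" where
  "Q_obj = loc_obj"

definition Q_arr ::
  "('o, 'a, 'm) addcat_scheme \<Rightarrow> ('a \<times> 'a) set \<Rightarrow>
    ('o, 'a, 'a) presheaf_arr \<Rightarrow> ('o, 'a) quot_arr" where
  "Q_arr E K = loc_arr (mod_adm E K) (weak_isos E K)"

definition quot_conflations ::
  "('o, 'a, 'm) addcat_scheme \<Rightarrow> ('a \<times> 'a) set \<Rightarrow>
    (('o, 'a) quot_arr \<times> ('o, 'a) quot_arr) set" where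
  "quot_conflations E K =
    smallest_conflation_structure (quot E K) (map_prod (Q_arr E K) (Q_arr E K) ` adm_conflations E K)"

end

theory Submission
  imports Defs "HOL-Algebra.Coset"
begin

text \<open>
  Let \<open>f = i \<circ> p\<close> be admissible, \<open>F = coker \<bbbY>(f)\<close>, and let \<open>q : B \<rightarrow> C\<close> be a cokernel of the inflation
  \<open>i\<close>. Then \<open>F\<close> has a best approximation by a representable functor, namely the map \<open>\<eta> : F \<rightarrow> \<bbbY>(C)\<close>
  induced by \<open>q\<close>. It factors as \<open>F \<rightarrow> coker \<bbbY>(i) \<rightarrow> \<bbbY>(C)\<close>; the first map is surjective with kernel
  \<open>coker \<bbbY>(p)\<close>, the second one is injective with cokernel \<open>coker \<bbbY>(q)\<close>. As \<open>p\<close> and \<open>q\<close> are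
  deflations, both maps are weak isomorphisms, and as \<open>p\<close> is epi, every map \<open>F \<rightarrow> \<bbbY>(X)\<close> factors
  uniquely through \<open>\<eta>\<close> (lemma \<open>reflection_exists\<close>). So every object becomes isomorphic to a
  representable one in the quotient.

  For full faithfulness one shows that representables are local: composition with a weak
  isomorphism \<open>F \<rightarrow> G\<close> is a bijection from the maps \<open>G \<rightarrow> \<bbbY>(X)\<close> to the maps \<open>F \<rightarrow> \<bbbY>(X)\<close> (lemma
  \<open>weak_iso_local\<close>). Zigzags then act on the maps into a local object \<open>T\<close>, and this
  shows that localizing does not change \<open>Hom(-, T)\<close> (lemmas \<open>loc_full\<close> and \<open>loc_faithful\<close>). Locality
  is easy for deflations with kernel \<open>N\<close> in \<open>eff\<close>, because \<open>N\<close> has no nonzero map to a representable.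
  For an inflation \<open>i : F \<rightarrow> G\<close> with cokernel in \<open>eff\<close>, let \<open>u : C \<rightarrow> D\<close> be the map that \<open>i\<close> induces between
  the representing objects. Deflations behave like coverings of a site: an element killed by \<open>\<eta>\<close> dies
  after pullback along some deflation, and after such a pullback every element of \<open>\<bbbY>(C)\<close> lifts to
  \<open>F\<close>. Arguing with elements locally in this sense, \<open>u\<close> is mono, and some deflation factors through
  \<open>u\<close>; in a deflation-exact category this forces \<open>u\<close> to be an isomorphism (lemma
  \<open>iso_if_deflation_factors\<close>), and locality of \<open>i\<close> follows from universality of \<open>\<eta>\<close>.

  For the conflations, note that all kernels being inflations makes \<open>K\<close> the class of all
  kernel-cokernel pairs of \<open>E\<close> (lemma \<open>conflation_iff\<close>). The same local argument shows that a
  conflation of \<open>mod_adm\<close> induces a kernel-cokernel pair between the representing objects. As the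
  kernel-cokernel pairs of the quotient form a conflation structure, all conflations of the quotient are
  kernel-cokernel pairs, and the equivalence reflects these. Conversely a conflation
  \<open>A \<rightarrow> B \<rightarrow> C\<close> of \<open>E\<close> gives the conflation \<open>\<bbbY>(A) \<rightarrow> \<bbbY>(B) \<rightarrow> coker \<bbbY>(i)\<close>, whose last term is weakly
  isomorphic to \<open>\<bbbY>(C)\<close>.
\<close>

section \<open>Categories, duality and equivalences\<close>

context category
begin

lemma HomD: "f \<in> Hom C A B \<Longrightarrow> f \<in> Arr C \<and> Dom C f = A \<and> Cod C f = B \<and> A \<in> Obj C \<and> B \<in> Obj C"
  using Dom_Obj Cod_Obj by (auto simp: Hom_def)

lemma Arr_Hom: "f \<in> Arr C \<Longrightarrow> f \<in> Hom C (Dom C f) (Cod C f)"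
  by (simp add: Hom_def)

lemma isoI:
  assumes "f \<in> Hom C A B" "g \<in> Hom C B A" "Cmp C g f = Idn C A" "Cmp C f g = Idn C B"
  shows "is_iso C f"
  using assms HomD[OF assms(1)] by (auto simp: is_iso_def)

lemma isoE:
  assumes "is_iso C f" "f \<in> Hom C A B"
  obtains g where "g \<in> Hom C B A" "Cmp C g f = Idn C A" "Cmp C f g = Idn C B" "is_iso C g"
proof -
  have "Dom C f = A" "Cod C f = B" using HomD[OF assms(2)] by auto
  then obtain g where g: "g \<in> Hom C B A" "Cmp C g f = Idn C A" "Cmp C f g = Idn C B"
    using assms(1) by (auto simp: is_iso_def)
  then have "is_iso C g" using isoI assms(2) by blast
  with g show ?thesis by (rule that)
qed

lemma iso_Idn: "A \<in> Obj C \<Longrightarrow> is_iso C (Idn C A)"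
  using isoI Idn_Hom Cmp_Idn by metis

lemma iso_cancel_left:
  assumes "is_iso C t" "t \<in> Hom C A B" "f \<in> Hom C X A" "f' \<in> Hom C X A" "Cmp C t f = Cmp C t f'"
  shows "f = f'"
proof -
  obtain g where g: "g \<in> Hom C B A" "Cmp C g t = Idn C A" using isoE[OF assms(1,2)] by metis
  have "f = Cmp C g (Cmp C t f)"
    using Cmp_assoc[OF assms(3,2) g(1)] g(2) Idn_Cmp[OF assms(3)] by simp
  also have "\<dots> = f'"
    using Cmp_assoc[OF assms(4,2) g(1)] g(2) Idn_Cmp[OF assms(4)] assms(5) by simp
  finally show ?thesis .
qed

lemma iso_cancel_right:
  assumes "is_iso C t" "t \<in> Hom C A B" "f \<in> Hom C B X" "f' \<in> Hom C B X" "Cmp C f t = Cmp C f' t"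
  shows "f = f'"
proof -
  obtain g where g: "g \<in> Hom C B A" "Cmp C t g = Idn C B" using isoE[OF assms(1,2)] by metis
  have "f = Cmp C (Cmp C f t) g"
    using Cmp_assoc[OF g(1) assms(2,3)] g(2) Cmp_Idn[OF assms(3)] by simp
  also have "\<dots> = f'"
    using Cmp_assoc[OF g(1) assms(2,4)] g(2) Cmp_Idn[OF assms(4)] assms(5) by simp
  finally show ?thesis .
qed

lemma inv_cancel_left:
  assumes "t' \<in> Hom C B A" "t \<in> Hom C A B" "Cmp C t t' = Idn C B" "f \<in> Hom C X B"
  shows "Cmp C t (Cmp C t' f) = f"
  using Cmp_assoc[OF assms(4,1,2)] assms(3) Idn_Cmp[OF assms(4)] by simp

lemma inv_cancel_right:
  assumes "t' \<in> Hom C B A" "t \<in> Hom C A B" "Cmp C t t' = Idn C B" "f \<in> Hom C B X"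
  shows "Cmp C (Cmp C f t) t' = f"
  using Cmp_assoc[OF assms(1,2,4)] assms(3) Cmp_Idn[OF assms(4)] by simp

lemma zero_to:
  assumes "is_zero C Z" "A \<in> Obj C"
  obtains f where "f \<in> Hom C A Z" "\<And>f'. f' \<in> Hom C A Z \<Longrightarrow> f' = f"
proof -
  have "\<exists>!f. f \<in> Hom C A Z" using assms by (simp add: is_zero_def)
  then obtain f where f: "f \<in> Hom C A Z" "\<forall>f'. f' \<in> Hom C A Z \<longrightarrow> f' = f" by (rule ex1E)
  show ?thesis by (rule that[OF f(1)]) (use f(2) in simp)
qed

lemma zero_from:
  assumes "is_zero C Z" "A \<in> Obj C"
  obtains f where "f \<in> Hom C Z A" "\<And>f'. f' \<in> Hom C Z A \<Longrightarrow> f' = f"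
proof -
  have "\<exists>!f. f \<in> Hom C Z A" using assms by (simp add: is_zero_def)
  then obtain f where f: "f \<in> Hom C Z A" "\<forall>f'. f' \<in> Hom C Z A \<longrightarrow> f' = f" by (rule ex1E)
  show ?thesis by (rule that[OF f(1)]) (use f(2) in simp)
qed

lemma zero_arr_via:
  assumes Z: "is_zero C Z" and f: "f \<in> Hom C A B"
  shows "zero_arr C f \<longleftrightarrow> (\<exists>g \<in> Hom C A Z. \<exists>h \<in> Hom C Z B. f = Cmp C h g)"
proof
  have AB: "A \<in> Obj C" "B \<in> Obj C" "f \<in> Arr C" "Dom C f = A" "Cod C f = B" using HomD[OF f] by auto
  assume "zero_arr C f"
  then obtain Z' g h where *: "is_zero C Z'" "g \<in> Hom C A Z'" "h \<in> Hom C Z' B" "f = Cmp C h g"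
    using AB by (auto simp: zero_arr_def)
  obtain s where s: "s \<in> Hom C Z' Z" using Z *(1) unfolding is_zero_def by metis
  obtain t where t: "t \<in> Hom C Z Z'" using Z *(1) unfolding is_zero_def by metis
  have "Cmp C t s \<in> Hom C Z' Z'" "Idn C Z' \<in> Hom C Z' Z'"
    using s t Cmp_Hom Idn_Hom *(1) by (auto simp: is_zero_def)
  then have "Cmp C t s = Idn C Z'" using *(1) unfolding is_zero_def by blast
  then have "f = Cmp C h (Cmp C (Cmp C t s) g)" using *(4) Idn_Cmp[OF *(2)] by simp
  also have "\<dots> = Cmp C (Cmp C h t) (Cmp C s g)"
    using Cmp_assoc[OF *(2) s t] Cmp_assoc[OF Cmp_Hom[OF *(2) s] t *(3)] by simp
  finally have "f = Cmp C (Cmp C h t) (Cmp C s g)" .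
  then show "\<exists>g \<in> Hom C A Z. \<exists>h \<in> Hom C Z B. f = Cmp C h g"
    using * s t Cmp_Hom by blast
next
  assume "\<exists>g \<in> Hom C A Z. \<exists>h \<in> Hom C Z B. f = Cmp C h g"
  then show "zero_arr C f" using HomD[OF f] Z by (auto simp: zero_arr_def)
qed

lemma zero_arr_Cmp:
  assumes f: "f \<in> Hom C A B" and g: "g \<in> Hom C B D" and z: "zero_arr C f \<or> zero_arr C g"
  shows "zero_arr C (Cmp C g f)"
  using z
proof
  assume "zero_arr C f"
  then obtain Z k h where *: "is_zero C Z" "k \<in> Hom C A Z" "h \<in> Hom C Z B" "f = Cmp C h k"
    using HomD[OF f] by (auto simp: zero_arr_def)
  then have "Cmp C g f = Cmp C (Cmp C g h) k" "Cmp C g h \<in> Hom C Z D"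
    using Cmp_assoc Cmp_Hom g by blast+
  then show ?thesis using zero_arr_via[OF *(1) Cmp_Hom[OF f g]] * by blast
next
  assume "zero_arr C g"
  then obtain Z k h where *: "is_zero C Z" "k \<in> Hom C B Z" "h \<in> Hom C Z D" "g = Cmp C h k"
    using HomD[OF g] by (auto simp: zero_arr_def)
  then have "Cmp C g f = Cmp C h (Cmp C k f)" "Cmp C k f \<in> Hom C A Z"
    using Cmp_assoc[OF f *(2,3)] Cmp_Hom[OF f *(2)] by auto
  then show ?thesis using zero_arr_via[OF *(1) Cmp_Hom[OF f g]] * by blast
qed

lemma kernelI:
  assumes "f \<in> Hom C B D" "k \<in> Hom C A B" "zero_arr C (Cmp C f k)"
    and "\<And>X h. h \<in> Hom C X B \<Longrightarrow> zero_arr C (Cmp C f h) \<Longrightarrow> \<exists>u \<in> Hom C X A. Cmp C k u = h"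
    and "\<And>X u v. u \<in> Hom C X A \<Longrightarrow> v \<in> Hom C X A \<Longrightarrow> Cmp C k u = Cmp C k v \<Longrightarrow> u = v"
  shows "is_kernel C k f"
  unfolding is_kernel_def
proof (intro conjI ballI impI)
  fix h assume h: "h \<in> Arr C" "Cod C h = Dom C f \<and> zero_arr C (Cmp C f h)"
  then have "h \<in> Hom C (Dom C h) B" using HomD[OF assms(1)] by (auto simp: Hom_def)
  then show "\<exists>!u. u \<in> Hom C (Dom C h) (Dom C k) \<and> Cmp C k u = h"
    using assms(4)[of h "Dom C h"] h assms(5) HomD[OF assms(2)] by metis
qed (use HomD[OF assms(1)] HomD[OF assms(2)] assms(3) in auto)

lemma kernelD:
  assumes "is_kernel C k f" "k \<in> Hom C A B" "f \<in> Hom C B D"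
  shows kernel_zero: "zero_arr C (Cmp C f k)"
    and kernel_factor: "h \<in> Hom C X B \<Longrightarrow> zero_arr C (Cmp C f h) \<Longrightarrow> \<exists>u \<in> Hom C X A. Cmp C k u = h"
    and kernel_mono: "u \<in> Hom C X A \<Longrightarrow> v \<in> Hom C X A \<Longrightarrow> Cmp C k u = Cmp C k v \<Longrightarrow> u = v"
proof -
  show z: "zero_arr C (Cmp C f k)" using assms(1) by (simp add: is_kernel_def)
  have *: "\<exists>!u. u \<in> Hom C X A \<and> Cmp C k u = h" if "h \<in> Hom C X B" "zero_arr C (Cmp C f h)" for h X
  proof -
    have "h \<in> Arr C" "Cod C h = Dom C f" "Dom C h = X" "Dom C k = A"
      using HomD[OF that(1)] HomD[OF assms(2)] HomD[OF assms(3)] by auto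
    then show ?thesis using assms(1) that(2) unfolding is_kernel_def by blast
  qed
  show "\<exists>u \<in> Hom C X A. Cmp C k u = h" if "h \<in> Hom C X B" "zero_arr C (Cmp C f h)"
    using *[OF that] by blast
  show "u = v" if "u \<in> Hom C X A" "v \<in> Hom C X A" "Cmp C k u = Cmp C k v"
  proof -
    have "Cmp C k u \<in> Hom C X B" using that assms Cmp_Hom by blast
    moreover have "zero_arr C (Cmp C f (Cmp C k u))"
      using zero_arr_Cmp[OF that(1) Cmp_Hom[OF assms(2,3)]] z Cmp_assoc[OF that(1) assms(2,3)] by simp
    ultimately show ?thesis using *[of "Cmp C k u" X] that by metis
  qed
qed

end

text \<open>
  Cokernels are kernels in the opposite category, so that everything about kernels below has
  to be proved only once.
\<close>

definition op_cat :: "('o, 'a, 'm) cat_scheme \<Rightarrow> ('o, 'a, 'm) cat_scheme" where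
  "op_cat C = C\<lparr>Dom := Cod C, Cod := Dom C, Cmp := (\<lambda>g f. Cmp C f g)\<rparr>"

lemma op_cat_simps [simp]:
  "Obj (op_cat C) = Obj C" "Arr (op_cat C) = Arr C" "Dom (op_cat C) = Cod C"
  "Cod (op_cat C) = Dom C" "Idn (op_cat C) = Idn C" "Cmp (op_cat C) g f = Cmp C f g"
  "Hom (op_cat C) A B = Hom C B A"
  by (auto simp: op_cat_def Hom_def)

lemma category_op_cat:
  assumes "category C"
  shows "category (op_cat C)"
proof -
  interpret category C by fact
  show ?thesis
    by unfold_locales (simp_all add: Dom_Obj Cod_Obj Idn_Hom Cmp_Hom Cmp_Idn Idn_Cmp Cmp_assoc)
qed

lemma is_zero_op_cat [simp]: "is_zero (op_cat C) Z = is_zero C Z"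
  by (auto simp: is_zero_def)

lemma zero_arr_op_cat [simp]: "zero_arr (op_cat C) f = zero_arr C f"
  by (auto simp: zero_arr_def)

lemma is_iso_op_cat [simp]: "is_iso (op_cat C) f = is_iso C f"
  by (auto simp: is_iso_def)

lemma is_kernel_op_cat [simp]: "is_kernel (op_cat C) c f = is_cokernel C c f"
  by (simp add: is_kernel_def is_cokernel_def)

lemma is_functor_op_cat: "is_functor C D Fo Fa \<Longrightarrow> is_functor (op_cat C) (op_cat D) Fo Fa"
  using category_op_cat[of C] category_op_cat[of D] by (simp add: is_functor_def)

lemma (in category) cokernelI:
  assumes "f \<in> Hom C A B" "c \<in> Hom C B D" "zero_arr C (Cmp C c f)"
    and "\<And>X h. h \<in> Hom C B X \<Longrightarrow> zero_arr C (Cmp C h f) \<Longrightarrow> \<exists>u \<in> Hom C D X. Cmp C u c = h"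
    and "\<And>X u v. u \<in> Hom C D X \<Longrightarrow> v \<in> Hom C D X \<Longrightarrow> Cmp C u c = Cmp C v c \<Longrightarrow> u = v"
  shows "is_cokernel C c f"
  using category.kernelI[OF category_op_cat[OF category_axioms], of f B A c D] assms by simp

lemma (in category) cokernelD:
  assumes "is_cokernel C c f" "c \<in> Hom C B D" "f \<in> Hom C A B"
  shows cokernel_zero: "zero_arr C (Cmp C c f)"
    and cokernel_factor: "h \<in> Hom C B X \<Longrightarrow> zero_arr C (Cmp C h f) \<Longrightarrow> \<exists>u \<in> Hom C D X. Cmp C u c = h"
    and cokernel_epi: "u \<in> Hom C D X \<Longrightarrow> v \<in> Hom C D X \<Longrightarrow> Cmp C u c = Cmp C v c \<Longrightarrow> u = v"
  using category.kernelD[OF category_op_cat[OF category_axioms], of c f D B A] assms by simp_all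

text \<open>
  The form in which a commutative square with two invertible sides is turned around throughout.
\<close>

lemma (in category) square_inverse:
  assumes f: "f \<in> Hom C B D" and f': "f' \<in> Hom C B' D'" and b: "b \<in> Hom C B B'" and c: "c \<in> Hom C D D'"
    and b': "b' \<in> Hom C B' B" and c': "c' \<in> Hom C D' D"
    and inv: "Cmp C b b' = Idn C B'" "Cmp C c' c = Idn C D" and sq: "Cmp C c f = Cmp C f' b"
  shows "Cmp C f b' = Cmp C c' f'"
proof -
  have "Cmp C c' f' = Cmp C c' (Cmp C (Cmp C c f) b')"
    unfolding sq using Cmp_assoc[OF b' b f'] inv(1) Cmp_Idn[OF f'] by simp
  also have "\<dots> = Cmp C (Cmp C c' c) (Cmp C f b')"
    using Cmp_assoc[OF b' f c] Cmp_assoc[OF Cmp_Hom[OF b' f] c c'] by simp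
  also have "\<dots> = Cmp C f b'" using inv(2) Idn_Cmp[OF Cmp_Hom[OF b' f]] by simp
  finally show ?thesis by simp
qed

lemma (in category) kernel_transport:
  assumes kf: "is_kernel C k f" "k \<in> Hom C A B" "f \<in> Hom C B D"
    and kf': "k' \<in> Hom C A' B'" "f' \<in> Hom C B' D'"
    and abc: "is_iso C a" "a \<in> Hom C A A'" "is_iso C b" "b \<in> Hom C B B'" "is_iso C c" "c \<in> Hom C D D'"
    and sq: "Cmp C b k = Cmp C k' a" "Cmp C c f = Cmp C f' b"
  shows "is_kernel C k' f'"
proof -
  obtain a' where a': "a' \<in> Hom C A' A" "Cmp C a' a = Idn C A" "Cmp C a a' = Idn C A'"
    by (rule isoE[OF abc(1,2)])
  obtain b' where b': "b' \<in> Hom C B' B" "Cmp C b' b = Idn C B" "Cmp C b b' = Idn C B'"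
    by (rule isoE[OF abc(3,4)])
  obtain c' where c': "c' \<in> Hom C D' D" "Cmp C c' c = Idn C D" "Cmp C c c' = Idn C D'"
    by (rule isoE[OF abc(5,6)])
  have sq': "Cmp C k a' = Cmp C b' k'" "Cmp C f b' = Cmp C c' f'"
    using square_inverse[OF kf(2) kf'(1) abc(2,4) a'(1) b'(1) a'(3) b'(2) sq(1)]
      square_inverse[OF kf(3) kf'(2) abc(4,6) b'(1) c'(1) b'(3) c'(2) sq(2)] by auto
  show ?thesis
  proof (rule kernelI[OF kf'(2,1)])
    have "Cmp C f' k' = Cmp C (Cmp C f' b) (Cmp C b' k')"
      using Cmp_assoc[OF Cmp_Hom[OF kf'(1) b'(1)] abc(4) kf'(2)] Cmp_assoc[OF kf'(1) b'(1) abc(4)]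
        b'(3) Idn_Cmp[OF kf'(1)] by simp
    also have "\<dots> = Cmp C c (Cmp C (Cmp C f k) a')"
      unfolding sq(2)[symmetric] sq'(1)[symmetric]
      using Cmp_assoc[OF Cmp_Hom[OF a'(1) kf(2)] kf(3) abc(6)] Cmp_assoc[OF a'(1) kf(2,3)] by simp
    finally show "zero_arr C (Cmp C f' k')"
      using zero_arr_Cmp[OF Cmp_Hom[OF a'(1) Cmp_Hom[OF kf(2,3)]] abc(6)]
        zero_arr_Cmp[OF a'(1) Cmp_Hom[OF kf(2,3)]] kernel_zero[OF kf] by simp
  next
    fix X h assume h: "h \<in> Hom C X B'" and z: "zero_arr C (Cmp C f' h)"
    have "Cmp C f (Cmp C b' h) = Cmp C c' (Cmp C f' h)"
      using sq'(2) Cmp_assoc[OF h b'(1) kf(3)] Cmp_assoc[OF h kf'(2) c'(1)] by simp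
    moreover have "Cmp C f' h \<in> Hom C X D'" using h kf' Cmp_Hom by blast
    ultimately have "zero_arr C (Cmp C f (Cmp C b' h))" using zero_arr_Cmp[OF _ c'(1)] z by simp
    then obtain u where u: "u \<in> Hom C X A" "Cmp C k u = Cmp C b' h"
      using kernel_factor[OF kf] Cmp_Hom[OF h b'(1)] by blast
    have "Cmp C k' (Cmp C a u) = Cmp C (Cmp C b k) u"
      using sq(1) Cmp_assoc[OF u(1) abc(2) kf'(1)] by simp
    also have "\<dots> = Cmp C b (Cmp C b' h)"
      using u(2) Cmp_assoc[OF u(1) kf(2) abc(4)] by simp
    also have "\<dots> = h" using Cmp_assoc[OF h b'(1) abc(4)] b'(3) Idn_Cmp[OF h] by simp
    finally show "\<exists>u \<in> Hom C X A'. Cmp C k' u = h" using u abc(2) Cmp_Hom by blast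
  next
    fix X u v assume uv: "u \<in> Hom C X A'" "v \<in> Hom C X A'" "Cmp C k' u = Cmp C k' v"
    have "Cmp C k (Cmp C a' u) = Cmp C k (Cmp C a' v)"
      using sq'(1) uv(3) Cmp_assoc[OF uv(1) a'(1) kf(2)] Cmp_assoc[OF uv(2) a'(1) kf(2)]
        Cmp_assoc[OF uv(1) kf'(1) b'(1)] Cmp_assoc[OF uv(2) kf'(1) b'(1)] by simp
    then have "Cmp C a' u = Cmp C a' v"
      using kernel_mono[OF kf] uv a' Cmp_Hom by blast
    then show "u = v"
      using inv_cancel_left[OF a'(1) abc(2) a'(3) uv(1)] inv_cancel_left[OF a'(1) abc(2) a'(3) uv(2)]
      by metis
  qed
qed

lemma (in category) cokernel_transport:
  assumes "is_cokernel C p i" "i \<in> Hom C A B" "p \<in> Hom C B D"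
    and "i' \<in> Hom C A' B'" "p' \<in> Hom C B' D'"
    and "is_iso C a" "a \<in> Hom C A A'" "is_iso C b" "b \<in> Hom C B B'" "is_iso C c" "c \<in> Hom C D D'"
    and "Cmp C b i = Cmp C i' a" "Cmp C c p = Cmp C p' b"
  shows "is_cokernel C p' i'"
proof -
  obtain a' where a': "is_iso C a'" "a' \<in> Hom C A' A" "Cmp C a' a = Idn C A" "Cmp C a a' = Idn C A'"
    by (rule isoE[OF assms(6,7)])
  obtain b' where b': "is_iso C b'" "b' \<in> Hom C B' B" "Cmp C b' b = Idn C B" "Cmp C b b' = Idn C B'"
    by (rule isoE[OF assms(8,9)])
  obtain c' where c': "is_iso C c'" "c' \<in> Hom C D' D" "Cmp C c' c = Idn C D" "Cmp C c c' = Idn C D'"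
    by (rule isoE[OF assms(10,11)])
  have 1: "Cmp C p b' = Cmp C c' p'"
    by (rule square_inverse[OF assms(3,5,9,11) b'(2) c'(2) b'(4) c'(3) assms(13)])
  have 2: "Cmp C i a' = Cmp C b' i'"
    by (rule square_inverse[OF assms(2,4,7,9) a'(2) b'(2) a'(4) b'(3) assms(12)])
  show ?thesis
    using category.kernel_transport[OF category_op_cat[OF category_axioms],
      of p i D B A p' D' B' i' A' c' b' a'] assms a' b' c' 1 2
    by simp
qed

text \<open>
  The largest conflation structure of a category. It bounds the smallest conflation structure
  that contains given kernel-cokernel pairs.
\<close>

lemma (in category) conflation_structure_kernel_cokernel_pairs:
  "conflation_structure C {(i, p). kernel_cokernel_pair C i p}"
  unfolding conflation_structure_def
proof (clarsimp)
  fix i p i' p' a b c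
  assume ip: "kernel_cokernel_pair C i p" and i': "i' \<in> Arr C" and p': "p' \<in> Arr C"
    and cd: "Cod C i' = Dom C p'" and iso: "is_iso C a" "is_iso C b" "is_iso C c"
    and a: "a \<in> Hom C (Dom C i) (Dom C i')" and b: "b \<in> Hom C (Cod C i) (Dom C p')"
    and c: "c \<in> Hom C (Cod C p) (Cod C p')"
    and sq: "Cmp C b i = Cmp C i' a" "Cmp C c p = Cmp C p' b"
  have k: "is_kernel C i p" "is_cokernel C p i" using ip by (auto simp: kernel_cokernel_pair_def)
  then have h: "i \<in> Hom C (Dom C i) (Cod C i)" "p \<in> Hom C (Cod C i) (Cod C p)"
    by (auto simp: is_kernel_def Hom_def)
  have h': "i' \<in> Hom C (Dom C i') (Dom C p')" "p' \<in> Hom C (Dom C p') (Cod C p')"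
    using i' p' cd by (auto simp: Hom_def)
  show "kernel_cokernel_pair C i' p'"
    using kernel_transport[OF k(1) h h' iso(1) a iso(2) b iso(3) c sq]
      cokernel_transport[OF k(2) h h' iso(1) a iso(2) b iso(3) c sq]
    by (simp add: kernel_cokernel_pair_def)
qed

lemma (in category) conflation_structure_iso:
  assumes S: "conflation_structure C S" and ip: "(i, p) \<in> S" "i \<in> Hom C A B" "p \<in> Hom C B D"
    and ip': "i' \<in> Hom C A' B'" "p' \<in> Hom C B' D'"
    and abc: "is_iso C a" "a \<in> Hom C A A'" "is_iso C b" "b \<in> Hom C B B'" "is_iso C c" "c \<in> Hom C D D'"
    and sq: "Cmp C b i = Cmp C i' a" "Cmp C c p = Cmp C p' b"
  shows "(i', p') \<in> S"
proof -
  have "\<forall>i' \<in> Arr C. \<forall>p' \<in> Arr C. \<forall>a b c.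
      Cod C i' = Dom C p' \<and> is_iso C a \<and> is_iso C b \<and> is_iso C c \<and>
      a \<in> Hom C (Dom C i) (Dom C i') \<and> b \<in> Hom C (Cod C i) (Cod C i') \<and>
      c \<in> Hom C (Cod C p) (Cod C p') \<and>
      Cmp C b i = Cmp C i' a \<and> Cmp C c p = Cmp C p' b \<longrightarrow> (i', p') \<in> S"
    using S ip(1) unfolding conflation_structure_def by blast
  from this[rule_format, of i' p' a b c] show ?thesis
    using HomD[OF ip(2)] HomD[OF ip(3)] HomD[OF ip'(1)] HomD[OF ip'(2)] abc sq by simp
qed

lemma (in category) kernel_cokernel_pair_iso:
  assumes uv: "kernel_cokernel_pair C u v" "u \<in> Hom C A' B'" "v \<in> Hom C B' D'"
    and ip: "i \<in> Hom C A B" "p \<in> Hom C B D"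
    and abc: "is_iso C a" "a \<in> Hom C A A'" "is_iso C b" "b \<in> Hom C B B'" "is_iso C c" "c \<in> Hom C D D'"
    and sq: "Cmp C b i = Cmp C u a" "Cmp C c p = Cmp C v b"
  shows "kernel_cokernel_pair C i p"
proof -
  obtain a' where a': "a' \<in> Hom C A' A" "Cmp C a' a = Idn C A" "Cmp C a a' = Idn C A'" "is_iso C a'"
    by (rule isoE[OF abc(1,2)])
  obtain b' where b': "b' \<in> Hom C B' B" "Cmp C b' b = Idn C B" "Cmp C b b' = Idn C B'" "is_iso C b'"
    by (rule isoE[OF abc(3,4)])
  obtain c' where c': "c' \<in> Hom C D' D" "Cmp C c' c = Idn C D" "Cmp C c c' = Idn C D'" "is_iso C c'"
    by (rule isoE[OF abc(5,6)])
  note sq' = square_inverse[OF ip(1) uv(2) abc(2,4) a'(1) b'(1) a'(3) b'(2) sq(1), symmetric]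
    square_inverse[OF ip(2) uv(3) abc(4,6) b'(1) c'(1) b'(3) c'(2) sq(2), symmetric]
  show ?thesis
    by (rule conflation_structure_iso[OF conflation_structure_kernel_cokernel_pairs, simplified,
          OF uv ip a'(4,1) b'(4,1) c'(4,1) sq'])
qed

lemma category_full_subcat: "category C \<Longrightarrow> category (full_subcat C S)"
  unfolding category_def full_subcat_def Hom_def by auto

locale cat_functor =
  fixes C :: "('o, 'a, 'm) cat_scheme" and D :: "('p, 'b, 'n) cat_scheme" and Fo Fa
  assumes is_functor: "is_functor C D Fo Fa"
begin

lemma categories: "category C" "category D"
  using is_functor by (auto simp: is_functor_def)

lemma Fo_Obj: "A \<in> Obj C \<Longrightarrow> Fo A \<in> Obj D"
  and Fa_Idn: "A \<in> Obj C \<Longrightarrow> Fa (Idn C A) = Idn D (Fo A)"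
  using is_functor by (auto simp: is_functor_def)

lemma Fa_Hom: "f \<in> Hom C A B \<Longrightarrow> Fa f \<in> Hom D (Fo A) (Fo B)"
  using is_functor by (auto simp: is_functor_def Hom_def)

lemma Fa_Cmp: "f \<in> Hom C A B \<Longrightarrow> g \<in> Hom C B X \<Longrightarrow> Fa (Cmp C g f) = Cmp D (Fa g) (Fa f)"
  using is_functor by (auto simp: is_functor_def Hom_def)

end

text \<open>
  This characterization of equivalences involves no inverse functor and is self-dual, so that
  statements about cokernels follow from those about kernels.
\<close>

locale ff_es_functor = cat_functor +
  assumes full: "A \<in> Obj C \<Longrightarrow> B \<in> Obj C \<Longrightarrow> g \<in> Hom D (Fo A) (Fo B) \<Longrightarrow> \<exists>f \<in> Hom C A B. Fa f = g"
    and faithful: "f \<in> Hom C A B \<Longrightarrow> f' \<in> Hom C A B \<Longrightarrow> Fa f = Fa f' \<Longrightarrow> f = f'"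
    and ess_surj: "Y \<in> Obj D \<Longrightarrow> \<exists>X \<in> Obj C. \<exists>t \<in> Hom D (Fo X) Y. is_iso D t"

lemma ff_es_functor_op_cat:
  assumes "ff_es_functor C D Fo Fa"
  shows "ff_es_functor (op_cat C) (op_cat D) Fo Fa"
proof -
  interpret ff_es_functor C D Fo Fa by fact
  interpret D: category D by (rule categories)
  show ?thesis
  proof unfold_locales
    show "is_functor (op_cat C) (op_cat D) Fo Fa" by (rule is_functor_op_cat[OF is_functor])
    fix Y assume "Y \<in> Obj (op_cat D)"
    then have "\<exists>X \<in> Obj C. \<exists>t \<in> Hom D (Fo X) Y. is_iso D t" using ess_surj by simp
    then obtain X t where t: "X \<in> Obj C" "t \<in> Hom D (Fo X) Y" "is_iso D t" by blast
    obtain t' where "t' \<in> Hom D Y (Fo X)" "is_iso D t'" by (rule D.isoE[OF t(3,2)])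
    with t show "\<exists>X \<in> Obj (op_cat C). \<exists>t \<in> Hom (op_cat D) (Fo X) Y. is_iso (op_cat D) t" by auto
  qed (use full faithful in simp_all)
qed

context ff_es_functor
begin

lemma Fa_iso_reflect:
  assumes "f \<in> Hom C A B" "is_iso D (Fa f)"
  shows "is_iso C f"
proof -
  interpret C: category C by (rule categories)
  interpret D: category D by (rule categories)
  have AB: "A \<in> Obj C" "B \<in> Obj C" using C.HomD[OF assms(1)] by auto
  obtain g where g: "g \<in> Hom D (Fo B) (Fo A)" "Cmp D g (Fa f) = Idn D (Fo A)"
      "Cmp D (Fa f) g = Idn D (Fo B)"
    using D.isoE[OF assms(2) Fa_Hom[OF assms(1)]] by metis
  obtain g' where g': "g' \<in> Hom C B A" "Fa g' = g" using full[OF AB(2,1) g(1)] by blast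
  have "Cmp C g' f = Idn C A"
    by (rule faithful[OF C.Cmp_Hom[OF assms(1) g'(1)] C.Idn_Hom[OF AB(1)]])
      (simp add: Fa_Cmp[OF assms(1) g'(1)] g' g Fa_Idn AB)
  moreover have "Cmp C f g' = Idn C B"
    by (rule faithful[OF C.Cmp_Hom[OF g'(1) assms(1)] C.Idn_Hom[OF AB(2)]])
      (simp add: Fa_Cmp[OF g'(1) assms(1)] g' g Fa_Idn AB)
  ultimately show ?thesis using C.isoI[OF assms(1) g'(1)] by simp
qed

text \<open>
  The inverse functor and the unit are determined by the chosen isomorphisms \<open>\<epsilon>\<close>: an arrow into
  \<open>Go Y\<close> is known once its image is composed with \<open>\<epsilon> Y\<close> (\<open>cancel\<close>), and every arrow into \<open>Y\<close> arises
  in this way (\<open>lift\<close>).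
\<close>

lemma is_equivalence: "is_equivalence C D Fo Fa"
proof -
  interpret C: category C by (rule categories)
  interpret D: category D by (rule categories)
  obtain Go \<epsilon> where G: "\<And>Y. Y \<in> Obj D \<Longrightarrow> Go Y \<in> Obj C \<and> \<epsilon> Y \<in> Hom D (Fo (Go Y)) Y \<and> is_iso D (\<epsilon> Y)"
    using ess_surj by metis
  then have \<epsilon>: "\<epsilon> Y \<in> Hom D (Fo (Go Y)) Y" if "Y \<in> Obj D" for Y using that by blast
  have cancel: "f = f'" if "Y \<in> Obj D" "f \<in> Hom C A (Go Y)" "f' \<in> Hom C A (Go Y)"
    "Cmp D (\<epsilon> Y) (Fa f) = Cmp D (\<epsilon> Y) (Fa f')" for f f' A Y
    using D.iso_cancel_left[of "\<epsilon> Y"] G[OF that(1)] Fa_Hom that faithful by metis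
  have lift: "\<exists>f \<in> Hom C A (Go Y). Cmp D (\<epsilon> Y) (Fa f) = g"
    if A: "A \<in> Obj C" and g: "g \<in> Hom D (Fo A) Y" for g A Y
  proof -
    have Y: "Y \<in> Obj D" using D.HomD[OF g] by auto
    obtain e where e: "e \<in> Hom D Y (Fo (Go Y))" "Cmp D (\<epsilon> Y) e = Idn D Y"
      using D.isoE[of "\<epsilon> Y"] G[OF Y] by metis
    obtain f where f: "f \<in> Hom C A (Go Y)" "Fa f = Cmp D e g"
      using full[OF A _ D.Cmp_Hom[OF g e(1)]] G[OF Y] by blast
    have "Cmp D (\<epsilon> Y) (Fa f) = g"
      unfolding f(2) using D.inv_cancel_left[OF e(1) _ e(2) g] G[OF Y] by simp
    with f(1) show ?thesis by blast
  qed
  have "\<exists>f \<in> Hom C (Go (Dom D g)) (Go (Cod D g)).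
      Cmp D (\<epsilon> (Cod D g)) (Fa f) = Cmp D g (\<epsilon> (Dom D g))" if "g \<in> Arr D" for g
    using lift G D.Dom_Obj[OF that] D.Cmp_Hom[OF _ D.Arr_Hom[OF that]] by blast
  then obtain Ga where Ga: "\<And>g. g \<in> Arr D \<Longrightarrow> Ga g \<in> Hom C (Go (Dom D g)) (Go (Cod D g)) \<and>
      Cmp D (\<epsilon> (Cod D g)) (Fa (Ga g)) = Cmp D g (\<epsilon> (Dom D g))"
    by metis
  have GH: "Ga g \<in> Hom C (Go A) (Go B)" "Cmp D (\<epsilon> B) (Fa (Ga g)) = Cmp D g (\<epsilon> A)"
    if "g \<in> Hom D A B" for g A B
    using Ga[of g] D.HomD[OF that] by auto
  have Gf: "is_functor D C Go Ga"
    unfolding is_functor_def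
  proof (intro conjI ballI impI)
    fix A assume A: "A \<in> Obj D"
    show "Go A \<in> Obj C" using G[OF A] by simp
    show "Ga (Idn D A) = Idn C (Go A)"
    proof (rule cancel[OF A])
      show "Cmp D (\<epsilon> A) (Fa (Ga (Idn D A))) = Cmp D (\<epsilon> A) (Fa (Idn C (Go A)))"
        using GH(2)[OF D.Idn_Hom[OF A]] Fa_Idn[of "Go A"] G[OF A] D.Idn_Cmp[of "\<epsilon> A"] D.Cmp_Idn[of "\<epsilon> A"]
        by auto
    next
      show "Ga (Idn D A) \<in> Hom C (Go A) (Go A)" by (rule GH(1)[OF D.Idn_Hom[OF A]])
      show "Idn C (Go A) \<in> Hom C (Go A) (Go A)" using C.Idn_Hom G[OF A] by blast
    qed
  next
    fix f assume "f \<in> Arr D" then show "Ga f \<in> Hom C (Go (Dom D f)) (Go (Cod D f))" using Ga by simp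
  next
    fix f g assume "f \<in> Arr D" "g \<in> Arr D" "Cod D f = Dom D g"
    then obtain X Y Z where fg: "f \<in> Hom D X Y" "g \<in> Hom D Y Z" by (auto simp: Hom_def)
    have XYZ: "X \<in> Obj D" "Y \<in> Obj D" "Z \<in> Obj D" using D.HomD[OF fg(1)] D.HomD[OF fg(2)] by auto
    note gf = D.Cmp_Hom[OF fg]
    show "Ga (Cmp D g f) = Cmp C (Ga g) (Ga f)"
    proof (rule cancel[OF XYZ(3) GH(1)[OF gf] C.Cmp_Hom[OF GH(1)[OF fg(1)] GH(1)[OF fg(2)]]])
      have "Cmp D (\<epsilon> Z) (Fa (Cmp C (Ga g) (Ga f))) = Cmp D (Cmp D (\<epsilon> Z) (Fa (Ga g))) (Fa (Ga f))"
        using Fa_Cmp[OF GH(1)[OF fg(1)] GH(1)[OF fg(2)]]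
          D.Cmp_assoc[OF Fa_Hom[OF GH(1)[OF fg(1)]] Fa_Hom[OF GH(1)[OF fg(2)]] \<epsilon>[OF XYZ(3)]] by simp
      also have "\<dots> = Cmp D g (Cmp D (\<epsilon> Y) (Fa (Ga f)))"
        unfolding GH(2)[OF fg(2)]
        using D.Cmp_assoc[OF Fa_Hom[OF GH(1)[OF fg(1)]] \<epsilon>[OF XYZ(2)] fg(2)] by simp
      also have "\<dots> = Cmp D (Cmp D g f) (\<epsilon> X)"
        unfolding GH(2)[OF fg(1)] using D.Cmp_assoc[OF \<epsilon>[OF XYZ(1)] fg] by simp
      finally show "Cmp D (\<epsilon> Z) (Fa (Ga (Cmp D g f))) = Cmp D (\<epsilon> Z) (Fa (Cmp C (Ga g) (Ga f)))"
        using GH(2)[OF gf] by simp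
    qed
  qed (fact categories)+
  have "\<exists>f \<in> Hom C A (Go (Fo A)). Cmp D (\<epsilon> (Fo A)) (Fa f) = Idn D (Fo A)" if "A \<in> Obj C" for A
    using lift D.Idn_Hom Fo_Obj that by blast
  then obtain \<eta> where \<eta>: "\<And>A. A \<in> Obj C \<Longrightarrow> \<eta> A \<in> Hom C A (Go (Fo A)) \<and>
      Cmp D (\<epsilon> (Fo A)) (Fa (\<eta> A)) = Idn D (Fo A)"
    by metis
  have "natural_iso C C (\<lambda>A. A) (\<lambda>f. f) (Go \<circ> Fo) (Ga \<circ> Fa) \<eta>"
    unfolding natural_iso_def
  proof (intro conjI ballI)
    fix A assume A: "A \<in> Obj C"
    show "\<eta> A \<in> Hom C A ((Go \<circ> Fo) A)" using \<eta>[OF A] by simp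
    obtain e where e: "e \<in> Hom D (Fo A) (Fo (Go (Fo A)))" "Cmp D e (\<epsilon> (Fo A)) = Idn D (Fo (Go (Fo A)))"
        "is_iso D e"
      using D.isoE[of "\<epsilon> (Fo A)"] G[OF Fo_Obj[OF A]] by metis
    have \<eta>A: "Fa (\<eta> A) \<in> Hom D (Fo A) (Fo (Go (Fo A)))" using Fa_Hom \<eta>[OF A] by blast
    have "Fa (\<eta> A) = Cmp D e (Cmp D (\<epsilon> (Fo A)) (Fa (\<eta> A)))"
      using D.inv_cancel_left[OF _ e(1,2) \<eta>A] G[OF Fo_Obj[OF A]] by simp
    also have "\<dots> = e" using \<eta>[OF A] D.Cmp_Idn[OF e(1)] by simp
    finally show "is_iso C (\<eta> A)" using Fa_iso_reflect \<eta>[OF A] e by metis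
  next
    fix f assume "f \<in> Arr C"
    then obtain A B where AB: "f \<in> Hom C A B" by (auto simp: Hom_def)
    have o: "A \<in> Obj C" "B \<in> Obj C" "Dom C f = A" "Cod C f = B" using C.HomD[OF AB] by auto
    note f' = GH[OF Fa_Hom[OF AB]]
    have "Cmp C (\<eta> B) f = Cmp C (Ga (Fa f)) (\<eta> A)"
    proof (rule cancel[OF Fo_Obj[OF o(2)]])
      have hA: "\<eta> A \<in> Hom C A (Go (Fo A))" and hB: "\<eta> B \<in> Hom C B (Go (Fo B))"
        and eA: "\<epsilon> (Fo A) \<in> Hom D (Fo (Go (Fo A))) (Fo A)"
        and eB: "\<epsilon> (Fo B) \<in> Hom D (Fo (Go (Fo B))) (Fo B)"
        using \<eta> o G Fo_Obj by auto
      have "Cmp D (\<epsilon> (Fo B)) (Fa (Cmp C (\<eta> B) f)) = Fa f"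
        using Fa_Cmp[OF AB hB] D.Cmp_assoc[OF Fa_Hom[OF AB] Fa_Hom[OF hB] eB]
          \<eta>[OF o(2)] D.Idn_Cmp[OF Fa_Hom[OF AB]] by simp
      moreover have "Cmp D (\<epsilon> (Fo B)) (Fa (Cmp C (Ga (Fa f)) (\<eta> A)))
          = Cmp D (Cmp D (\<epsilon> (Fo B)) (Fa (Ga (Fa f)))) (Fa (\<eta> A))"
        using Fa_Cmp[OF hA f'(1)] D.Cmp_assoc[OF Fa_Hom[OF hA] Fa_Hom[OF f'(1)] eB] by simp
      moreover have "\<dots> = Fa f"
        unfolding f'(2) using \<eta>[OF o(1)] D.Cmp_assoc[OF Fa_Hom[OF hA] eA Fa_Hom[OF AB]]
          D.Cmp_Idn[OF Fa_Hom[OF AB]] by simp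
      ultimately show "Cmp D (\<epsilon> (Fo B)) (Fa (Cmp C (\<eta> B) f))
          = Cmp D (\<epsilon> (Fo B)) (Fa (Cmp C (Ga (Fa f)) (\<eta> A)))" by simp
    next
      show "Cmp C (\<eta> B) f \<in> Hom C A (Go (Fo B))" using C.Cmp_Hom[OF AB] \<eta>[OF o(2)] by blast
      show "Cmp C (Ga (Fa f)) (\<eta> A) \<in> Hom C A (Go (Fo B))" using C.Cmp_Hom[OF _ f'(1)] \<eta>[OF o(1)] by blast
    qed
    then show "Cmp C (\<eta> (Cod C f)) f = Cmp C ((Ga \<circ> Fa) f) (\<eta> (Dom C f))" using o by simp
  qed
  moreover have "natural_iso D D (Fo \<circ> Go) (Fa \<circ> Ga) (\<lambda>A. A) (\<lambda>f. f) \<epsilon>"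
    using G Ga by (auto simp: natural_iso_def)
  ultimately show ?thesis using is_functor Gf by (auto simp: is_equivalence_def)
qed

lemma is_zero_image:
  assumes Z: "is_zero C Z"
  shows "is_zero D (Fo Z)"
proof -
  interpret C: category C by (rule categories)
  interpret D: category D by (rule categories)
  have ZO: "Z \<in> Obj C" using Z by (simp add: is_zero_def)
  show ?thesis
    unfolding is_zero_def
  proof (intro conjI ballI)
    show "Fo Z \<in> Obj D" using Fo_Obj ZO .
    fix Y assume "Y \<in> Obj D"
    then obtain X t where X: "X \<in> Obj C" "t \<in> Hom D (Fo X) Y" "is_iso D t" using ess_surj by blast
    obtain t' where t': "t' \<in> Hom D Y (Fo X)" "is_iso D t'" by (rule D.isoE[OF X(3,2)])
    obtain f where f: "f \<in> Hom C X Z" "\<And>f'. f' \<in> Hom C X Z \<Longrightarrow> f' = f"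
      using C.zero_to[OF Z X(1)] by blast
    obtain g where g: "g \<in> Hom C Z X" "\<And>g'. g' \<in> Hom C Z X \<Longrightarrow> g' = g"
      using C.zero_from[OF Z X(1)] by blast
    have 1: "h = Fa f" if h: "h \<in> Hom D (Fo X) (Fo Z)" for h
      using full[OF X(1) ZO h] f(2) by blast
    have 2: "h = Fa g" if h: "h \<in> Hom D (Fo Z) (Fo X)" for h
      using full[OF ZO X(1) h] g(2) by blast
    show "\<exists>!h. h \<in> Hom D Y (Fo Z)"
    proof (rule ex1I)
      show "Cmp D (Fa f) t' \<in> Hom D Y (Fo Z)" by (rule D.Cmp_Hom[OF t'(1) Fa_Hom[OF f(1)]])
      then show "h = Cmp D (Fa f) t'" if "h \<in> Hom D Y (Fo Z)" for h
        using D.iso_cancel_right[OF X(3,2) that] 1[OF D.Cmp_Hom[OF X(2) that]]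
          1[OF D.Cmp_Hom[OF X(2)]] by simp
    qed
    show "\<exists>!h. h \<in> Hom D (Fo Z) Y"
    proof (rule ex1I)
      show "Cmp D t (Fa g) \<in> Hom D (Fo Z) Y" by (rule D.Cmp_Hom[OF Fa_Hom[OF g(1)] X(2)])
      then show "h = Cmp D t (Fa g)" if "h \<in> Hom D (Fo Z) Y" for h
        using D.iso_cancel_left[OF t'(2,1) that] 2[OF D.Cmp_Hom[OF that t'(1)]]
          2[OF D.Cmp_Hom[OF _ t'(1)]] by simp
    qed
  qed
qed

lemma zero_arr_image:
  assumes Z: "is_zero C Z" and f: "f \<in> Hom C A B"
  shows "zero_arr D (Fa f) \<longleftrightarrow> zero_arr C f"
proof -
  interpret C: category C by (rule categories)
  interpret D: category D by (rule categories)
  have AB: "A \<in> Obj C" "B \<in> Obj C" "Z \<in> Obj C" using C.HomD[OF f] Z by (auto simp: is_zero_def)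
  note C = C.zero_arr_via[OF Z f] and D = D.zero_arr_via[OF is_zero_image[OF Z] Fa_Hom[OF f]]
  show ?thesis
  proof
    assume "zero_arr D (Fa f)"
    then obtain g h where gh: "g \<in> Hom D (Fo A) (Fo Z)" "h \<in> Hom D (Fo Z) (Fo B)" "Fa f = Cmp D h g"
      using D by blast
    then obtain g' h' where gh': "g' \<in> Hom C A Z" "h' \<in> Hom C Z B" "Fa g' = g" "Fa h' = h"
      using full[OF AB(1,3) gh(1)] full[OF AB(3,2) gh(2)] by blast
    then have "f = Cmp C h' g'"
      using faithful[OF f C.Cmp_Hom[OF gh'(1,2)]] Fa_Cmp[OF gh'(1,2)] gh(3) by simp
    then show "zero_arr C f" using C gh' by blast
  next
    assume "zero_arr C f"
    then obtain g h where gh: "g \<in> Hom C A Z" "h \<in> Hom C Z B" "f = Cmp C h g" using C by blast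
    then show "zero_arr D (Fa f)" using D Fa_Cmp[OF gh(1,2)] Fa_Hom[OF gh(1)] Fa_Hom[OF gh(2)] by blast
  qed
qed

text \<open>
  Test objects of \<open>D\<close> are replaced by isomorphic images of objects of \<open>C\<close>. The zero object serves to
  recognize zero arrows on both sides.
\<close>

lemma kernel_image:
  assumes Z: "is_zero C Z" and k: "k \<in> Hom C A B" and f: "f \<in> Hom C B X"
  shows "is_kernel D (Fa k) (Fa f) \<longleftrightarrow> is_kernel C k f"
proof -
  interpret C: category C by (rule categories)
  interpret D: category D by (rule categories)
  have AB: "A \<in> Obj C" "B \<in> Obj C" "Z \<in> Obj C" using C.HomD[OF k] Z by (auto simp: is_zero_def)
  have z: "zero_arr D (Cmp D (Fa f) (Fa h)) \<longleftrightarrow> zero_arr C (Cmp C f h)" if "h \<in> Hom C T B" for h T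
    using zero_arr_image[OF Z C.Cmp_Hom[OF that f]] Fa_Cmp[OF that f] by simp
  show ?thesis
  proof
    assume K: "is_kernel D (Fa k) (Fa f)"
    note K = D.kernelD[OF K Fa_Hom[OF k] Fa_Hom[OF f]]
    show "is_kernel C k f"
    proof (rule C.kernelI[OF f k])
      show "zero_arr C (Cmp C f k)" using K(1) z k by blast
      fix T h assume h: "h \<in> Hom C T B" "zero_arr C (Cmp C f h)"
      have T: "T \<in> Obj C" using C.HomD[OF h(1)] by simp
      obtain U where U: "U \<in> Hom D (Fo T) (Fo A)" "Cmp D (Fa k) U = Fa h"
        using K(2)[OF Fa_Hom[OF h(1)]] z[OF h(1)] h(2) by blast
      then obtain u where u: "u \<in> Hom C T A" "Cmp D (Fa k) (Fa u) = Fa h"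
        using full[OF T AB(1) U(1)] by blast
      then show "\<exists>u \<in> Hom C T A. Cmp C k u = h"
        using faithful[OF C.Cmp_Hom[OF u(1) k] h(1)] Fa_Cmp[OF u(1) k] by auto
    next
      fix T u v assume uv: "u \<in> Hom C T A" "v \<in> Hom C T A" "Cmp C k u = Cmp C k v"
      then have "Cmp D (Fa k) (Fa u) = Cmp D (Fa k) (Fa v)"
        using Fa_Cmp[OF uv(1) k] Fa_Cmp[OF uv(2) k] by simp
      then show "u = v" using K(3)[OF Fa_Hom[OF uv(1)] Fa_Hom[OF uv(2)]] faithful[OF uv(1,2)] by simp
    qed
  next
    assume K: "is_kernel C k f"
    note K = C.kernelD[OF K k f]
    show "is_kernel D (Fa k) (Fa f)"
    proof (rule D.kernelI[OF Fa_Hom[OF f] Fa_Hom[OF k]])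
      show "zero_arr D (Cmp D (Fa f) (Fa k))" using K(1) z k by blast
      fix Y h assume h: "h \<in> Hom D Y (Fo B)" "zero_arr D (Cmp D (Fa f) h)"
      then obtain T t where T: "T \<in> Obj C" "t \<in> Hom D (Fo T) Y" "is_iso D t"
        using ess_surj D.HomD[OF h(1)] by blast
      obtain t' where t': "t' \<in> Hom D Y (Fo T)" "Cmp D t t' = Idn D Y" by (rule D.isoE[OF T(3,2)])
      obtain h' where h': "h' \<in> Hom C T B" "Fa h' = Cmp D h t"
        using full[OF T(1) AB(2)] D.Cmp_Hom[OF T(2) h(1)] by blast
      have "Cmp D (Fa f) (Fa h') = Cmp D (Cmp D (Fa f) h) t"
        using h' D.Cmp_assoc[OF T(2) h(1) Fa_Hom[OF f]] by simp
      then have "zero_arr C (Cmp C f h')"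
        using D.zero_arr_Cmp[OF T(2) D.Cmp_Hom[OF h(1) Fa_Hom[OF f]]] h(2) z[OF h'(1)] by simp
      then obtain u where u: "u \<in> Hom C T A" "Cmp C k u = h'" using K(2) h' by blast
      have "Cmp D (Fa k) (Cmp D (Fa u) t') = Cmp D (Fa h') t'"
        using u(2) Fa_Cmp[OF u(1) k] D.Cmp_assoc[OF t'(1) Fa_Hom[OF u(1)] Fa_Hom[OF k]] by simp
      also have "\<dots> = h" unfolding h'(2) by (rule D.inv_cancel_right[OF t'(1) T(2) t'(2) h(1)])
      finally show "\<exists>u \<in> Hom D Y (Fo A). Cmp D (Fa k) u = h"
        using D.Cmp_Hom[OF t'(1) Fa_Hom[OF u(1)]] by blast
    next
      fix Y u v assume uv: "u \<in> Hom D Y (Fo A)" "v \<in> Hom D Y (Fo A)" "Cmp D (Fa k) u = Cmp D (Fa k) v"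
      then obtain T t where T: "T \<in> Obj C" "t \<in> Hom D (Fo T) Y" "is_iso D t"
        using ess_surj D.HomD[OF uv(1)] by blast
      obtain u' v' where uv': "u' \<in> Hom C T A" "Fa u' = Cmp D u t" "v' \<in> Hom C T A" "Fa v' = Cmp D v t"
        using full[OF T(1) AB(1) D.Cmp_Hom[OF T(2) uv(1)]] full[OF T(1) AB(1) D.Cmp_Hom[OF T(2) uv(2)]]
        by blast
      have "Fa (Cmp C k u') = Fa (Cmp C k v')"
        using Fa_Cmp[OF uv'(1) k] Fa_Cmp[OF uv'(3) k] uv'(2,4) uv(3)
          D.Cmp_assoc[OF T(2) uv(1) Fa_Hom[OF k]] D.Cmp_assoc[OF T(2) uv(2) Fa_Hom[OF k]] by simp
      then have "u' = v'"
        using faithful[OF C.Cmp_Hom[OF uv'(1) k] C.Cmp_Hom[OF uv'(3) k]] K(3)[OF uv'(1,3)] by simp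
      then show "u = v" using uv'(2,4) D.iso_cancel_right[OF T(3,2) uv(1,2)] by simp
    qed
  qed
qed

lemma kernel_cokernel_pair_image:
  assumes Z: "is_zero C Z" and i: "i \<in> Hom C A B" and p: "p \<in> Hom C B X"
  shows "kernel_cokernel_pair D (Fa i) (Fa p) \<longleftrightarrow> kernel_cokernel_pair C i p"
proof -
  interpret op: ff_es_functor "op_cat C" "op_cat D" Fo Fa
    using ff_es_functor_op_cat ff_es_functor_axioms .
  show ?thesis
    using kernel_image[OF assms] op.kernel_image[of Z p X B i A] assms
    by (simp add: kernel_cokernel_pair_def)
qed

end

section \<open>Localizations and local objects\<close>

locale localizing = category C for C :: "('o, 'a, 'm) cat_scheme" +
  fixes W :: "'a set"
  assumes W_Arr: "W \<subseteq> Arr C"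
begin

abbreviation "L \<equiv> localization C W"
abbreviation "zz \<equiv> zigzag C W"
abbreviation "zz_eq \<equiv> zigzag_eq C W"
abbreviation "zz_class \<equiv> zigzag_class C W"

lemma zigzag_Obj: "zz x p y \<Longrightarrow> x \<in> Obj C \<and> y \<in> Obj C"
proof (induction p arbitrary: x)
  case (Cons a p)
  then show ?case using Dom_Obj Cod_Obj by (cases a) auto
qed simp

lemma zigzag_append: "zz x (p @ q) z \<longleftrightarrow> (\<exists>y. zz x p y \<and> zz y q z)"
proof (induction p arbitrary: x)
  case Nil
  then show ?case using zigzag_Obj by auto
next
  case (Cons a p)
  then show ?case by (cases a) auto
qed

lemma zigzag_target_unique: "zz x p y \<Longrightarrow> zz x p y' \<Longrightarrow> y = y'"
proof (induction p arbitrary: x)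
  case (Cons a p)
  then show ?case by (cases a) auto
qed simp

lemma zigzag_source_unique: "zz x p y \<Longrightarrow> zz x' p y \<Longrightarrow> x = x'"
proof (cases p)
  case (Cons a q)
  then show "zz x p y \<Longrightarrow> zz x' p y \<Longrightarrow> x = x'" by (cases a) auto
qed simp

lemma zigzag_eq_zigzag:
  assumes "(p, q) \<in> zz_eq x y"
  shows "zz x p y \<and> zz x q y"
  using assms by (induction rule: zigzag_eq.induct) auto

text \<open>
  The relation is closed under rewriting in the middle of a zigzag by construction; closure under
  prolongation makes concatenation of classes well defined.
\<close>

lemma zigzag_eq_append:
  assumes "(p, q) \<in> zz_eq x y" "zz w u x" "zz y v z"
  shows "(u @ p @ v, u @ q @ v) \<in> zz_eq w z"
  using assms
proof (induction rule: zigzag_eq.induct)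
  case (refl p)
  then show ?case using zigzag_append by (intro zigzag_eq.refl) blast
next
  case (step l r a b)
  have "zz w ((u @ a) @ l @ (b @ v)) z" "zz w ((u @ a) @ r @ (b @ v)) z"
    using step unfolding zigzag_append by blast+
  from zigzag_eq.step[OF step(1) this] show ?case by simp
next
  case (sym p q)
  show ?case by (rule zigzag_eq.sym[OF sym(2)[OF sym(3,4)]])
next
  case (trans p q r)
  show ?case by (rule zigzag_eq.trans[OF trans(3)[OF trans(5,6)] trans(4)[OF trans(5,6)]])
qed

lemma zigzag_class_eq_iff:
  assumes "zz x p y"
  shows "zz_class x p y = zz_class x q y \<longleftrightarrow> (p, q) \<in> zz_eq x y"
proof
  assume "zz_class x p y = zz_class x q y"
  then have "p \<in> zz_eq x y `` {q}"
    using zigzag_eq.refl[OF assms] by (auto simp: zigzag_class_def)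
  then show "(p, q) \<in> zz_eq x y" by (auto intro: zigzag_eq.sym)
next
  assume pq: "(p, q) \<in> zz_eq x y"
  show "zz_class x p y = zz_class x q y"
    using zigzag_eq.trans[OF pq] zigzag_eq.trans[OF zigzag_eq.sym[OF pq]]
    by (auto simp: zigzag_class_def)
qed

lemma Obj_loc: "Obj L = Obj C"
  by (simp add: localization_def)

lemma Hom_loc: "Hom L x y = {zz_class x p y | p. zz x p y}"
  by (auto simp: localization_def Hom_def zigzag_class_def)

lemma Arr_loc_Hom: "t \<in> Arr L \<Longrightarrow> \<exists>x y p. t = zz_class x p y \<and> zz x p y"
  by (auto simp: localization_def)

lemma Cmp_loc:
  assumes p: "zz x p y" and q: "zz y q z"
  shows "Cmp L (zz_class y q z) (zz_class x p y) = zz_class x (p @ q) z"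
proof -
  have *: "zz_eq x z `` {p' @ q'} = zz_eq x z `` {p @ q}"
    if "(p, p') \<in> zz_eq x y" "(q, q') \<in> zz_eq y z" for p' q'
  proof -
    have "zz x [] x" "zz z [] z" using zigzag_Obj p q by auto
    then have "(p @ q, p' @ q) \<in> zz_eq x z" "(p' @ q, p' @ q') \<in> zz_eq x z"
      using zigzag_eq_append[OF that(1), of x "[]" q z] q
        zigzag_eq_append[OF that(2), of x p' "[]" z] zigzag_eq_zigzag[OF that(1)] by auto
    then have pq: "(p @ q, p' @ q') \<in> zz_eq x z" by (rule zigzag_eq.trans)
    show ?thesis
      using zigzag_eq.trans[OF pq] zigzag_eq.trans[OF zigzag_eq.sym[OF pq]] by blast
  qed
  have "(\<Union>p' \<in> zz_eq x y `` {p}. \<Union>q' \<in> zz_eq y z `` {q}. zz_eq x z `` {p' @ q'})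
      = zz_eq x z `` {p @ q}"
  proof (intro subset_antisym subsetI)
    fix r assume "r \<in> zz_eq x z `` {p @ q}"
    then show "r \<in> (\<Union>p' \<in> zz_eq x y `` {p}. \<Union>q' \<in> zz_eq y z `` {q}.
        zz_eq x z `` {p' @ q'})"
      using zigzag_eq.refl[OF p] zigzag_eq.refl[OF q] by blast
  next
    fix r assume "r \<in> (\<Union>p' \<in> zz_eq x y `` {p}. \<Union>q' \<in> zz_eq y z `` {q}.
        zz_eq x z `` {p' @ q'})"
    then show "r \<in> zz_eq x z `` {p @ q}" using * by blast
  qed
  then show ?thesis by (simp add: localization_def zigzag_class_def)
qed

lemma Idn_loc: "Idn L x = zz_class x [] x"
  by (simp add: localization_def)

lemma category_loc: "category L"
proof
  fix f assume "f \<in> Arr L"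
  then obtain x y p where f: "f = zz_class x p y" "zz x p y"
    using Arr_loc_Hom by blast
  have "Dom L f = x" "Cod L f = y" by (simp_all add: f(1) localization_def zigzag_class_def)
  then show "Dom L f \<in> Obj L" "Cod L f \<in> Obj L" using zigzag_Obj[OF f(2)] by (simp_all add: Obj_loc)
next
  fix A assume "A \<in> Obj L"
  then have "zz A [] A" by (simp add: Obj_loc)
  then show "Idn L A \<in> Hom L A A" unfolding Hom_loc Idn_loc by blast
next
  fix f g A B D assume "f \<in> Hom L A B" "g \<in> Hom L B D"
  then obtain p q where "f = zz_class A p B" "zz A p B"
    "g = zz_class B q D" "zz B q D"
    unfolding Hom_loc by blast
  then have "Cmp L g f = zz_class A (p @ q) D" "zz A (p @ q) D"
    using Cmp_loc zigzag_append by auto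
  then show "Cmp L g f \<in> Hom L A D" unfolding Hom_loc by blast
next
  fix f A B assume "f \<in> Hom L A B"
  then obtain p where p: "f = zz_class A p B" "zz A p B" unfolding Hom_loc by blast
  then have "zz A [] A" "zz B [] B" using zigzag_Obj by auto
  then show "Cmp L f (Idn L A) = f" "Cmp L (Idn L B) f = f"
    using Cmp_loc[of A "[]" A p B] Cmp_loc[of A p B "[]" B] p by (simp_all add: Idn_loc)
next
  fix f g h A B D D' assume "f \<in> Hom L A B" "g \<in> Hom L B D" "h \<in> Hom L D D'"
  then obtain p q r where *: "f = zz_class A p B" "zz A p B"
    "g = zz_class B q D" "zz B q D"
    "h = zz_class D r D'" "zz D r D'"
    unfolding Hom_loc by blast
  then have "zz A (p @ q) D" "zz B (q @ r) D'" using zigzag_append by blast+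
  then show "Cmp L h (Cmp L g f) = Cmp L (Cmp L h g) f"
    using * Cmp_loc by simp
qed

lemma loc_arr_eq: "f \<in> Hom C A B \<Longrightarrow> loc_arr C W f = zz_class A [Fwd f] B"
  using HomD[of f A B] by (simp add: loc_arr_def)

lemma zigzag_Fwd: "f \<in> Hom C A B \<Longrightarrow> zz A [Fwd f] B"
  using HomD[of f A B] by simp

lemma is_functor_loc: "is_functor C L loc_obj (loc_arr C W)"
  unfolding is_functor_def
proof (intro conjI ballI impI)
  fix A assume A: "A \<in> Obj C"
  then show "loc_obj A \<in> Obj L" by (simp add: Obj_loc loc_obj_def)
  have "([] @ [Fwd (Idn C A)] @ [], [] @ [] @ []) \<in> zz_eq A A"
    using zigzag_Fwd[OF Idn_Hom[OF A]] A
    by (intro zigzag_eq.step elementary_zigzag.intros) simp_all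
  then show "loc_arr C W (Idn C A) = Idn L (loc_obj A)"
    using loc_arr_eq[OF Idn_Hom[OF A]] zigzag_class_eq_iff[OF zigzag_Fwd[OF Idn_Hom[OF A]]]
    by (simp add: Idn_loc loc_obj_def)
next
  fix f assume "f \<in> Arr C"
  then show "loc_arr C W f \<in> Hom L (loc_obj (Dom C f)) (loc_obj (Cod C f))"
    using zigzag_Fwd[OF Arr_Hom] unfolding Hom_loc loc_arr_def loc_obj_def by blast
next
  fix f g assume fg: "f \<in> Arr C" "g \<in> Arr C" "Cod C f = Dom C g"
  then obtain X Y Z where f: "f \<in> Hom C X Y" and g: "g \<in> Hom C Y Z" by (auto simp: Hom_def)
  note gf = Cmp_Hom[OF f g]
  have "([] @ [Fwd f, Fwd g] @ [], [] @ [Fwd (Cmp C g f)] @ []) \<in> zz_eq X Z"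
    using zigzag_Fwd[OF gf] zigzag_append[of X "[Fwd f]" "[Fwd g]" Z] zigzag_Fwd[OF f] zigzag_Fwd[OF g] fg
    by (intro zigzag_eq.step elementary_zigzag.intros) auto
  then show "loc_arr C W (Cmp C g f) = Cmp L (loc_arr C W g) (loc_arr C W f)"
    using zigzag_class_eq_iff[OF zigzag_Fwd[OF gf]] zigzag_eq.sym
    by (simp add: loc_arr_eq[OF f] loc_arr_eq[OF g] loc_arr_eq[OF gf]
        Cmp_loc[OF zigzag_Fwd[OF f] zigzag_Fwd[OF g]])
qed (fact category_axioms category_loc)+

sublocale loc: cat_functor C L loc_obj "loc_arr C W"
  by unfold_locales (rule is_functor_loc)

lemma is_iso_loc:
  assumes "s \<in> W"
  shows "is_iso L (loc_arr C W s)"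
proof -
  let ?A = "Dom C s" and ?B = "Cod C s"
  have s: "s \<in> Arr C" "s \<in> Hom C ?A ?B" using assms W_Arr Arr_Hom by auto
  then have o: "?A \<in> Obj C" "?B \<in> Obj C" using HomD[OF s(2)] by auto
  have z: "zz ?B [Bwd s] ?A" "zz ?A [Fwd s] ?B" using s assms o by auto
  have e: "([] @ [Fwd s, Bwd s] @ [], [] @ [] @ []) \<in> zz_eq ?A ?A"
    "([] @ [Bwd s, Fwd s] @ [], [] @ [] @ []) \<in> zz_eq ?B ?B"
    using assms s o by (intro zigzag_eq.step elementary_zigzag.intros; simp)+
  show ?thesis
  proof (rule category.isoI[OF category_loc])
    show "loc_arr C W s \<in> Hom L ?A ?B" using loc.Fa_Hom[OF s(2)] by (simp add: loc_obj_def)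
    show "zz_class ?B [Bwd s] ?A \<in> Hom L ?B ?A" using z unfolding Hom_loc by blast
    show "Cmp L (zz_class ?B [Bwd s] ?A) (loc_arr C W s) = Idn L ?A"
      using Cmp_loc[OF z(2,1)] e(1) zigzag_class_eq_iff[of ?A "[Fwd s, Bwd s]" ?A]
        zigzag_eq_zigzag[OF e(1)] by (simp add: loc_arr_def Idn_loc)
    show "Cmp L (loc_arr C W s) (zz_class ?B [Bwd s] ?A) = Idn L ?B"
      using Cmp_loc[OF z(1,2)] e(2) zigzag_class_eq_iff[of ?B "[Bwd s, Fwd s]" ?B]
        zigzag_eq_zigzag[OF e(2)] by (simp add: loc_arr_def Idn_loc)
  qed
qed

text \<open>
  \<open>T\<close> is local if \<open>Hom(-, T)\<close> turns the elements of \<open>W\<close> into bijections.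
\<close>

definition local_obj :: "'o \<Rightarrow> bool" where
  "local_obj T \<longleftrightarrow> T \<in> Obj C \<and>
    (\<forall>s \<in> W. \<forall>h \<in> Hom C (Dom C s) T. \<exists>!h'. h' \<in> Hom C (Cod C s) T \<and> Cmp C h' s = h)"

text \<open>
  A zigzag from \<open>x\<close> to \<open>y\<close> acts contravariantly on arrows into a local object \<open>T\<close>: forward steps
  by precomposition, backward steps by unique extension. This is the representable functor
  \<open>Hom(-, T)\<close> factored through the localization.
\<close>

fun pull :: "'o \<Rightarrow> 'a zstep list \<Rightarrow> 'a \<Rightarrow> 'a" where
  "pull T [] h = h"
| "pull T (Fwd f # p) h = Cmp C (pull T p h) f"
| "pull T (Bwd s # p) h = (THE h'. h' \<in> Hom C (Cod C s) T \<and> Cmp C h' s = pull T p h)"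

lemma local_obj_ex1:
  assumes "local_obj T" "s \<in> W" "h \<in> Hom C (Dom C s) T"
  shows "\<exists>!h'. h' \<in> Hom C (Cod C s) T \<and> Cmp C h' s = h"
  using assms by (simp add: local_obj_def)

lemma pull_Hom:
  assumes T: "local_obj T"
  shows "zz x p y \<Longrightarrow> h \<in> Hom C y T \<Longrightarrow> pull T p h \<in> Hom C x T"
proof (induction p arbitrary: x)
  case (Cons a p)
  show ?case
  proof (cases a)
    case (Fwd f)
    then have f: "f \<in> Hom C x (Cod C f)" "zz (Cod C f) p y"
      using Cons.prems by (auto simp: Hom_def)
    show ?thesis using Cmp_Hom[OF f(1) Cons.IH[OF f(2) Cons.prems(2)]] by (simp add: Fwd)
  next
    case (Bwd s)
    then have s: "s \<in> W" "Cod C s = x" "zz (Dom C s) p y" using Cons.prems by auto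
    show ?thesis
      using theI'[OF local_obj_ex1[OF T s(1) Cons.IH[OF s(3) Cons.prems(2)]]] s(2) by (simp add: Bwd)
  qed
qed simp

lemma pull_append: "pull T (p @ q) h = pull T p (pull T q h)"
proof (induction p)
  case (Cons a p)
  then show ?case by (cases a) auto
qed simp

lemma pull_elementary:
  assumes T: "local_obj T" and e: "elementary_zigzag C W l r"
    and z: "zz x l y" "zz x r y" and h: "h \<in> Hom C y T"
  shows "pull T l h = pull T r h"
  using e
proof cases
  case (1 a)
  then have "x = a" "y = a" using z HomD[OF Idn_Hom[of a]] by auto
  then show ?thesis using 1 Cmp_Idn[of h a T] h by simp
next
  case (2 f g)
  then have "f \<in> Hom C x (Cod C f)" "g \<in> Hom C (Cod C f) y" using z by (auto simp: Hom_def)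
  then show ?thesis using 2 Cmp_assoc h by simp
next
  case (3 s)
  then have "h \<in> Hom C (Dom C s) T" using z h by auto
  from theI'[OF local_obj_ex1[OF T 3(3) this]] show ?thesis using 3 by simp
next
  case (4 s)
  then have s: "h \<in> Hom C (Cod C s) T" "s \<in> Hom C (Dom C s) (Cod C s)" using z h by (auto simp: Hom_def)
  have "(THE h'. h' \<in> Hom C (Cod C s) T \<and> Cmp C h' s = Cmp C h s) = h"
    by (rule the1_equality[OF local_obj_ex1[OF T 4(3) Cmp_Hom[OF s(2,1)]]]) (use s in simp)
  then show ?thesis using 4 by simp
qed

text \<open>
  A rewriting step happens in the middle of a zigzag. Its end points are those of the two zigzags
  because a prefix determines its target and a suffix its source, so that \<open>pull_elementary\<close> applies.
\<close>

lemma pull_cong: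
  assumes T: "local_obj T" and e: "(p, q) \<in> zz_eq x y" and h: "h \<in> Hom C y T"
  shows "pull T p h = pull T q h"
  using e h
proof (induction rule: zigzag_eq.induct)
  case (step l r u v)
  obtain a b where ab: "zz x u a" "zz a l b" "zz b v y"
    using step(2) unfolding zigzag_append by blast
  obtain a' b' where ab': "zz x u a'" "zz a' r b'" "zz b' v y"
    using step(3) unfolding zigzag_append by blast
  have "a' = a" "b' = b"
    using zigzag_target_unique[OF ab(1) ab'(1)] zigzag_source_unique[OF ab(3) ab'(3)] by auto
  then have "pull T l (pull T v h) = pull T r (pull T v h)"
    using pull_elementary[OF T step(1) ab(2)] ab' pull_Hom[OF T ab(3) step(4)] by simp
  then show ?case by (simp add: pull_append)
qed auto

text \<open>
  The action is composition in the localization: following \<open>p\<close> by an arrow \<open>h\<close> into \<open>T\<close> is the same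
  as the single arrow \<open>pull T p h\<close>. In particular every zigzag into \<open>T\<close> is equivalent to one arrow.
\<close>

lemma zigzag_pull:
  assumes T: "local_obj T"
  shows "zz x p y \<Longrightarrow> h \<in> Hom C y T \<Longrightarrow> (p @ [Fwd h], [Fwd (pull T p h)]) \<in> zz_eq x T"
proof (induction p arbitrary: x)
  case Nil
  then have "h \<in> Hom C x T" by simp
  from zigzag_eq.refl[OF zigzag_Fwd[OF this]] show ?case by simp
next
  case (Cons a p)
  show ?case
  proof (cases a)
    case (Fwd f)
    then have f: "f \<in> Hom C x (Cod C f)" "zz (Cod C f) p y"
      using Cons.prems by (auto simp: Hom_def)
    let ?k = "pull T p h"
    have k: "?k \<in> Hom C (Cod C f) T" by (rule pull_Hom[OF T f(2) Cons.prems(2)])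
    have TT: "zz T [] T" using HomD[OF k] by simp
    have 1: "([Fwd f] @ (p @ [Fwd h]) @ [], [Fwd f] @ [Fwd ?k] @ []) \<in> zz_eq x T"
      by (rule zigzag_eq_append[OF Cons.IH[OF f(2) Cons.prems(2)] zigzag_Fwd[OF f(1)] TT])
    have 2: "([] @ [Fwd f, Fwd ?k] @ [], [] @ [Fwd (Cmp C ?k f)] @ []) \<in> zz_eq x T"
      using zigzag_eq_zigzag[OF 1] zigzag_Fwd[OF Cmp_Hom[OF f(1) k]] HomD[OF f(1)] HomD[OF k]
      by (intro zigzag_eq.step elementary_zigzag.intros) auto
    show ?thesis using zigzag_eq.trans[OF 1] 2 by (simp add: Fwd)
  next
    case (Bwd s)
    then have s: "s \<in> W" "Cod C s = x" "zz (Dom C s) p y" "zz x [Bwd s] (Dom C s)"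
      using Cons.prems zigzag_Obj by auto
    let ?k = "pull T p h" and ?k' = "pull T (Bwd s # p) h"
    have k: "?k \<in> Hom C (Dom C s) T" by (rule pull_Hom[OF T s(3) Cons.prems(2)])
    have k': "?k' \<in> Hom C x T" "Cmp C ?k' s = ?k"
      using theI'[OF local_obj_ex1[OF T s(1) k]] s(2) by simp_all
    have sx: "s \<in> Hom C (Dom C s) x" using s W_Arr by (auto simp: Hom_def)
    have TT: "zz T [] T" using HomD[OF k] by simp
    \<comment> \<open>With \<open>k = k' \<circ> s\<close> the zigzag \<open>s\<^sup>- k\<close> is equivalent to \<open>s\<^sup>- s k'\<close> and hence to \<open>k'\<close>.\<close>
    have zs: "zz x [Bwd s, Fwd s] x"
      using s(4) zigzag_append[of x "[Bwd s]" "[Fwd s]" x] zigzag_Fwd[OF sx] by auto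
    have 1: "([Bwd s] @ (p @ [Fwd h]) @ [], [Bwd s] @ [Fwd ?k] @ []) \<in> zz_eq x T"
      by (rule zigzag_eq_append[OF Cons.IH[OF s(3) Cons.prems(2)] s(4) TT])
    have 2: "([Bwd s] @ [Fwd s, Fwd ?k'] @ [], [Bwd s] @ [Fwd (Cmp C ?k' s)] @ []) \<in> zz_eq x T"
    proof (intro zigzag_eq.step elementary_zigzag.intros)
      show "zz x ([Bwd s] @ [Fwd s, Fwd ?k'] @ []) T"
        using zs zigzag_append[of x "[Bwd s, Fwd s]" "[Fwd ?k']" T] zigzag_Fwd[OF k'(1)] by auto
      show "zz x ([Bwd s] @ [Fwd (Cmp C ?k' s)] @ []) T"
        unfolding k'(2) using zigzag_eq_zigzag[OF 1] by auto
    qed (use HomD[OF sx] HomD[OF k'(1)] in auto)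
    have 3: "([] @ [Bwd s, Fwd s] @ [Fwd ?k'], [] @ [] @ [Fwd ?k']) \<in> zz_eq x T"
      using zigzag_eq_zigzag[OF 2] zigzag_Fwd[OF k'(1)] s(1)
      by (intro zigzag_eq.step elementary_zigzag.intros) auto
    have "([Bwd s] @ (p @ [Fwd h]), [Bwd s, Fwd s, Fwd ?k']) \<in> zz_eq x T"
      using zigzag_eq.trans[OF 1] zigzag_eq.sym[OF 2] k'(2) by (simp del: pull.simps)
    from zigzag_eq.trans[OF this, of "[Fwd ?k']"] 3
    have "([Bwd s] @ (p @ [Fwd h]), [Fwd ?k']) \<in> zz_eq x T"
      by (simp del: pull.simps)
    then show ?thesis by (simp add: Bwd del: pull.simps)
  qed
qed

text \<open>
  Arrows into a local object are the same before and after localizing: \<open>zigzag_pull\<close> represents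
  a class by an arrow, and \<open>pull\<close>, applied to the identity of \<open>T\<close>, recovers the arrow from its class.
\<close>

lemma loc_full:
  assumes T: "local_obj T" and g: "g \<in> Hom L F T"
  shows "\<exists>h \<in> Hom C F T. loc_arr C W h = g"
proof -
  obtain p where p: "g = zz_class F p T" "zz F p T" using g unfolding Hom_loc by blast
  have i: "Idn C T \<in> Hom C T T" using Idn_Hom zigzag_Obj[OF p(2)] by blast
  have o: "T \<in> Obj C" "F \<in> Obj C" using zigzag_Obj[OF p(2)] by auto
  let ?h = "pull T p (Idn C T)"
  have h: "?h \<in> Hom C F T" by (rule pull_Hom[OF T p(2) i])
  have 1: "(p @ [Fwd (Idn C T)], [Fwd ?h]) \<in> zz_eq F T" by (rule zigzag_pull[OF T p(2) i])
  have 2: "(p @ [Fwd (Idn C T)] @ [], p @ [] @ []) \<in> zz_eq F T"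
    using p(2) zigzag_eq_zigzag[OF 1] o by (intro zigzag_eq.step elementary_zigzag.intros) auto
  have "(p, [Fwd ?h]) \<in> zz_eq F T" using zigzag_eq.trans[OF zigzag_eq.sym[OF 2]] 1 by simp
  then have "loc_arr C W ?h = g"
    using zigzag_class_eq_iff[OF p(2), of "[Fwd ?h]"] p(1) loc_arr_eq[OF h] by simp
  with h show ?thesis by blast
qed

lemma loc_faithful:
  assumes T: "local_obj T" and h: "h \<in> Hom C F T" "h' \<in> Hom C F T" and eq: "loc_arr C W h = loc_arr C W h'"
  shows "h = h'"
proof -
  have "([Fwd h], [Fwd h']) \<in> zz_eq F T"
    using eq zigzag_class_eq_iff[OF zigzag_Fwd[OF h(1)]] loc_arr_eq h by simp
  moreover have "Idn C T \<in> Hom C T T" using Idn_Hom HomD[OF h(1)] by blast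
  ultimately have "pull T [Fwd h] (Idn C T) = pull T [Fwd h'] (Idn C T)" by (rule pull_cong[OF T])
  then show ?thesis using Idn_Cmp h by simp
qed

text \<open>
  Full faithfulness survives localization because the values of the functor are local; the arrows
  \<open>\<eta>\<close>, which become invertible, provide essential surjectivity.
\<close>

lemma ff_es_functor_loc:
  assumes "is_functor E C Yo Ya"
    and full: "\<And>A B g. A \<in> Obj E \<Longrightarrow> B \<in> Obj E \<Longrightarrow> g \<in> Hom C (Yo A) (Yo B) \<Longrightarrow> \<exists>f \<in> Hom E A B. Ya f = g"
    and faithful: "\<And>A B f f'. f \<in> Hom E A B \<Longrightarrow> f' \<in> Hom E A B \<Longrightarrow> Ya f = Ya f' \<Longrightarrow> f = f'"
    and local_image: "\<And>A. A \<in> Obj E \<Longrightarrow> local_obj (Yo A)"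
    and reflection: "\<And>F. F \<in> Obj C \<Longrightarrow> \<exists>A \<in> Obj E. \<exists>\<eta> \<in> Hom C F (Yo A). \<eta> \<in> W"
  shows "ff_es_functor E L (loc_obj \<circ> Yo) (loc_arr C W \<circ> Ya)"
proof -
  interpret Y: cat_functor E C Yo Ya by unfold_locales fact
  interpret E: category E by (rule Y.categories)
  show ?thesis
  proof unfold_locales
    show "is_functor E L (loc_obj \<circ> Yo) (loc_arr C W \<circ> Ya)"
      unfolding is_functor_def
    proof (intro conjI ballI impI)
      fix f assume "f \<in> Arr E"
      from loc.Fa_Hom[OF Y.Fa_Hom[OF E.Arr_Hom[OF this]]]
      show "(loc_arr C W \<circ> Ya) f \<in> Hom L ((loc_obj \<circ> Yo) (Dom E f)) ((loc_obj \<circ> Yo) (Cod E f))" by simp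
    next
      fix f g assume fg: "f \<in> Arr E" "g \<in> Arr E" "Cod E f = Dom E g"
      then have f: "f \<in> Hom E (Dom E f) (Dom E g)" and g: "g \<in> Hom E (Dom E g) (Cod E g)"
        by (auto simp: Hom_def)
      show "(loc_arr C W \<circ> Ya) (Cmp E g f) = Cmp L ((loc_arr C W \<circ> Ya) g) ((loc_arr C W \<circ> Ya) f)"
        using Y.Fa_Cmp[OF f g] loc.Fa_Cmp[OF Y.Fa_Hom[OF f] Y.Fa_Hom[OF g]] by simp
    qed (simp_all add: E.category_axioms category_loc Y.Fo_Obj Y.Fa_Idn loc.Fo_Obj loc.Fa_Idn)
    fix A B assume AB: "A \<in> Obj E" "B \<in> Obj E"
    show "\<exists>f \<in> Hom E A B. (loc_arr C W \<circ> Ya) f = g" if "g \<in> Hom L ((loc_obj \<circ> Yo) A) ((loc_obj \<circ> Yo) B)" for g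
    proof -
      have "g \<in> Hom L (Yo A) (Yo B)" using that by (simp add: loc_obj_def)
      from loc_full[OF local_image[OF AB(2)] this]
      obtain h where h: "h \<in> Hom C (Yo A) (Yo B)" "loc_arr C W h = g" by blast
      obtain f where "f \<in> Hom E A B" "Ya f = h" using full[OF AB h(1)] by blast
      with h(2) show ?thesis by auto
    qed
  next
    fix A B f f' assume f: "f \<in> Hom E A B" "f' \<in> Hom E A B" "(loc_arr C W \<circ> Ya) f = (loc_arr C W \<circ> Ya) f'"
    then have "B \<in> Obj E" using E.HomD by blast
    then show "f = f'"
      using loc_faithful[OF local_image Y.Fa_Hom[OF f(1)] Y.Fa_Hom[OF f(2)]] f(3) faithful[OF f(1,2)] by simp
  next
    fix F assume "F \<in> Obj L"
    then obtain A \<eta> where \<eta>: "A \<in> Obj E" "\<eta> \<in> Hom C F (Yo A)" "\<eta> \<in> W"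
      using reflection Obj_loc by blast
    have "loc_arr C W \<eta> \<in> Hom L F (Yo A)" using loc.Fa_Hom[OF \<eta>(2)] by (simp add: loc_obj_def)
    then obtain t where "t \<in> Hom L (Yo A) F" "is_iso L t"
      by (rule category.isoE[OF category_loc is_iso_loc[OF \<eta>(3)]])
    with \<eta>(1) show "\<exists>A \<in> Obj E. \<exists>t \<in> Hom L ((loc_obj \<circ> Yo) A) F. is_iso L t"
      by (auto simp: loc_obj_def)
  qed
qed

end

section \<open>Presheaves of abelian groups\<close>

lemma hom_eq_iff_one:
  assumes "h \<in> hom G H" "group G" "group H" "x \<in> carrier G" "y \<in> carrier G"
  shows "h x = h y \<longleftrightarrow> h (x \<otimes>\<^bsub>G\<^esub> inv\<^bsub>G\<^esub> y) = \<one>\<^bsub>H\<^esub>"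
proof -
  interpret group_hom G H h using assms by (simp add: group_hom_def group_hom_axioms_def)
  have hx: "h x \<in> carrier H" "h y \<in> carrier H" using assms by auto
  have "h (x \<otimes>\<^bsub>G\<^esub> inv\<^bsub>G\<^esub> y) = h x \<otimes>\<^bsub>H\<^esub> inv\<^bsub>H\<^esub> h y" using assms by simp
  then show ?thesis using hx by (metis H.r_inv H.inv_equality H.inv_inv H.inv_closed)
qed

abbreviation app :: "('o, 'a, 'u) presheaf_arr \<Rightarrow> 'o \<Rightarrow> 'u \<Rightarrow> 'u" where
  "app t \<equiv> fst (snd t)"

abbreviation el :: "('o, 'a, 'u) presheaf \<Rightarrow> 'o \<Rightarrow> 'u set" where
  "el F A \<equiv> carrier (Val F A)"

lemma full_subcat_simps [simp]:
  "Obj (full_subcat C S) = Obj C \<inter> S" "Dom (full_subcat C S) = Dom C"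
  "Cod (full_subcat C S) = Cod C" "Idn (full_subcat C S) = Idn C" "Cmp (full_subcat C S) = Cmp C"
  by (simp_all add: full_subcat_def)

lemma Hom_full_subcat: "Hom (full_subcat C S) A B = (if A \<in> S \<and> B \<in> S then Hom C A B else {})"
  by (auto simp: Hom_def full_subcat_def)

lemma Hom_full_subcatD: "f \<in> Hom (full_subcat C S) A B \<Longrightarrow> f \<in> Hom C A B \<and> A \<in> S \<and> B \<in> S"
  by (auto simp: Hom_full_subcat split: if_splits)

lemma full_subcat_full_subcat: "full_subcat (full_subcat C S) T = full_subcat C (S \<inter> T)"
  by (simp add: full_subcat_def Int_assoc conj_ac)

lemma full_subcat_UNIV: "full_subcat C UNIV = C"
  by (simp add: full_subcat_def)

context additive_category
begin

abbreviation "M \<equiv> Mod_cat E"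
abbreviation "Y \<equiv> yoneda_obj E"
abbreviation "Ya \<equiv> yoneda_arr E"

lemma hom_group_simps [simp]:
  "carrier (hom_group E A B) = Hom E A B" "mult (hom_group E A B) = Add E"
  "one (hom_group E A B) = Zero E A B"
  by (simp_all add: hom_group_def)

lemma hom_is_group: "A \<in> Obj E \<Longrightarrow> B \<in> Obj E \<Longrightarrow> group (hom_group E A B)"
  using hom_comm_group comm_group_def by blast

lemma Zero_Hom: "A \<in> Obj E \<Longrightarrow> B \<in> Obj E \<Longrightarrow> Zero E A B \<in> Hom E A B"
  using hom_is_group[of A B] group.is_monoid monoid.one_closed by fastforce

lemma Add_Hom: "f \<in> Hom E A B \<Longrightarrow> g \<in> Hom E A B \<Longrightarrow> Add E f g \<in> Hom E A B"
  using hom_is_group[of A B] HomD[of f A B] group.is_monoid monoid.m_closed[of "hom_group E A B" f g]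
  by fastforce

lemma Cmp_hom_left: "f \<in> Hom E A B \<Longrightarrow> X \<in> Obj E \<Longrightarrow>
    (\<lambda>u. Cmp E u f) \<in> hom (hom_group E B X) (hom_group E A X)"
  by (rule homI) (simp_all add: Cmp_Hom Cmp_Add_left)

lemma Cmp_hom_right: "f \<in> Hom E A B \<Longrightarrow> X \<in> Obj E \<Longrightarrow>
    (\<lambda>u. Cmp E f u) \<in> hom (hom_group E X A) (hom_group E X B)"
  by (rule homI) (simp_all add: Cmp_Hom Cmp_Add_right)

lemma Cmp_Zero_right: "f \<in> Hom E A B \<Longrightarrow> X \<in> Obj E \<Longrightarrow> Cmp E f (Zero E X A) = Zero E X B"
  using hom_one[OF Cmp_hom_right[of f A B X]] hom_is_group HomD[of f A B] by simp

lemma Cmp_Zero_left: "f \<in> Hom E A B \<Longrightarrow> X \<in> Obj E \<Longrightarrow> Cmp E (Zero E B X) f = Zero E A X"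
  using hom_one[OF Cmp_hom_left[of f A B X]] hom_is_group HomD[of f A B] by simp

lemma is_zero_Obj: "is_zero E Z \<Longrightarrow> Z \<in> Obj E"
  by (simp add: is_zero_def)

lemma Hom_to_zero:
  assumes Z: "is_zero E Z" and f: "f \<in> Hom E A Z"
  shows "f = Zero E A Z"
proof -
  have A: "A \<in> Obj E" using HomD[OF f] by simp
  obtain g where g: "g \<in> Hom E A Z" "\<And>f'. f' \<in> Hom E A Z \<Longrightarrow> f' = g" using zero_to[OF Z A] by blast
  show ?thesis unfolding g(2)[OF f] using g(2)[OF Zero_Hom[OF A is_zero_Obj[OF Z]]] by simp
qed

lemma zero_arr_iff_Zero:
  assumes f: "f \<in> Hom E A B"
  shows "zero_arr E f \<longleftrightarrow> f = Zero E A B"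
proof -
  obtain Z where Z: "is_zero E Z" using ex_zero by blast
  have o: "Z \<in> Obj E" "A \<in> Obj E" "B \<in> Obj E" using HomD[OF f] is_zero_Obj[OF Z] by auto
  note z = Zero_Hom[OF o(2,1)] Zero_Hom[OF o(1,3)]
  have "Cmp E h g = Zero E A B" if "g \<in> Hom E A Z" "h \<in> Hom E Z B" for g h
    using Hom_to_zero[OF Z that(1)] Cmp_Zero_right[OF that(2) o(2)] by simp
  then show ?thesis using zero_arr_via[OF Z f] z by metis
qed

text \<open>
  Composition with \<open>u\<close> is a homomorphism of groups, so triviality of its kernel is injectivity.
\<close>

lemma mono_if_kernel_zero:
  assumes u: "u \<in> Hom E B X" and z: "\<And>s. s \<in> Hom E A B \<Longrightarrow> Cmp E u s = Zero E A X \<Longrightarrow> s = Zero E A B"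
    and a: "a \<in> Hom E A B" "b \<in> Hom E A B" "Cmp E u a = Cmp E u b"
  shows "a = b"
proof -
  have o: "A \<in> Obj E" "B \<in> Obj E" "X \<in> Obj E" using HomD[OF u] HomD[OF a(1)] by auto
  note gs = hom_is_group[OF o(1,2)] hom_is_group[OF o(1,3)]
  have "inj_on (\<lambda>u'. Cmp E u u') (Hom E A B)"
    using inj_on_one_iff'[OF Cmp_hom_right[OF u o(1)] gs] z by simp
  then show ?thesis using a by (auto dest: inj_onD)
qed

subsection \<open>Elements of presheaves\<close>

context
  fixes F :: "('o, 'a, 'u) presheaf"
  assumes F: "additive_presheaf E F"
begin

lemma val_comm_group: "A \<in> Obj E \<Longrightarrow> comm_group (Val F A)"
  using F by (simp add: additive_presheaf_def)

lemma val_group: "A \<in> Obj E \<Longrightarrow> group (Val F A)"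
  using val_comm_group comm_group_def by blast

lemma el_one: "A \<in> Obj E \<Longrightarrow> \<one>\<^bsub>Val F A\<^esub> \<in> el F A"
  using val_group group.is_monoid monoid.one_closed by blast

lemma act_hom: "f \<in> Hom E A B \<Longrightarrow> Act F f \<in> hom (Val F B) (Val F A)"
  using F by (auto simp: additive_presheaf_def Hom_def)

lemma act_el: "f \<in> Hom E A B \<Longrightarrow> x \<in> el F B \<Longrightarrow> Act F f x \<in> el F A"
  by (rule hom_in_carrier[OF act_hom])

lemma act_one: "f \<in> Hom E A B \<Longrightarrow> Act F f \<one>\<^bsub>Val F B\<^esub> = \<one>\<^bsub>Val F A\<^esub>"
  using hom_one[OF act_hom[of f A B]] val_group HomD[of f A B] by simp

lemma act_Idn: "A \<in> Obj E \<Longrightarrow> x \<in> el F A \<Longrightarrow> Act F (Idn E A) x = x"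
  using F by (simp add: additive_presheaf_def)

lemma act_Cmp:
  assumes "f \<in> Hom E A B" "g \<in> Hom E B D" "x \<in> el F D"
  shows "Act F (Cmp E g f) x = Act F f (Act F g x)"
proof -
  have "f \<in> Arr E" "g \<in> Arr E" "Cod E f = Dom E g" "Cod E g = D"
    using HomD[OF assms(1)] HomD[OF assms(2)] by auto
  then show ?thesis using F assms(3) by (simp add: additive_presheaf_def)
qed

lemma act_Add:
  assumes "f \<in> Hom E A B" "g \<in> Hom E A B" "x \<in> el F B"
  shows "Act F (Add E f g) x = Act F f x \<otimes>\<^bsub>Val F A\<^esub> Act F g x"
  using F assms HomD[OF assms(1)] unfolding additive_presheaf_def by blast

lemma act_hom_arr:
  assumes "A \<in> Obj E" "B \<in> Obj E" "x \<in> el F B"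
  shows "(\<lambda>f. Act F f x) \<in> hom (hom_group E A B) (Val F A)"
  using act_Add act_el assms by (intro homI) auto

end

subsection \<open>Natural transformations\<close>

text \<open>
  Components are cut down to the objects and carriers on which they matter, as equality of arrows of
  \<open>Mod_cat\<close> demands.
\<close>

definition nat_hom :: "('o, 'a, 'u) presheaf \<Rightarrow> ('o \<Rightarrow> 'u \<Rightarrow> 'u) \<Rightarrow> ('o, 'a, 'u) presheaf \<Rightarrow>
    ('o, 'a, 'u) presheaf_arr" where
  "nat_hom F \<phi> G = (F, (\<lambda>A \<in> Obj E. \<lambda>x \<in> el F A. \<phi> A x), G)"

lemma app_nat_hom [simp]: "A \<in> Obj E \<Longrightarrow> x \<in> el F A \<Longrightarrow> app (nat_hom F \<phi> G) A x = \<phi> A x"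
  by (simp add: nat_hom_def)

lemma Obj_Mod: "F \<in> Obj M \<longleftrightarrow> additive_presheaf E F"
  by (simp add: Mod_cat_def)

lemma Hom_Mod_iff: "t \<in> Hom M F G \<longleftrightarrow> additive_presheaf E F \<and> additive_presheaf E G \<and>
    fst t = F \<and> snd (snd t) = G \<and> natural_transformation E F G (app t)"
  by (cases t) (auto simp: Hom_def Mod_cat_def)

lemma nat_homI:
  assumes F: "additive_presheaf E F" and G: "additive_presheaf E G"
    and hom: "\<And>A. A \<in> Obj E \<Longrightarrow> \<phi> A \<in> hom (Val F A) (Val G A)"
    and nat: "\<And>A B f x. f \<in> Hom E A B \<Longrightarrow> x \<in> el F B \<Longrightarrow> \<phi> A (Act F f x) = Act G f (\<phi> B x)"
  shows "nat_hom F \<phi> G \<in> Hom M F G"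
proof -
  have "restrict (\<phi> A) (el F A) \<in> hom (Val F A) (Val G A)" if A: "A \<in> Obj E" for A
  proof -
    interpret group "Val F A" by (rule val_group[OF F A])
    show ?thesis using hom[OF A] by (auto simp: hom_def)
  qed
  moreover have "\<phi> (Dom E f) (Act F f x) = Act G f (\<phi> (Cod E f) x)" "Act F f x \<in> el F (Dom E f)"
    "Dom E f \<in> Obj E" "Cod E f \<in> Obj E"
    if "f \<in> Arr E" "x \<in> el F (Cod E f)" for f x
    using nat[OF Arr_Hom] act_el[OF F Arr_Hom] that Dom_Obj Cod_Obj by auto
  ultimately show ?thesis
    using F G by (auto simp: Hom_Mod_iff nat_hom_def natural_transformation_def)
qed

lemma app_hom: "t \<in> Hom M F G \<Longrightarrow> A \<in> Obj E \<Longrightarrow> app t A \<in> hom (Val F A) (Val G A)"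
  by (auto simp: Hom_Mod_iff natural_transformation_def)

lemma app_el: "t \<in> Hom M F G \<Longrightarrow> A \<in> Obj E \<Longrightarrow> x \<in> el F A \<Longrightarrow> app t A x \<in> el G A"
  by (rule hom_in_carrier[OF app_hom])

lemma Hom_presheaf: "t \<in> Hom M F G \<Longrightarrow> additive_presheaf E F \<and> additive_presheaf E G"
  by (simp add: Hom_Mod_iff)

lemma app_one: "t \<in> Hom M F G \<Longrightarrow> A \<in> Obj E \<Longrightarrow> app t A \<one>\<^bsub>Val F A\<^esub> = \<one>\<^bsub>Val G A\<^esub>"
  using hom_one[OF app_hom[of t F G A]] val_group[of F A] val_group[of G A] Hom_presheaf[of t F G] by simp

lemma app_act:
  assumes "t \<in> Hom M F G" "f \<in> Hom E A B" "x \<in> el F B"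
  shows "app t A (Act F f x) = Act G f (app t B x)"
  using assms HomD[OF assms(2)] by (auto simp: Hom_Mod_iff natural_transformation_def)

lemma Hom_Mod_eqI:
  assumes t: "t \<in> Hom M F G" "t' \<in> Hom M F G"
    and eq: "\<And>A x. A \<in> Obj E \<Longrightarrow> x \<in> el F A \<Longrightarrow> app t A x = app t' A x"
  shows "t = t'"
proof -
  have "app t = app t'"
  proof (rule extensionalityI[of _ "Obj E"])
    fix A assume A: "A \<in> Obj E"
    show "app t A = app t' A"
      by (rule extensionalityI[of _ "el F A"])
        (use t eq A in \<open>auto simp: Hom_Mod_iff natural_transformation_def\<close>)
  qed (use t in \<open>auto simp: Hom_Mod_iff natural_transformation_def\<close>)
  then show ?thesis using t by (simp add: Hom_Mod_iff prod_eq_iff)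
qed

lemma Cmp_Mod: "Cmp M s t = nat_hom (fst t) (\<lambda>A x. app s A (app t A x)) (snd (snd s))"
  by (cases s; cases t) (simp add: Mod_cat_def nat_hom_def)

lemma Idn_Mod: "Idn M F = nat_hom F (\<lambda>A x. x) F"
  by (simp add: Mod_cat_def nat_hom_def)

lemma app_Cmp:
  assumes "t \<in> Hom M F G" "A \<in> Obj E" "x \<in> el F A"
  shows "app (Cmp M s t) A x = app s A (app t A x)"
  using assms by (auto simp: Cmp_Mod Hom_Mod_iff)

lemma Cmp_Mod_Hom:
  assumes t: "t \<in> Hom M F G" and s: "s \<in> Hom M G H"
  shows "Cmp M s t \<in> Hom M F H"
proof -
  have "nat_hom F (\<lambda>A x. app s A (app t A x)) H \<in> Hom M F H"
  proof (rule nat_homI)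
    fix A assume A: "A \<in> Obj E"
    show "(\<lambda>x. app s A (app t A x)) \<in> hom (Val F A) (Val H A)"
      using app_hom[OF t A] app_hom[OF s A] by (auto simp: hom_def Pi_def)
  qed (use Hom_presheaf[OF t] Hom_presheaf[OF s] app_act[OF t] app_act[OF s] app_el[OF t] HomD in auto)
  then show ?thesis using t s by (simp add: Cmp_Mod Hom_Mod_iff)
qed

lemma Idn_Mod_Hom: "additive_presheaf E F \<Longrightarrow> Idn M F \<in> Hom M F F"
  unfolding Idn_Mod by (rule nat_homI) (auto simp: hom_def)

lemma category_Mod: "category M"
proof
  fix t assume "t \<in> Arr M"
  then show "Dom M t \<in> Obj M" "Cod M t \<in> Obj M" by (auto simp: Mod_cat_def)
next
  fix A assume "A \<in> Obj M" then show "Idn M A \<in> Hom M A A" by (simp add: Obj_Mod Idn_Mod_Hom)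
next
  fix t F G assume t: "t \<in> Hom M F G"
  note p = Hom_presheaf[OF t]
  note i = Idn_Mod_Hom[OF conjunct1[OF p]] Idn_Mod_Hom[OF conjunct2[OF p]]
  show "Cmp M t (Idn M F) = t"
    by (rule Hom_Mod_eqI[OF Cmp_Mod_Hom[OF i(1) t] t]) (simp add: app_Cmp[OF i(1)], simp add: Idn_Mod)
  show "Cmp M (Idn M G) t = t"
    by (rule Hom_Mod_eqI[OF Cmp_Mod_Hom[OF t i(2)] t])
      (simp add: app_Cmp[OF t], simp add: Idn_Mod app_el[OF t])
next
  fix t s r F G H J assume *: "t \<in> Hom M F G" "s \<in> Hom M G H" "r \<in> Hom M H J"
  note st = Cmp_Mod_Hom[OF *(1,2)] and rs = Cmp_Mod_Hom[OF *(2,3)]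
  show "Cmp M r (Cmp M s t) = Cmp M (Cmp M r s) t"
    by (rule Hom_Mod_eqI[OF Cmp_Mod_Hom[OF st *(3)] Cmp_Mod_Hom[OF *(1) rs]])
      (simp add: app_Cmp[OF st] app_Cmp[OF *(1)] app_Cmp[OF *(2)] app_el[OF *(1)])
qed (rule Cmp_Mod_Hom)

sublocale M: category M by (rule category_Mod)

subsection \<open>Pointwise exactness\<close>

definition pw_inj :: "('o, 'a, 'u) presheaf_arr \<Rightarrow> bool" where
  "pw_inj t \<longleftrightarrow> (\<forall>A \<in> Obj E. \<forall>x \<in> el (fst t) A. app t A x = \<one>\<^bsub>Val (snd (snd t)) A\<^esub> \<longrightarrow> x = \<one>\<^bsub>Val (fst t) A\<^esub>)"

definition pw_surj :: "('o, 'a, 'u) presheaf_arr \<Rightarrow> bool" where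
  "pw_surj t \<longleftrightarrow> (\<forall>A \<in> Obj E. \<forall>y \<in> el (snd (snd t)) A. \<exists>x \<in> el (fst t) A. app t A x = y)"

definition pw_exact :: "('o, 'a, 'u) presheaf_arr \<Rightarrow> ('o, 'a, 'u) presheaf_arr \<Rightarrow> bool" where
  "pw_exact s t \<longleftrightarrow> (\<forall>A \<in> Obj E. \<forall>x \<in> el (fst t) A.
     app t A x = \<one>\<^bsub>Val (snd (snd t)) A\<^esub> \<longleftrightarrow> (\<exists>y \<in> el (fst s) A. app s A y = x))"

lemma Hom_fst_snd: "t \<in> Hom M F G \<Longrightarrow> fst t = F \<and> snd (snd t) = G"
  by (simp add: Hom_Mod_iff)

lemma pw_iff:
  assumes t: "t \<in> Hom M F G"
  shows pw_inj_iff: "pw_inj t \<longleftrightarrow> (\<forall>A \<in> Obj E. \<forall>x \<in> el F A. app t A x = \<one>\<^bsub>Val G A\<^esub> \<longrightarrow> x = \<one>\<^bsub>Val F A\<^esub>)"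
    and pw_surj_iff: "pw_surj t \<longleftrightarrow> (\<forall>A \<in> Obj E. \<forall>y \<in> el G A. \<exists>x \<in> el F A. app t A x = y)"
    and pw_exact_iff: "s \<in> Hom M T F \<Longrightarrow> pw_exact s t \<longleftrightarrow>
      (\<forall>A \<in> Obj E. \<forall>x \<in> el F A. app t A x = \<one>\<^bsub>Val G A\<^esub> \<longleftrightarrow> (\<exists>y \<in> el T A. app s A y = x))"
  using Hom_fst_snd[OF t] Hom_fst_snd[of s T F] by (simp_all add: pw_inj_def pw_surj_def pw_exact_def)

lemma pw_inj_inj_on:
  assumes t: "t \<in> Hom M F G" and "pw_inj t" and A: "A \<in> Obj E"
  shows "inj_on (app t A) (el F A)"
proof -
  note p = Hom_presheaf[OF t]
  show ?thesis
    using inj_on_one_iff'[OF app_hom[OF t A] val_group[OF conjunct1[OF p] A] val_group[OF conjunct2[OF p] A]]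
      assms(2) A by (simp add: pw_inj_iff[OF t])
qed

text \<open>
  A map out of \<open>F\<close> that kills the kernel of a surjection \<open>t\<close> is constant on its fibres. Values are
  computed on arbitrarily chosen preimages \<open>r A y\<close>.
\<close>

lemma pw_surj_factor:
  assumes t: "t \<in> Hom M F G" and surj: "pw_surj t" and h: "h \<in> Hom M F H"
    and ker: "\<And>A x. A \<in> Obj E \<Longrightarrow> x \<in> el F A \<Longrightarrow> app t A x = \<one>\<^bsub>Val G A\<^esub> \<Longrightarrow> app h A x = \<one>\<^bsub>Val H A\<^esub>"
  shows "\<exists>u \<in> Hom M G H. Cmp M u t = h"
proof -
  have F: "additive_presheaf E F" and G: "additive_presheaf E G" and H: "additive_presheaf E H"
    using Hom_presheaf[OF t] Hom_presheaf[OF h] by auto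
  have "\<exists>x. x \<in> el F A \<and> app t A x = y" if "A \<in> Obj E" "y \<in> el G A" for A y
    using surj that unfolding pw_surj_iff[OF t] by blast
  then obtain r where r: "\<And>A y. A \<in> Obj E \<Longrightarrow> y \<in> el G A \<Longrightarrow> r A y \<in> el F A \<and> app t A (r A y) = y"
    by metis
  have h_eq: "app h A x = app h A x'" if A: "A \<in> Obj E" and x: "x \<in> el F A" "x' \<in> el F A"
    and eq: "app t A x = app t A x'" for A x x'
  proof -
    have gs: "group (Val F A)" "group (Val G A)" "group (Val H A)" using val_group F G H A by auto
    interpret FA: group "Val F A" by (rule gs(1))
    have "x \<otimes>\<^bsub>Val F A\<^esub> inv\<^bsub>Val F A\<^esub> x' \<in> el F A" using x by simp
    then show ?thesis
      using hom_eq_iff_one[OF app_hom[OF t A] gs(1,2) x] hom_eq_iff_one[OF app_hom[OF h A] gs(1,3) x]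
        ker[OF A] eq by blast
  qed
  let ?\<phi> = "\<lambda>A y. app h A (r A y)"
  have h\<phi>: "app h A x = ?\<phi> A (app t A x)" if A: "A \<in> Obj E" and x: "x \<in> el F A" for A x
    using r[OF A app_el[OF t A x]] h_eq[OF A x] by simp
  have u: "nat_hom G ?\<phi> H \<in> Hom M G H"
  proof (rule nat_homI[OF G H])
    fix A assume A: "A \<in> Obj E"
    interpret FA: group "Val F A" by (rule val_group[OF F A])
    show "?\<phi> A \<in> hom (Val G A) (Val H A)"
    proof (rule homI)
      fix y assume "y \<in> el G A" then show "?\<phi> A y \<in> el H A" using r[OF A] app_el[OF h A] by blast
    next
      fix y y' assume y: "y \<in> el G A" "y' \<in> el G A"
      note ry = r[OF A y(1)] r[OF A y(2)]
      have "?\<phi> A (y \<otimes>\<^bsub>Val G A\<^esub> y') = ?\<phi> A (app t A (r A y \<otimes>\<^bsub>Val F A\<^esub> r A y'))"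
        using ry hom_mult[OF app_hom[OF t A]] by simp
      also have "\<dots> = app h A (r A y \<otimes>\<^bsub>Val F A\<^esub> r A y')" using h\<phi>[OF A] ry by simp
      also have "\<dots> = ?\<phi> A y \<otimes>\<^bsub>Val H A\<^esub> ?\<phi> A y'" using ry hom_mult[OF app_hom[OF h A]] by simp
      finally show "?\<phi> A (y \<otimes>\<^bsub>Val G A\<^esub> y') = ?\<phi> A y \<otimes>\<^bsub>Val H A\<^esub> ?\<phi> A y'" .
    qed
  next
    fix A B f y assume f: "f \<in> Hom E A B" and y: "y \<in> el G B"
    have o: "A \<in> Obj E" "B \<in> Obj E" using HomD[OF f] by auto
    note ry = r[OF o(2) y]
    have "?\<phi> A (Act G f y) = ?\<phi> A (app t A (Act F f (r B y)))" using app_act[OF t f] ry by simp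
    also have "\<dots> = app h A (Act F f (r B y))" using h\<phi>[OF o(1)] act_el[OF F f] ry by simp
    also have "\<dots> = Act H f (?\<phi> B y)" using app_act[OF h f] ry by simp
    finally show "?\<phi> A (Act G f y) = Act H f (?\<phi> B y)" .
  qed
  have "Cmp M (nat_hom G ?\<phi> H) t = h"
    by (rule Hom_Mod_eqI[OF Cmp_Mod_Hom[OF t u] h]) (simp add: app_Cmp[OF t] app_el[OF t] h\<phi>[symmetric])
  with u show ?thesis by blast
qed

lemma pw_surj_epi:
  assumes t: "t \<in> Hom M F G" and surj: "pw_surj t" and uv: "u \<in> Hom M G H" "v \<in> Hom M G H"
    and eq: "Cmp M u t = Cmp M v t"
  shows "u = v"
proof (rule Hom_Mod_eqI[OF uv])
  fix A y assume A: "A \<in> Obj E" and y: "y \<in> el G A"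
  obtain x where x: "x \<in> el F A" "app t A x = y"
    using surj A y unfolding pw_surj_iff[OF t] by blast
  show "app u A y = app v A y"
    using app_Cmp[OF t A x(1), of u] app_Cmp[OF t A x(1), of v] eq x(2) by simp
qed

lemma pw_inj_factor:
  assumes k: "k \<in> Hom M F G" and inj: "pw_inj k" and h: "h \<in> Hom M T G"
    and im: "\<And>A x. A \<in> Obj E \<Longrightarrow> x \<in> el T A \<Longrightarrow> \<exists>y \<in> el F A. app k A y = app h A x"
  shows "\<exists>u \<in> Hom M T F. Cmp M k u = h"
proof -
  have F: "additive_presheaf E F" and G: "additive_presheaf E G" and T: "additive_presheaf E T"
    using Hom_presheaf[OF k] Hom_presheaf[OF h] by auto
  obtain r where r: "\<And>A x. A \<in> Obj E \<Longrightarrow> x \<in> el T A \<Longrightarrow> r A x \<in> el F A \<and> app k A (r A x) = app h A x"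
    using im by metis
  have eqI: "y = y'" if "A \<in> Obj E" "y \<in> el F A" "y' \<in> el F A" "app k A y = app k A y'" for A y y'
    using pw_inj_inj_on[OF k inj that(1)] that by (auto dest: inj_onD)
  have u: "nat_hom T r F \<in> Hom M T F"
  proof (rule nat_homI[OF T F])
    fix A assume A: "A \<in> Obj E"
    interpret TA: group "Val T A" by (rule val_group[OF T A])
    interpret FA: group "Val F A" by (rule val_group[OF F A])
    show "r A \<in> hom (Val T A) (Val F A)"
    proof (rule homI)
      fix x x' assume x: "x \<in> el T A" "x' \<in> el T A"
      show "r A (x \<otimes>\<^bsub>Val T A\<^esub> x') = r A x \<otimes>\<^bsub>Val F A\<^esub> r A x'"
        by (rule eqI[OF A]) (use r[OF A] x hom_mult[OF app_hom[OF k A]] hom_mult[OF app_hom[OF h A]] in auto)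
    qed (use r[OF A] in blast)
  next
    fix A B f x assume f: "f \<in> Hom E A B" and x: "x \<in> el T B"
    have o: "A \<in> Obj E" "B \<in> Obj E" using HomD[OF f] by auto
    show "r A (Act T f x) = Act F f (r B x)"
      by (rule eqI[OF o(1)])
        (use r o x act_el[OF T f] act_el[OF F f] app_act[OF k f] app_act[OF h f] in auto)
  qed
  have "Cmp M k (nat_hom T r F) = h"
    by (rule Hom_Mod_eqI[OF Cmp_Mod_Hom[OF u k] h]) (simp add: app_Cmp[OF u] r)
  with u show ?thesis by blast
qed

lemma pw_inj_mono:
  assumes k: "k \<in> Hom M F G" and inj: "pw_inj k" and uv: "u \<in> Hom M T F" "v \<in> Hom M T F"
    and eq: "Cmp M k u = Cmp M k v"
  shows "u = v"
proof (rule Hom_Mod_eqI[OF uv])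
  fix A x assume A: "A \<in> Obj E" and x: "x \<in> el T A"
  have "app k A (app u A x) = app k A (app v A x)"
    using app_Cmp[OF uv(1) A x, of k] app_Cmp[OF uv(2) A x, of k] eq by simp
  then show "app u A x = app v A x"
    using pw_inj_inj_on[OF k inj A] app_el[OF uv(1) A x] app_el[OF uv(2) A x] by (auto dest: inj_onD)
qed

lemma pw_exact_Cmp:
  assumes i: "i \<in> Hom M F G" and p: "p \<in> Hom M G H" and ex: "pw_exact i p" and A: "A \<in> Obj E" "x \<in> el F A"
  shows "app p A (app i A x) = \<one>\<^bsub>Val H A\<^esub>"
  using ex A app_el[OF i A] unfolding pw_exact_iff[OF p i] by blast

lemma pw_exactD:
  assumes i: "i \<in> Hom M F G" and p: "p \<in> Hom M G H" and ex: "pw_exact i p" and A: "A \<in> Obj E" "x \<in> el G A"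
    and "app p A x = \<one>\<^bsub>Val H A\<^esub>"
  shows "\<exists>y \<in> el F A. app i A y = x"
  using ex A assms(6) unfolding pw_exact_iff[OF p i] by blast

section \<open>Cokernels of presheaves\<close>

text \<open>
  Quotients by the image of \<open>t\<close> are carried by chosen representatives of the cosets instead of the
  cosets themselves; this keeps the cokernel in the universe \<open>'u\<close> of its source.
\<close>

definition coker_rep :: "('o, 'a, 'u) presheaf_arr \<Rightarrow> 'o \<Rightarrow> 'u \<Rightarrow> 'u" where
  "coker_rep t A y = (SOME y'. \<exists>x \<in> el (fst t) A. y' = y \<otimes>\<^bsub>Val (snd (snd t)) A\<^esub> app t A x)"

definition coker_presheaf :: "('o, 'a, 'u) presheaf_arr \<Rightarrow> ('o, 'a, 'u) presheaf" where
  "coker_presheaf t =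
    \<lparr>Val = (\<lambda>A. \<lparr>carrier = coker_rep t A ` el (snd (snd t)) A,
        mult = (\<lambda>y y'. coker_rep t A (y \<otimes>\<^bsub>Val (snd (snd t)) A\<^esub> y')),
        one = coker_rep t A \<one>\<^bsub>Val (snd (snd t)) A\<^esub>\<rparr>),
     Act = (\<lambda>f y. coker_rep t (Dom E f) (Act (snd (snd t)) f y))\<rparr>"

context
  fixes t F G
  assumes t: "t \<in> Hom M F G"
begin

lemma coker_rep_spec:
  assumes A: "A \<in> Obj E"
  shows "\<exists>x \<in> el F A. coker_rep t A y = y \<otimes>\<^bsub>Val G A\<^esub> app t A x"
proof -
  have fs: "fst t = F" "snd (snd t) = G" using Hom_fst_snd[OF t] by auto
  have "\<exists>y' x. x \<in> el F A \<and> y' = y \<otimes>\<^bsub>Val G A\<^esub> app t A x"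
    using el_one[OF _ A, of F] Hom_presheaf[OF t] by blast
  then show ?thesis
    unfolding coker_rep_def fs
    using someI_ex[of "\<lambda>y'. \<exists>x \<in> el F A. y' = y \<otimes>\<^bsub>Val G A\<^esub> app t A x"] by blast
qed

lemma coker_rep_eq_iff:
  assumes A: "A \<in> Obj E" and y: "y \<in> el G A" "y' \<in> el G A"
  shows "coker_rep t A y = coker_rep t A y' \<longleftrightarrow> (\<exists>x \<in> el F A. y' = y \<otimes>\<^bsub>Val G A\<^esub> app t A x)"
proof -
  note p = Hom_presheaf[OF t] and fs = Hom_fst_snd[OF t]
  interpret G: comm_group "Val G A" by (rule val_comm_group[OF conjunct2[OF p] A])
  interpret F: group "Val F A" by (rule val_group[OF conjunct1[OF p] A])
  interpret h: group_hom "Val F A" "Val G A" "app t A"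
    by unfold_locales (rule app_hom[OF t A])
  show ?thesis
  proof
    assume eq: "coker_rep t A y = coker_rep t A y'"
    obtain x where x: "x \<in> el F A" "coker_rep t A y = y \<otimes>\<^bsub>Val G A\<^esub> app t A x" using coker_rep_spec[OF A] by blast
    obtain x' where x': "x' \<in> el F A" "coker_rep t A y' = y' \<otimes>\<^bsub>Val G A\<^esub> app t A x'" using coker_rep_spec[OF A] by blast
    have "y' = (y \<otimes>\<^bsub>Val G A\<^esub> app t A x) \<otimes>\<^bsub>Val G A\<^esub> inv\<^bsub>Val G A\<^esub> app t A x'"
      using eq x x' y by (metis G.inv_solve_right h.hom_closed G.m_closed)
    also have "\<dots> = y \<otimes>\<^bsub>Val G A\<^esub> app t A (x \<otimes>\<^bsub>Val F A\<^esub> inv\<^bsub>Val F A\<^esub> x')"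
      using x x' y by (simp add: G.m_assoc)
    finally show "\<exists>x \<in> el F A. y' = y \<otimes>\<^bsub>Val G A\<^esub> app t A x" using x x' by blast
  next
    assume "\<exists>x \<in> el F A. y' = y \<otimes>\<^bsub>Val G A\<^esub> app t A x"
    then obtain x where x: "x \<in> el F A" "y' = y \<otimes>\<^bsub>Val G A\<^esub> app t A x" by blast
    have "(\<exists>a \<in> el F A. z = y \<otimes>\<^bsub>Val G A\<^esub> app t A a) \<longleftrightarrow> (\<exists>a \<in> el F A. z = y' \<otimes>\<^bsub>Val G A\<^esub> app t A a)" for z
    proof
      assume "\<exists>a \<in> el F A. z = y \<otimes>\<^bsub>Val G A\<^esub> app t A a"
      then obtain a where a: "a \<in> el F A" "z = y \<otimes>\<^bsub>Val G A\<^esub> app t A a" by blast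
      have "z = y' \<otimes>\<^bsub>Val G A\<^esub> app t A (inv\<^bsub>Val F A\<^esub> x \<otimes>\<^bsub>Val F A\<^esub> a)"
        using x a y by (simp add: G.m_assoc G.inv_solve_left' flip: h.hom_mult) (simp add: F.m_assoc[symmetric])
      then show "\<exists>a \<in> el F A. z = y' \<otimes>\<^bsub>Val G A\<^esub> app t A a" using x a by blast
    next
      assume "\<exists>a \<in> el F A. z = y' \<otimes>\<^bsub>Val G A\<^esub> app t A a"
      then obtain a where a: "a \<in> el F A" "z = y' \<otimes>\<^bsub>Val G A\<^esub> app t A a" by blast
      have "z = y \<otimes>\<^bsub>Val G A\<^esub> app t A (x \<otimes>\<^bsub>Val F A\<^esub> a)"
        using x a y by (simp add: G.m_assoc)
      then show "\<exists>a \<in> el F A. z = y \<otimes>\<^bsub>Val G A\<^esub> app t A a" using x a by blast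
    qed
    then show "coker_rep t A y = coker_rep t A y'" unfolding coker_rep_def using fs by simp
  qed
qed

lemma coker_rep_el:
  assumes A: "A \<in> Obj E" and y: "y \<in> el G A"
  shows "coker_rep t A y \<in> el G A"
proof -
  interpret G: group "Val G A" using val_group Hom_presheaf[OF t] A by blast
  show ?thesis using coker_rep_spec[OF A, of y] y app_el[OF t A] by auto
qed

lemma coker_rep_hom:
  assumes A: "A \<in> Obj E"
  shows "coker_rep t A \<in> hom (Val G A) (Val (coker_presheaf t) A)"
proof (rule homI)
  note p = Hom_presheaf[OF t] and fs = Hom_fst_snd[OF t]
  interpret G: comm_group "Val G A" by (rule val_comm_group[OF conjunct2[OF p] A])
  interpret F: group "Val F A" by (rule val_group[OF conjunct1[OF p] A])
  interpret h: group_hom "Val F A" "Val G A" "app t A"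
    by unfold_locales (rule app_hom[OF t A])
  fix y y' assume y: "y \<in> el G A" "y' \<in> el G A"
  note r = coker_rep_el[OF A y(1)] coker_rep_el[OF A y(2)]
  obtain x where x: "x \<in> el F A" "coker_rep t A y = y \<otimes>\<^bsub>Val G A\<^esub> app t A x"
    using coker_rep_spec[OF A] by blast
  obtain x' where x': "x' \<in> el F A" "coker_rep t A y' = y' \<otimes>\<^bsub>Val G A\<^esub> app t A x'"
    using coker_rep_spec[OF A] by blast
  have "coker_rep t A y \<otimes>\<^bsub>Val G A\<^esub> coker_rep t A y' = (y \<otimes>\<^bsub>Val G A\<^esub> y') \<otimes>\<^bsub>Val G A\<^esub> app t A (x \<otimes>\<^bsub>Val F A\<^esub> x')"
    using x x' y by (simp add: G.m_ac)
  then have "coker_rep t A (y \<otimes>\<^bsub>Val G A\<^esub> y') = coker_rep t A (coker_rep t A y \<otimes>\<^bsub>Val G A\<^esub> coker_rep t A y')"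
    using coker_rep_eq_iff[OF A, of "y \<otimes>\<^bsub>Val G A\<^esub> y'" "coker_rep t A y \<otimes>\<^bsub>Val G A\<^esub> coker_rep t A y'"] y r x x'
      F.m_closed by blast
  then show "coker_rep t A (y \<otimes>\<^bsub>Val G A\<^esub> y') = coker_rep t A y \<otimes>\<^bsub>Val (coker_presheaf t) A\<^esub> coker_rep t A y'"
    by (simp add: coker_presheaf_def fs)
qed (simp add: coker_presheaf_def Hom_fst_snd[OF t])

lemma act_coker:
  assumes f: "f \<in> Hom E A B" and y: "y \<in> el G B"
  shows "Act (coker_presheaf t) f (coker_rep t B y) = coker_rep t A (Act G f y)"
proof -
  have G: "additive_presheaf E G" and F: "additive_presheaf E F" and fs: "snd (snd t) = G"
    using Hom_presheaf[OF t] Hom_fst_snd[OF t] by auto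
  have A: "A \<in> Obj E" "B \<in> Obj E" "Dom E f = A" using HomD[OF f] by auto
  obtain x where x: "x \<in> el F B" "coker_rep t B y = y \<otimes>\<^bsub>Val G B\<^esub> app t B x"
    using coker_rep_spec[OF A(2)] by blast
  have "Act G f (coker_rep t B y) = Act G f y \<otimes>\<^bsub>Val G A\<^esub> app t A (Act F f x)"
    using x hom_mult[OF act_hom[OF G f] y] app_el[OF t A(2)] app_act[OF t f] by simp
  then have "coker_rep t A (Act G f y) = coker_rep t A (Act G f (coker_rep t B y))"
    using coker_rep_eq_iff[OF A(1) act_el[OF G f y] act_el[OF G f coker_rep_el[OF A(2) y]]] act_el[OF F f x(1)] by blast
  then show ?thesis by (simp add: coker_presheaf_def fs A)
qed

lemma el_coker: "el (coker_presheaf t) A = coker_rep t A ` el G A"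
  using Hom_fst_snd[OF t] by (simp add: coker_presheaf_def)

lemma additive_presheaf_coker: "additive_presheaf E (coker_presheaf t)"
proof -
  have G: "additive_presheaf E G" and fs: "snd (snd t) = G"
    using Hom_presheaf[OF t] Hom_fst_snd[OF t] by auto
  note mult = hom_mult[OF coker_rep_hom]
  have *: "Act (coker_presheaf t) f \<in> hom (Val (coker_presheaf t) B) (Val (coker_presheaf t) A)"
    if f: "f \<in> Hom E A B" for f A B
  proof (rule homI)
    have A: "A \<in> Obj E" "B \<in> Obj E" using HomD[OF f] by auto
    interpret GB: comm_group "Val G B" by (rule val_comm_group[OF G A(2)])
    fix z assume z: "z \<in> el (coker_presheaf t) B"
    then obtain y where y: "y \<in> el G B" "z = coker_rep t B y" by (auto simp: el_coker)
    then show "Act (coker_presheaf t) f z \<in> el (coker_presheaf t) A"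
      using act_coker[OF f y(1)] act_el[OF G f y(1)] by (simp add: el_coker)
    fix z' assume z': "z' \<in> el (coker_presheaf t) B"
    then obtain y' where y': "y' \<in> el G B" "z' = coker_rep t B y'" by (auto simp: el_coker)
    have "Act (coker_presheaf t) f (z \<otimes>\<^bsub>Val (coker_presheaf t) B\<^esub> z') = coker_rep t A (Act G f (y \<otimes>\<^bsub>Val G B\<^esub> y'))"
      using mult[OF A(2) y(1) y'(1)] y y' act_coker[OF f, of "y \<otimes>\<^bsub>Val G B\<^esub> y'"] by simp
    also have "\<dots> = coker_rep t A (Act G f y) \<otimes>\<^bsub>Val (coker_presheaf t) A\<^esub> coker_rep t A (Act G f y')"
      using hom_mult[OF act_hom[OF G f] y(1) y'(1)] mult[OF A(1) act_el[OF G f y(1)] act_el[OF G f y'(1)]]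
      by simp
    finally show "Act (coker_presheaf t) f (z \<otimes>\<^bsub>Val (coker_presheaf t) B\<^esub> z')
        = Act (coker_presheaf t) f z \<otimes>\<^bsub>Val (coker_presheaf t) A\<^esub> Act (coker_presheaf t) f z'"
      using act_coker[OF f] y y' by simp
  qed
  show ?thesis
    unfolding additive_presheaf_def
  proof (intro conjI ballI impI)
    fix A assume A: "A \<in> Obj E"
    interpret GA: comm_group "Val G A" by (rule val_comm_group[OF G A])
    show "comm_group (Val (coker_presheaf t) A)"
      using GA.hom_imp_img_comm_group[OF coker_rep_hom[OF A]] by (simp add: coker_presheaf_def fs)
    fix z assume "z \<in> el (coker_presheaf t) A"
    then obtain y where y: "y \<in> el G A" "z = coker_rep t A y" by (auto simp: el_coker)
    then show "Act (coker_presheaf t) (Idn E A) z = z"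
      using act_coker[OF Idn_Hom[OF A] y(1)] act_Idn[OF G A y(1)] by simp
  next
    fix f assume "f \<in> Arr E"
    then show "Act (coker_presheaf t) f \<in> hom (Val (coker_presheaf t) (Cod E f)) (Val (coker_presheaf t) (Dom E f))"
      using *[OF Arr_Hom] by simp
  next
    fix f g z assume fg: "f \<in> Arr E" "g \<in> Arr E" "Cod E f = Dom E g" and "z \<in> el (coker_presheaf t) (Cod E g)"
    then obtain y where y: "y \<in> el G (Cod E g)" "z = coker_rep t (Cod E g) y" by (auto simp: el_coker)
    have f: "f \<in> Hom E (Dom E f) (Dom E g)" and g: "g \<in> Hom E (Dom E g) (Cod E g)"
      using fg by (auto simp: Hom_def)
    show "Act (coker_presheaf t) (Cmp E g f) z = Act (coker_presheaf t) f (Act (coker_presheaf t) g z)"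
      unfolding y(2) act_coker[OF Cmp_Hom[OF f g] y(1)] act_coker[OF g y(1)]
        act_coker[OF f act_el[OF G g y(1)]] act_Cmp[OF G f g y(1)] ..
  next
    fix A B f g z assume A: "A \<in> Obj E" "B \<in> Obj E" and f: "f \<in> Hom E A B" and g: "g \<in> Hom E A B"
      and "z \<in> el (coker_presheaf t) B"
    then obtain y where y: "y \<in> el G B" "z = coker_rep t B y" by (auto simp: el_coker)
    show "Act (coker_presheaf t) (Add E f g) z
        = Act (coker_presheaf t) f z \<otimes>\<^bsub>Val (coker_presheaf t) A\<^esub> Act (coker_presheaf t) g z"
      unfolding y(2) act_coker[OF Add_Hom[OF f g] y(1)] act_coker[OF f y(1)] act_coker[OF g y(1)]
        act_Add[OF G f g y(1)] by (rule mult[OF A(1) act_el[OF G f y(1)] act_el[OF G g y(1)]])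
  qed
qed

lemma pw_cokernel_exists:
  "\<exists>H. \<exists>c \<in> Hom M G H. pw_surj c \<and> pw_exact t c"
proof -
  let ?H = "coker_presheaf t" and ?c = "nat_hom G (coker_rep t) (coker_presheaf t)"
  have G: "additive_presheaf E G" and fs: "snd (snd t) = G"
    using Hom_presheaf[OF t] Hom_fst_snd[OF t] by auto
  have c: "?c \<in> Hom M G ?H"
    by (rule nat_homI[OF G additive_presheaf_coker coker_rep_hom act_coker[symmetric]])
  have "pw_surj ?c" unfolding pw_surj_iff[OF c] by (auto simp: el_coker)
  moreover have "pw_exact t ?c"
    unfolding pw_exact_iff[OF c t]
  proof (intro ballI)
    fix A y assume A: "A \<in> Obj E" and y: "y \<in> el G A"
    interpret G: group "Val G A" by (rule val_group[OF G A])
    have "app ?c A y = \<one>\<^bsub>Val ?H A\<^esub> \<longleftrightarrow> coker_rep t A \<one>\<^bsub>Val G A\<^esub> = coker_rep t A y"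
      using A y by (auto simp: coker_presheaf_def fs)
    also have "\<dots> \<longleftrightarrow> (\<exists>x \<in> el F A. app t A x = y)"
      using coker_rep_eq_iff[OF A G.one_closed y] app_el[OF t A] by auto
    finally show "app ?c A y = \<one>\<^bsub>Val ?H A\<^esub> \<longleftrightarrow> (\<exists>x \<in> el F A. app t A x = y)" .
  qed
  ultimately show ?thesis using c by blast
qed

end

section \<open>The Yoneda embedding\<close>

lemma el_yoneda [simp]: "el (Y B) A = Hom E A B"
  by (simp add: yoneda_obj_def)

lemma Val_yoneda [simp]: "Val (Y B) A = hom_group E A B"
  by (simp add: yoneda_obj_def)

lemma Act_yoneda [simp]: "Act (Y B) f u = Cmp E u f"
  by (simp add: yoneda_obj_def)

lemma additive_presheaf_yoneda:
  assumes B: "B \<in> Obj E"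
  shows "additive_presheaf E (Y B)"
  unfolding additive_presheaf_def
proof (intro conjI ballI impI)
  fix f assume "f \<in> Arr E"
  have "(\<lambda>u. Cmp E u f) \<in> hom (hom_group E (Cod E f) B) (hom_group E (Dom E f) B)"
    by (rule Cmp_hom_left[OF Arr_Hom B]) fact
  then show "Act (Y B) f \<in> hom (Val (Y B) (Cod E f)) (Val (Y B) (Dom E f))" by (simp add: yoneda_obj_def)
next
  fix f g x assume fg: "f \<in> Arr E" "g \<in> Arr E" "Cod E f = Dom E g" and "x \<in> el (Y B) (Cod E g)"
  then have "f \<in> Hom E (Dom E f) (Dom E g)" "g \<in> Hom E (Dom E g) (Cod E g)" "x \<in> Hom E (Cod E g) B"
    by (auto simp: Hom_def yoneda_obj_def)
  then show "Act (Y B) (Cmp E g f) x = Act (Y B) f (Act (Y B) g x)" by (simp add: Cmp_assoc)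
qed (use hom_comm_group B in \<open>auto simp: Cmp_Idn Cmp_Add_right\<close>)

lemma yoneda_arr_nat_hom: "f \<in> Hom E A B \<Longrightarrow> Ya f = nat_hom (Y A) (\<lambda>X u. Cmp E f u) (Y B)"
  using HomD[of f A B] by (simp add: yoneda_arr_def nat_hom_def)

lemma yoneda_arr_Hom:
  assumes f: "f \<in> Hom E A B"
  shows "Ya f \<in> Hom M (Y A) (Y B)"
  unfolding yoneda_arr_nat_hom[OF f]
proof (rule nat_homI)
  have o: "A \<in> Obj E" "B \<in> Obj E" using HomD[OF f] by auto
  show "additive_presheaf E (Y A)" "additive_presheaf E (Y B)" using o additive_presheaf_yoneda by auto
  show "Cmp E f \<in> hom (Val (Y A) X) (Val (Y B) X)" if "X \<in> Obj E" for X
    using Cmp_hom_right[OF f that] by simp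
qed (simp add: Cmp_assoc[OF _ _ f])

lemma app_yoneda_arr:
  assumes f: "f \<in> Hom E A B" and u: "u \<in> Hom E X A"
  shows "app (Ya f) X u = Cmp E f u"
  using HomD[OF u] u by (simp add: yoneda_arr_nat_hom[OF f])

lemma app_from_yoneda:
  assumes t: "t \<in> Hom M (Y B) F" and u: "u \<in> Hom E A B"
  shows "app t A u = Act F u (app t B (Idn E B))"
  using app_act[OF t u, of "Idn E B"] Idn_Hom[of B] HomD[OF u] Idn_Cmp[OF u] by simp

lemma yoneda_elem:
  assumes F: "additive_presheaf E F" and B: "B \<in> Obj E" and x: "x \<in> el F B"
  shows "\<exists>t \<in> Hom M (Y B) F. (\<forall>A \<in> Obj E. \<forall>u \<in> Hom E A B. app t A u = Act F u x) \<and> app t B (Idn E B) = x"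
proof (intro bexI conjI)
  show "nat_hom (Y B) (\<lambda>A u. Act F u x) F \<in> Hom M (Y B) F"
    by (rule nat_homI[OF additive_presheaf_yoneda[OF B] F])
      (use act_hom_arr[OF F _ B x] act_Cmp[OF F _ _ x] in simp_all)
qed (simp_all add: B Idn_Hom act_Idn[OF F B x])

lemma yoneda_eqI:
  assumes t: "t \<in> Hom M (Y B) F" "t' \<in> Hom M (Y B) F" and eq: "app t B (Idn E B) = app t' B (Idn E B)"
  shows "t = t'"
  by (rule Hom_Mod_eqI[OF t]) (simp add: app_from_yoneda[OF t(1)] app_from_yoneda[OF t(2)] eq)

lemma is_functor_yoneda: "is_functor E M Y Ya"
  unfolding is_functor_def
proof (intro conjI ballI impI)
  fix A assume A: "A \<in> Obj E"
  show "Y A \<in> Obj M" by (simp add: Obj_Mod additive_presheaf_yoneda[OF A])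
  show "Ya (Idn E A) = Idn M (Y A)"
  proof (rule Hom_Mod_eqI[OF yoneda_arr_Hom[OF Idn_Hom[OF A]] Idn_Mod_Hom[OF additive_presheaf_yoneda[OF A]]])
    fix X u assume "X \<in> Obj E" "u \<in> el (Y A) X"
    then show "app (Ya (Idn E A)) X u = app (Idn M (Y A)) X u"
      using app_yoneda_arr[OF Idn_Hom[OF A], of u X] Idn_Cmp[of u X A] by (simp add: Idn_Mod)
  qed
next
  fix f assume "f \<in> Arr E" then show "Ya f \<in> Hom M (Y (Dom E f)) (Y (Cod E f))"
    using yoneda_arr_Hom Arr_Hom by blast
next
  fix f g assume "f \<in> Arr E" "g \<in> Arr E" "Cod E f = Dom E g"
  then have f: "f \<in> Hom E (Dom E f) (Dom E g)" and g: "g \<in> Hom E (Dom E g) (Cod E g)"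
    by (auto simp: Hom_def)
  show "Ya (Cmp E g f) = Cmp M (Ya g) (Ya f)"
  proof (rule Hom_Mod_eqI[OF yoneda_arr_Hom[OF Cmp_Hom[OF f g]]
        Cmp_Mod_Hom[OF yoneda_arr_Hom[OF f] yoneda_arr_Hom[OF g]]])
    fix X u assume X: "X \<in> Obj E" and "u \<in> el (Y (Dom E f)) X"
    then have u: "u \<in> Hom E X (Dom E f)" by simp
    show "app (Ya (Cmp E g f)) X u = app (Cmp M (Ya g) (Ya f)) X u"
      using app_Cmp[OF yoneda_arr_Hom[OF f] X, of u "Ya g"] u app_yoneda_arr[OF Cmp_Hom[OF f g] u]
        app_yoneda_arr[OF f u] app_yoneda_arr[OF g Cmp_Hom[OF u f]] Cmp_assoc[OF u f g] by simp
  qed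
qed (fact category_axioms category_Mod)+

lemma yoneda_full:
  assumes t: "t \<in> Hom M (Y A) (Y B)" and o: "A \<in> Obj E" "B \<in> Obj E"
  shows "\<exists>f \<in> Hom E A B. Ya f = t"
proof -
  have f: "app t A (Idn E A) \<in> Hom E A B" using app_el[OF t o(1)] Idn_Hom[OF o(1)] by simp
  have "Ya (app t A (Idn E A)) = t"
    by (rule yoneda_eqI[OF yoneda_arr_Hom[OF f] t]) (simp add: app_yoneda_arr[OF f Idn_Hom[OF o(1)]] Cmp_Idn[OF f])
  with f show ?thesis by blast
qed

lemma yoneda_faithful:
  assumes f: "f \<in> Hom E A B" "f' \<in> Hom E A B" and eq: "Ya f = Ya f'"
  shows "f = f'"
proof -
  have "Idn E A \<in> Hom E A A" using Idn_Hom HomD[OF f(1)] by blast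
  then have "Cmp E f (Idn E A) = Cmp E f' (Idn E A)"
    using app_yoneda_arr[OF f(1)] app_yoneda_arr[OF f(2)] eq by metis
  then show ?thesis using Cmp_Idn[OF f(1)] Cmp_Idn[OF f(2)] by simp
qed

section \<open>Kernels and cokernels are pointwise\<close>

context
  fixes S :: "('o, 'a, 'a) presheaf set"
  assumes S: "Y ` Obj E \<subseteq> S"
begin

abbreviation "MS \<equiv> full_subcat M S"

interpretation S: category MS by (rule category_full_subcat[OF category_Mod])

text \<open>
  All kernels and cokernels below live in a full subcategory that contains the representables. The
  representable at a zero object is a zero object there, so that zero arrows are those
  with zero components (\<open>zero_arr_iff_app\<close>).
\<close>

lemma is_zero_yoneda:
  assumes Z: "is_zero E Z"
  shows "is_zero MS (Y Z)"
  unfolding is_zero_def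
proof (intro conjI ballI)
  have ZO: "Z \<in> Obj E" by (rule is_zero_Obj[OF Z])
  note YZ = additive_presheaf_yoneda[OF ZO]
  have ZS: "Y Z \<in> S" using S ZO by blast
  then show "Y Z \<in> Obj MS" using YZ by (simp add: Obj_Mod)
  fix F assume "F \<in> Obj MS"
  then have F: "F \<in> S" "additive_presheaf E F" by (auto simp: Obj_Mod)
  show "\<exists>!f. f \<in> Hom MS F (Y Z)"
  proof (rule ex1I)
    have "nat_hom F (\<lambda>A x. Zero E A Z) (Y Z) \<in> Hom M F (Y Z)"
    proof (rule nat_homI[OF F(2) YZ])
      show "(\<lambda>x. Zero E A Z) \<in> hom (Val F A) (Val (Y Z) A)" if "A \<in> Obj E" for A
        using trivial_hom[OF val_group[OF YZ that]] by simp
    qed (simp add: Cmp_Zero_left[OF _ ZO])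
    then show "nat_hom F (\<lambda>A x. Zero E A Z) (Y Z) \<in> Hom MS F (Y Z)" using F ZS by (simp add: Hom_full_subcat)
    show "t = nat_hom F (\<lambda>A x. Zero E A Z) (Y Z)" if "t \<in> Hom MS F (Y Z)" for t
      using Hom_Mod_eqI[OF _ \<open>nat_hom F _ _ \<in> Hom M F (Y Z)\<close>, of t] Hom_to_zero[OF Z] app_el[of t F "Y Z"]
        Hom_full_subcatD[OF that] by simp
  qed
  show "\<exists>!f. f \<in> Hom MS (Y Z) F"
  proof (rule ex1I)
    have "nat_hom (Y Z) (\<lambda>A x. \<one>\<^bsub>Val F A\<^esub>) F \<in> Hom M (Y Z) F"
      by (rule nat_homI[OF YZ F(2) trivial_hom[OF val_group[OF F(2)]]]) (simp_all add: act_one[OF F(2)])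
    then show "nat_hom (Y Z) (\<lambda>A x. \<one>\<^bsub>Val F A\<^esub>) F \<in> Hom MS (Y Z) F" using F ZS by (simp add: Hom_full_subcat)
    show "t = nat_hom (Y Z) (\<lambda>A x. \<one>\<^bsub>Val F A\<^esub>) F" if "t \<in> Hom MS (Y Z) F" for t
    proof (rule Hom_Mod_eqI[OF _ \<open>nat_hom (Y Z) _ _ \<in> Hom M (Y Z) F\<close>])
      show t: "t \<in> Hom M (Y Z) F" using Hom_full_subcatD[OF that] by simp
      fix A x assume A: "A \<in> Obj E" and x: "x \<in> el (Y Z) A"
      then show "app t A x = app (nat_hom (Y Z) (\<lambda>A x. \<one>\<^bsub>Val F A\<^esub>) F) A x"
        using app_one[OF t A] Hom_to_zero[OF Z, of x A] by simp
    qed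
  qed
qed

lemma zero_arr_iff_app:
  assumes t: "t \<in> Hom MS F G"
  shows "zero_arr MS t \<longleftrightarrow> (\<forall>A \<in> Obj E. \<forall>x \<in> el F A. app t A x = \<one>\<^bsub>Val G A\<^esub>)"
proof -
  obtain Z where Z: "is_zero E Z" using ex_zero by blast
  note YZ = is_zero_yoneda[OF Z]
  have FG: "t \<in> Hom M F G" and o: "F \<in> Obj MS" "G \<in> Obj MS" using Hom_full_subcatD[OF t] S.HomD[OF t] by auto
  have 1: "app (Cmp M h g) A x = \<one>\<^bsub>Val G A\<^esub>"
    if "g \<in> Hom MS F (Y Z)" "h \<in> Hom MS (Y Z) G" "A \<in> Obj E" "x \<in> el F A" for g h A x
  proof -
    have g: "g \<in> Hom M F (Y Z)" and h: "h \<in> Hom M (Y Z) G" using Hom_full_subcatD[OF that(1)] Hom_full_subcatD[OF that(2)] by auto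
    show ?thesis
      using app_Cmp[OF g that(3,4), of h] app_el[OF g that(3,4)] Hom_to_zero[OF Z, of _ A] app_one[OF h that(3)]
      by simp
  qed
  show ?thesis
  proof
    assume "zero_arr MS t"
    then show "\<forall>A \<in> Obj E. \<forall>x \<in> el F A. app t A x = \<one>\<^bsub>Val G A\<^esub>"
      using S.zero_arr_via[OF YZ t] 1 by auto
  next
    assume 2: "\<forall>A \<in> Obj E. \<forall>x \<in> el F A. app t A x = \<one>\<^bsub>Val G A\<^esub>"
    obtain g h where gh: "g \<in> Hom MS F (Y Z)" "h \<in> Hom MS (Y Z) G"
      using S.zero_to[OF YZ o(1)] S.zero_from[OF YZ o(2)] by metis
    have "Cmp M h g \<in> Hom M F G" using Hom_full_subcatD[OF S.Cmp_Hom[OF gh]] by simp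
    then have "t = Cmp M h g" using Hom_Mod_eqI[OF FG] 1[OF gh] 2 by simp
    then show "zero_arr MS t" using S.zero_arr_via[OF YZ t] gh by auto
  qed
qed

lemma kernel_if_pw_exact:
  assumes i: "i \<in> Hom (MS) F G" and p: "p \<in> Hom (MS) G H"
    and ex: "pw_inj i" "pw_exact i p"
  shows "is_kernel (MS) i p"
proof -
  note z = zero_arr_iff_app
  have i': "i \<in> Hom M F G" "F \<in> S" "G \<in> S" and p': "p \<in> Hom M G H" "H \<in> S"
    using Hom_full_subcatD[OF i] Hom_full_subcatD[OF p] by auto
  show ?thesis
  proof (rule S.kernelI[OF p i])
    show "zero_arr (MS) (Cmp (MS) p i)"
      using z[OF S.Cmp_Hom[OF i p]] app_Cmp[OF i'(1)] pw_exact_Cmp[OF i'(1) p'(1) ex(2)] by simp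
  next
    fix T h assume h: "h \<in> Hom (MS) T G"
      "zero_arr (MS) (Cmp (MS) p h)"
    have h': "h \<in> Hom M T G" "T \<in> S" using Hom_full_subcatD[OF h(1)] by auto
    have 1: "app p A (app h A x) = \<one>\<^bsub>Val H A\<^esub>" if "A \<in> Obj E" "x \<in> el T A" for A x
      using z[OF S.Cmp_Hom[OF h(1) p]] h(2) app_Cmp[OF h'(1) that, of p] that by auto
    have "\<exists>u \<in> Hom M T F. Cmp M i u = h"
      by (rule pw_inj_factor[OF i'(1) ex(1) h'(1)], rule pw_exactD[OF i'(1) p'(1) ex(2)])
        (simp_all add: 1 app_el[OF h'(1)])
    then show "\<exists>u \<in> Hom (MS) T F. Cmp (MS) i u = h"
      using i' h' by (simp add: Hom_full_subcat)
  next
    fix T u v assume "u \<in> Hom (MS) T F" "v \<in> Hom (MS) T F"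
      "Cmp (MS) i u = Cmp (MS) i v"
    then show "u = v"
      using pw_inj_mono[OF i'(1) ex(1), of u T v] Hom_full_subcatD[of u M S T F]
        Hom_full_subcatD[of v M S T F] by simp
  qed
qed

lemma cokernel_if_pw_exact:
  assumes i: "i \<in> Hom (MS) F G" and p: "p \<in> Hom (MS) G H"
    and ex: "pw_exact i p" "pw_surj p"
  shows "is_cokernel (MS) p i"
proof -
  note z = zero_arr_iff_app
  have i': "i \<in> Hom M F G" "F \<in> S" "G \<in> S" and p': "p \<in> Hom M G H" "H \<in> S"
    using Hom_full_subcatD[OF i] Hom_full_subcatD[OF p] by auto
  show ?thesis
  proof (rule S.cokernelI[OF i p])
    show "zero_arr (MS) (Cmp (MS) p i)"
      using z[OF S.Cmp_Hom[OF i p]] app_Cmp[OF i'(1)] pw_exact_Cmp[OF i'(1) p'(1) ex(1)] by simp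
  next
    fix T h assume h: "h \<in> Hom (MS) G T"
      "zero_arr (MS) (Cmp (MS) h i)"
    have h': "h \<in> Hom M G T" "T \<in> S" using Hom_full_subcatD[OF h(1)] by auto
    have 1: "app h A (app i A x) = \<one>\<^bsub>Val T A\<^esub>" if "A \<in> Obj E" "x \<in> el F A" for A x
      using z[OF S.Cmp_Hom[OF i h(1)]] h(2) app_Cmp[OF i'(1) that, of h] that by auto
    have "\<exists>u \<in> Hom M H T. Cmp M u p = h"
    proof (rule pw_surj_factor[OF p'(1) ex(2) h'(1)])
      fix A x assume A: "A \<in> Obj E" and x: "x \<in> el G A" "app p A x = \<one>\<^bsub>Val H A\<^esub>"
      obtain y where "y \<in> el F A" "app i A y = x" using pw_exactD[OF i'(1) p'(1) ex(1) A x] by blast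
      then show "app h A x = \<one>\<^bsub>Val T A\<^esub>" using 1[OF A] by blast
    qed
    then show "\<exists>u \<in> Hom (MS) H T. Cmp (MS) u p = h"
      using p' h' by (simp add: Hom_full_subcat)
  next
    fix T u v assume "u \<in> Hom (MS) H T" "v \<in> Hom (MS) H T"
      "Cmp (MS) u p = Cmp (MS) v p"
    then show "u = v"
      using pw_surj_epi[OF p'(1) ex(2), of u T v] Hom_full_subcatD[of u M S H T]
        Hom_full_subcatD[of v M S H T] by simp
  qed
qed

text \<open>
  Elements of \<open>F(A)\<close> are maps \<open>\<bbbY>(A) \<rightarrow> F\<close>. Representables being available as test objects, kernels are
  computed pointwise.
\<close>

lemma pw_if_kernel:
  assumes i: "i \<in> Hom MS F G" and p: "p \<in> Hom MS G H" and ker: "is_kernel MS i p"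
  shows "pw_inj i" "pw_exact i p"
proof -
  note z = zero_arr_iff_app and ker = S.kernelD[OF ker i p]
  have i': "i \<in> Hom M F G" "F \<in> S" "G \<in> S" and p': "p \<in> Hom M G H"
    using Hom_full_subcatD[OF i] Hom_full_subcatD[OF p] by auto
  have F: "additive_presheaf E F" and G: "additive_presheaf E G" and HH: "additive_presheaf E H"
    using Hom_presheaf[OF i'(1)] Hom_presheaf[OF p'] by auto
  have H: "t \<in> Hom MS (Y A) T \<longleftrightarrow> t \<in> Hom M (Y A) T" if "A \<in> Obj E" "T \<in> S" for t A T
    using that S by (auto simp: Hom_full_subcat)
  have I: "Idn E A \<in> el (Y A) A" if "A \<in> Obj E" for A using Idn_Hom[OF that] by simp
  show "pw_inj i"
    unfolding pw_inj_iff[OF i'(1)]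
  proof (intro ballI impI)
    fix A x assume A: "A \<in> Obj E" and x: "x \<in> el F A" and ix: "app i A x = \<one>\<^bsub>Val G A\<^esub>"
    obtain t where t: "t \<in> Hom M (Y A) F" "app t A (Idn E A) = x" using yoneda_elem[OF F A x] by blast
    obtain t' where t': "t' \<in> Hom M (Y A) F" "app t' A (Idn E A) = \<one>\<^bsub>Val F A\<^esub>"
      using yoneda_elem[OF F A el_one[OF F A]] by blast
    have "Cmp M i t = Cmp M i t'"
      by (rule yoneda_eqI[OF Cmp_Mod_Hom[OF t(1) i'(1)] Cmp_Mod_Hom[OF t'(1) i'(1)]])
        (simp add: app_Cmp[OF t(1) A I[OF A]] app_Cmp[OF t'(1) A I[OF A]] t t' ix app_one[OF i'(1) A])
    then have "t = t'" using ker(3)[of t "Y A" t'] H[OF A] i'(2) t(1) t'(1) by simp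
    then show "x = \<one>\<^bsub>Val F A\<^esub>" using t(2) t'(2) by simp
  qed
  show "pw_exact i p"
    unfolding pw_exact_iff[OF p' i'(1)]
  proof (intro ballI iffI)
    fix A y assume A: "A \<in> Obj E" and y: "y \<in> el G A" and py: "app p A y = \<one>\<^bsub>Val H A\<^esub>"
    obtain t where t: "t \<in> Hom M (Y A) G" "app t A (Idn E A) = y" using yoneda_elem[OF G A y] by blast
    have t': "t \<in> Hom MS (Y A) G" using H[OF A i'(3)] t(1) by simp
    have pt: "Cmp M p t \<in> Hom M (Y A) H" by (rule Cmp_Mod_Hom[OF t(1) p'])
    have "zero_arr MS (Cmp MS p t)"
      unfolding z[OF S.Cmp_Hom[OF t' p]]
      using app_from_yoneda[OF pt] app_Cmp[OF t(1) A I[OF A], of p] t(2) py act_one[OF HH] by simp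
    then obtain v where "v \<in> Hom MS (Y A) F" "Cmp MS i v = t" using ker(2)[OF t'] by blast
    then have v: "v \<in> Hom M (Y A) F" "Cmp M i v = t" using H[OF A i'(2)] by simp_all
    have "app i A (app v A (Idn E A)) = y" using app_Cmp[OF v(1) A I[OF A], of i] v(2) t(2) by simp
    then show "\<exists>x \<in> el F A. app i A x = y" using app_el[OF v(1) A I[OF A]] by blast
  next
    fix A y assume A: "A \<in> Obj E" and "\<exists>x \<in> el F A. app i A x = y"
    then obtain x where x: "x \<in> el F A" "app i A x = y" by blast
    then show "app p A y = \<one>\<^bsub>Val H A\<^esub>"
      using z[OF S.Cmp_Hom[OF i p]] ker(1) app_Cmp[OF i'(1) A x(1), of p] A by simp
  qed
qed

end

text \<open>
  In the whole of \<open>Mod_cat\<close> there is a pointwise cokernel \<open>c'\<close>, and any other cokernel is isomorphic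
  to it.
\<close>

lemma pw_if_cokernel:
  fixes t c :: "('o, 'a, 'a) presheaf_arr"
  assumes t: "t \<in> Hom M F G" and c: "c \<in> Hom M G H" and coker: "is_cokernel M c t"
  shows "pw_surj c" "pw_exact t c"
proof -
  note z = zero_arr_iff_app[OF subset_UNIV, unfolded full_subcat_UNIV]
  note coker = M.cokernelD[OF coker c t]
  obtain H' c' where c': "c' \<in> Hom M G H'" "pw_surj c'" "pw_exact t c'" using pw_cokernel_exists[OF t] by blast
  have ct: "app c A (app t A x) = \<one>\<^bsub>Val H A\<^esub>" if "A \<in> Obj E" "x \<in> el F A" for A x
    using z[OF Cmp_Mod_Hom[OF t c]] coker(1) app_Cmp[OF t that, of c] that by simp
  have "zero_arr M (Cmp M c' t)"
    unfolding z[OF Cmp_Mod_Hom[OF t c'(1)]]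
    using app_Cmp[OF t] pw_exact_Cmp[OF t c'(1,3)] by simp
  then obtain u where u: "u \<in> Hom M H H'" "Cmp M u c = c'" using coker(2)[OF c'(1)] by blast
  have "\<exists>v \<in> Hom M H' H. Cmp M v c' = c"
  proof (rule pw_surj_factor[OF c'(1,2) c])
    fix A x assume A: "A \<in> Obj E" "x \<in> el G A" "app c' A x = \<one>\<^bsub>Val H' A\<^esub>"
    then obtain y where "y \<in> el F A" "app t A y = x" using pw_exactD[OF t c'(1,3) A] by blast
    then show "app c A x = \<one>\<^bsub>Val H A\<^esub>" using ct A(1) by blast
  qed
  then obtain v where v: "v \<in> Hom M H' H" "Cmp M v c' = c" by blast
  have "Cmp M (Cmp M v u) c = Cmp M (Idn M H) c"
    using M.Cmp_assoc[OF c u(1) v(1)] u(2) v(2) M.Idn_Cmp[OF c] by simp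
  then have vu: "Cmp M v u = Idn M H"
    using coker(3)[OF Cmp_Mod_Hom[OF u(1) v(1)] Idn_Mod_Hom] Hom_presheaf[OF c] by simp
  show "pw_surj c"
    unfolding pw_surj_iff[OF c]
  proof (intro ballI)
    fix A y assume A: "A \<in> Obj E" and y: "y \<in> el H A"
    have "app v A (app u A y) = y" using app_Cmp[OF u(1) A y, of v] vu A y by (simp add: Idn_Mod)
    moreover obtain x where x: "x \<in> el G A" "app c' A x = app u A y"
      using c'(2) app_el[OF u(1) A y] A unfolding pw_surj_iff[OF c'(1)] by blast
    ultimately show "\<exists>x \<in> el G A. app c A x = y"
      using app_Cmp[OF c'(1) A x(1), of v] v(2) by auto
  qed
  show "pw_exact t c"
    unfolding pw_exact_iff[OF c t]
  proof (intro ballI iffI)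
    fix A x assume A: "A \<in> Obj E" and x: "x \<in> el G A" and cx: "app c A x = \<one>\<^bsub>Val H A\<^esub>"
    have "app c' A x = \<one>\<^bsub>Val H' A\<^esub>" using app_Cmp[OF c A x, of u] u(2) cx app_one[OF u(1) A] by simp
    then show "\<exists>y \<in> el F A. app t A y = x" by (rule pw_exactD[OF t c'(1,3) A x])
  qed (use ct in auto)
qed

section \<open>Finitely presented presheaves by generators and relations\<close>

text \<open>
  \<open>F \<cong> coker \<bbbY>(f)\<close> in terms of elements: \<open>b\<close> is the class of the identity of the codomain of \<open>f\<close>,
  it generates \<open>F\<close>, and its annihilators are the arrows that factor through \<open>f\<close>.
\<close>

definition presents :: "'a \<Rightarrow> 'a \<Rightarrow> ('o, 'a, 'a) presheaf \<Rightarrow> bool" where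
  "presents f b F \<longleftrightarrow> f \<in> Arr E \<and> additive_presheaf E F \<and> b \<in> el F (Cod E f) \<and>
    (\<forall>A \<in> Obj E. \<forall>x \<in> el F A. \<exists>u \<in> Hom E A (Cod E f). x = Act F u b) \<and>
    (\<forall>A \<in> Obj E. \<forall>u \<in> Hom E A (Cod E f).
      Act F u b = \<one>\<^bsub>Val F A\<^esub> \<longleftrightarrow> (\<exists>v \<in> Hom E A (Dom E f). u = Cmp E f v))"

lemma presentsD:
  assumes "presents f b F" "f \<in> Hom E A B"
  shows "additive_presheaf E F" "b \<in> el F B"
    and presents_gen: "X \<in> Obj E \<Longrightarrow> x \<in> el F X \<Longrightarrow> \<exists>u \<in> Hom E X B. x = Act F u b"
    and presents_rel: "u \<in> Hom E X B \<Longrightarrow> Act F u b = \<one>\<^bsub>Val F X\<^esub> \<longleftrightarrow> (\<exists>v \<in> Hom E X A. u = Cmp E f v)"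
  using assms(1) HomD[OF assms(2)] HomD[of u X B] unfolding presents_def by auto

lemma presents_arr: "presents f b F \<Longrightarrow> f \<in> Hom E (Dom E f) (Cod E f)"
  by (simp add: presents_def Arr_Hom)

lemma presents_if_cokernel:
  assumes f: "f \<in> Hom E A B" and c: "c \<in> Hom M (Y B) F" "pw_surj c" "pw_exact (Ya f) c"
  shows "presents f (app c B (Idn E B)) F"
proof -
  let ?b = "app c B (Idn E B)"
  have o: "A \<in> Obj E" "B \<in> Obj E" using HomD[OF f] by auto
  show ?thesis
    unfolding presents_def
  proof (intro conjI ballI)
    show "f \<in> Arr E" "additive_presheaf E F" using HomD[OF f] Hom_presheaf[OF c(1)] by auto
    show "?b \<in> el F (Cod E f)" using HomD[OF f] app_el[OF c(1) o(2)] Idn_Hom[OF o(2)] by simp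
    fix X assume X: "X \<in> Obj E"
    show "\<exists>u \<in> Hom E X (Cod E f). x = Act F u ?b" if "x \<in> el F X" for x
      using c(2) X that HomD[OF f] app_from_yoneda[OF c(1)] unfolding pw_surj_iff[OF c(1)] by fastforce
    fix u assume "u \<in> Hom E X (Cod E f)"
    then have u: "u \<in> Hom E X B" using HomD[OF f] by simp
    have "app c X u = \<one>\<^bsub>Val F X\<^esub> \<longleftrightarrow> (\<exists>v \<in> el (Y A) X. app (Ya f) X v = u)"
      using c(3) X u unfolding pw_exact_iff[OF c(1) yoneda_arr_Hom[OF f]] by simp
    also have "\<dots> \<longleftrightarrow> (\<exists>v \<in> Hom E X (Dom E f). u = Cmp E f v)"
      using app_yoneda_arr[OF f] HomD[OF f] by auto
    finally show "Act F u ?b = \<one>\<^bsub>Val F X\<^esub> \<longleftrightarrow> (\<exists>v \<in> Hom E X (Dom E f). u = Cmp E f v)"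
      using app_from_yoneda[OF c(1) u] by simp
  qed
qed

lemma presents_generator:
  assumes b: "presents f b F" and f: "f \<in> Hom E A B"
  shows "\<exists>c \<in> Hom M (Y B) F. (\<forall>X \<in> Obj E. \<forall>u \<in> Hom E X B. app c X u = Act F u b) \<and> pw_surj c \<and> pw_exact (Ya f) c"
proof -
  have o: "A \<in> Obj E" "B \<in> Obj E" using HomD[OF f] by auto
  note P = presentsD[OF b f]
  obtain c where c: "c \<in> Hom M (Y B) F" "\<forall>X \<in> Obj E. \<forall>u \<in> Hom E X B. app c X u = Act F u b"
    using yoneda_elem[OF P(1) o(2) P(2)] by blast
  have "pw_surj c"
    using P(3) c(2) unfolding pw_surj_iff[OF c(1)] by fastforce
  moreover have "pw_exact (Ya f) c"
    unfolding pw_exact_iff[OF c(1) yoneda_arr_Hom[OF f]]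
  proof (intro ballI)
    fix X u assume X: "X \<in> Obj E" and "u \<in> el (Y B) X"
    then have u: "u \<in> Hom E X B" by simp
    have "app c X u = \<one>\<^bsub>Val F X\<^esub> \<longleftrightarrow> (\<exists>v \<in> Hom E X A. u = Cmp E f v)"
      using P(4)[OF u] c(2) X u by simp
    then show "app c X u = \<one>\<^bsub>Val F X\<^esub> \<longleftrightarrow> (\<exists>v \<in> el (Y A) X. app (Ya f) X v = u)"
      using app_yoneda_arr[OF f] by auto
  qed
  ultimately show ?thesis using c by blast
qed

lemma presents_cokernel:
  assumes f: "f \<in> Hom E A B"
  shows "(\<exists>b. presents f b F) \<longleftrightarrow> (\<exists>c \<in> Hom M (Y B) F. pw_surj c \<and> pw_exact (Ya f) c)"
  using presents_generator[OF _ f] presents_if_cokernel[OF f] by blast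

lemma yoneda_cokernels_iff:
  assumes S: "S \<subseteq> Arr E"
  shows "F \<in> yoneda_cokernels E S \<longleftrightarrow> (\<exists>f \<in> S. \<exists>b. presents f b F)"
proof -
  have "(\<exists>c. is_cokernel M c (Ya f) \<and> Cod M c = F) \<longleftrightarrow> (\<exists>b. presents f b F)" if "f \<in> S" for f
  proof -
    have f: "f \<in> Hom E (Dom E f) (Cod E f)" using that S Arr_Hom by blast
    note Yf = yoneda_arr_Hom[OF f]
    show ?thesis
      unfolding presents_cokernel[OF f]
    proof
      assume "\<exists>c. is_cokernel M c (Ya f) \<and> Cod M c = F"
      then obtain c where c: "is_cokernel M c (Ya f)" "Cod M c = F" by blast
      then have "c \<in> Hom M (Y (Cod E f)) F" using M.HomD[OF Yf] by (simp add: is_cokernel_def Hom_def)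
      then show "\<exists>c \<in> Hom M (Y (Cod E f)) F. pw_surj c \<and> pw_exact (Ya f) c"
        using pw_if_cokernel[OF Yf _ c(1)] by blast
    next
      assume "\<exists>c \<in> Hom M (Y (Cod E f)) F. pw_surj c \<and> pw_exact (Ya f) c"
      then obtain c where c: "c \<in> Hom M (Y (Cod E f)) F" "pw_surj c" "pw_exact (Ya f) c" by blast
      have "is_cokernel M c (Ya f)"
        using cokernel_if_pw_exact[OF subset_UNIV, unfolded full_subcat_UNIV, OF Yf c(1,3,2)] .
      then show "\<exists>c. is_cokernel M c (Ya f) \<and> Cod M c = F" using M.HomD[OF c(1)] by blast
    qed
  qed
  then show ?thesis unfolding yoneda_cokernels_def by blast
qed

lemma presents_exists:
  assumes f: "f \<in> Hom E A B"
  shows "\<exists>F :: ('o, 'a, 'a) presheaf. \<exists>b. presents f b F"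
proof -
  have "\<exists>F. \<exists>c \<in> Hom M (Y B) F. pw_surj c \<and> pw_exact (Ya f) c"
    by (rule pw_cokernel_exists[OF yoneda_arr_Hom[OF f]])
  then show ?thesis using presents_cokernel[OF f] by blast
qed

lemma presents_app:
  assumes b: "presents f b F" and f: "f \<in> Hom E A B" and t: "t \<in> Hom M F G" and u: "u \<in> Hom E X B"
  shows "app t X (Act F u b) = Act G u (app t B b)"
  by (rule app_act[OF t u presentsD(2)[OF b f]])

lemma presents_eqI:
  assumes b: "presents f b F" and f: "f \<in> Hom E A B" and t: "t \<in> Hom M F G" "t' \<in> Hom M F G"
    and eq: "app t B b = app t' B b"
  shows "t = t'"
proof (rule Hom_Mod_eqI[OF t])
  fix X x assume X: "X \<in> Obj E" and x: "x \<in> el F X"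
  obtain u where u: "u \<in> Hom E X B" "x = Act F u b" using presents_gen[OF b f X x] by blast
  show "app t X x = app t' X x"
    using presents_app[OF b f t(1) u(1)] presents_app[OF b f t(2) u(1)] u(2) eq by simp
qed

text \<open>
  The universal property of generators and relations; \<open>presents_eqI\<close> is the uniqueness part.
\<close>

lemma presents_hom:
  assumes b: "presents f b F" and f: "f \<in> Hom E A B" and G: "additive_presheaf E G"
    and y: "y \<in> el G B" and fy: "Act G f y = \<one>\<^bsub>Val G A\<^esub>"
  shows "\<exists>t \<in> Hom M F G. app t B b = y"
proof -
  have o: "A \<in> Obj E" "B \<in> Obj E" using HomD[OF f] by auto
  note P = presentsD[OF b f]
  obtain c where c: "c \<in> Hom M (Y B) F" "\<forall>X \<in> Obj E. \<forall>u \<in> Hom E X B. app c X u = Act F u b" and surj: "pw_surj c"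
    using presents_generator[OF b f] by blast
  obtain h where h: "h \<in> Hom M (Y B) G" "\<forall>X \<in> Obj E. \<forall>u \<in> Hom E X B. app h X u = Act G u y"
    using yoneda_elem[OF G o(2) y] by blast
  have "\<exists>t \<in> Hom M F G. Cmp M t c = h"
  proof (rule pw_surj_factor[OF c(1) surj h(1)])
    fix X u assume X: "X \<in> Obj E" and "u \<in> el (Y B) X" and cu: "app c X u = \<one>\<^bsub>Val F X\<^esub>"
    then have u: "u \<in> Hom E X B" by simp
    obtain v where v: "v \<in> Hom E X A" "u = Cmp E f v" using P(4)[OF u] cu c(2) X u by auto
    have "app h X u = Act G v (Act G f y)" using h(2) X u v(2) act_Cmp[OF G v(1) f y] by simp
    then show "app h X u = \<one>\<^bsub>Val G X\<^esub>" using fy act_one[OF G v(1)] by simp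
  qed
  then obtain t where t: "t \<in> Hom M F G" "Cmp M t c = h" by blast
  have I: "Idn E B \<in> el (Y B) B" using Idn_Hom[OF o(2)] by simp
  have "app t B b = y"
    using app_Cmp[OF c(1) o(2) I, of t] t(2) c(2) h(2) o(2) I act_Idn[OF P(1) o(2) P(2)] act_Idn[OF G o(2) y]
    by simp
  with t(1) show ?thesis by blast
qed

end

section \<open>Deflation-exact categories with admissible kernels\<close>

locale deflation_exact_kernels = deflation_exact E K
  for E :: "('o, 'a, 'm) addcat_scheme" and K +
  assumes admissible_kernels: "has_admissible_kernels E K"
begin

lemma conflation_pair: "(i, p) \<in> K \<Longrightarrow> is_kernel E i p \<and> is_cokernel E p i"
  using conflations by (auto simp: conflation_structure_def kernel_cokernel_pair_def)

lemma conflation_Hom: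
  assumes "(i, p) \<in> K"
  shows "i \<in> Hom E (Dom E i) (Cod E i)" "p \<in> Hom E (Cod E i) (Cod E p)"
  using conflation_pair[OF assms] by (auto simp: is_kernel_def Hom_def)

lemma conflationD:
  assumes ip: "(i, p) \<in> K" and i: "i \<in> Hom E A B" and p: "p \<in> Hom E B D"
  shows conflation_zero: "Cmp E p i = Zero E A D"
    and conflation_kernel: "h \<in> Hom E X B \<Longrightarrow> Cmp E p h = Zero E X D \<Longrightarrow> \<exists>u \<in> Hom E X A. Cmp E i u = h"
    and inflation_mono: "u \<in> Hom E X A \<Longrightarrow> v \<in> Hom E X A \<Longrightarrow> Cmp E i u = Cmp E i v \<Longrightarrow> u = v"
    and conflation_cokernel: "h' \<in> Hom E B X \<Longrightarrow> Cmp E h' i = Zero E A X \<Longrightarrow> \<exists>u \<in> Hom E D X. Cmp E u p = h'"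
    and deflation_epi': "u' \<in> Hom E D X \<Longrightarrow> v' \<in> Hom E D X \<Longrightarrow> Cmp E u' p = Cmp E v' p \<Longrightarrow> u' = v'"
proof -
  note k = conflation_pair[OF ip]
  note ker = kernelD[OF conjunct1[OF k] i p] and coker = cokernelD[OF conjunct2[OF k] p i]
  show "Cmp E p i = Zero E A D" using ker(1) zero_arr_iff_Zero[OF Cmp_Hom[OF i p]] by simp
  show "\<exists>u \<in> Hom E X A. Cmp E i u = h" if "h \<in> Hom E X B" "Cmp E p h = Zero E X D"
    using ker(2)[OF that(1)] zero_arr_iff_Zero[OF Cmp_Hom[OF that(1) p]] that(2) by simp
  show "\<exists>u \<in> Hom E D X. Cmp E u p = h'" if "h' \<in> Hom E B X" "Cmp E h' i = Zero E A X"
    using coker(2)[OF that(1)] zero_arr_iff_Zero[OF Cmp_Hom[OF i that(1)]] that(2) by simp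
  show "u \<in> Hom E X A \<Longrightarrow> v \<in> Hom E X A \<Longrightarrow> Cmp E i u = Cmp E i v \<Longrightarrow> u = v" by (rule ker(3))
  show "u' \<in> Hom E D X \<Longrightarrow> v' \<in> Hom E D X \<Longrightarrow> Cmp E u' p = Cmp E v' p \<Longrightarrow> u' = v'" by (rule coker(3))
qed

lemma deflation_conflation:
  assumes "deflation K p" "p \<in> Hom E B D"
  obtains i A where "(i, p) \<in> K" "i \<in> Hom E A B"
proof -
  obtain i where i: "(i, p) \<in> K" using assms(1) by (auto simp: deflation_def)
  have "Cod E i = B" using conflation_Hom[OF i] HomD[OF assms(2)] by (auto simp: Hom_def)
  then show ?thesis using that[OF i] conflation_Hom(1)[OF i] by simp
qed

lemma inflation_conflation:
  assumes "inflation K i" "i \<in> Hom E A B"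
  obtains p D where "(i, p) \<in> K" "p \<in> Hom E B D"
proof -
  obtain p where p: "(i, p) \<in> K" using assms(1) by (auto simp: inflation_def)
  then show ?thesis using that[OF p] conflation_Hom(2)[OF p] HomD[OF assms(2)] by simp
qed

lemma deflation_epi:
  assumes "deflation K p" "p \<in> Hom E B D" "u \<in> Hom E D X" "v \<in> Hom E D X" "Cmp E u p = Cmp E v p"
  shows "u = v"
proof -
  obtain i A where "(i, p) \<in> K" "i \<in> Hom E A B" by (rule deflation_conflation[OF assms(1,2)])
  then show ?thesis using deflation_epi'[OF _ _ assms(2)] assms(3-5) by blast
qed

lemma deflation_arr: "deflation K p \<Longrightarrow> p \<in> Arr E"
  using conflation_Hom(2) by (auto simp: deflation_def Hom_def)

lemma inflation_arr: "inflation K p \<Longrightarrow> p \<in> Arr E"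
  using conflation_Hom(1) by (auto simp: inflation_def Hom_def)

lemma deflation_pullback:
  assumes p: "deflation K p" "p \<in> Hom E A B" and f: "f \<in> Hom E X B"
  obtains X' p' f' where "p' \<in> Hom E X' X" "f' \<in> Hom E X' A" "deflation K p'" "Cmp E p f' = Cmp E f p'"
proof -
  have c: "f \<in> Arr E" "Cod E f = Cod E p" "Dom E f = X" "Dom E p = A" using HomD[OF p(2)] HomD[OF f] by auto
  obtain p' f' where pb: "is_pullback E p f p' f'" using R2_ex[OF p(1) c(1,2)] by blast
  have "p' \<in> Hom E (Dom E p') X" "f' \<in> Hom E (Dom E p') A" "Cmp E p f' = Cmp E f p'"
    using pb c unfolding is_pullback_def by (auto simp: Hom_def)
  then show ?thesis using that R2_deflation[OF p(1) pb] by blast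
qed

lemma deflation_Cmp:
  assumes "deflation K p" "deflation K q" "p \<in> Hom E A B" "q \<in> Hom E B D"
  shows "deflation K (Cmp E q p)"
  using R1[OF assms(1,2)] HomD[OF assms(3)] HomD[OF assms(4)] by simp

lemma inflation_if_kernel: "is_kernel E k f \<Longrightarrow> inflation K k"
  using admissible_kernels by (simp add: has_admissible_kernels_def)

text \<open>
  The identity of a zero object is a deflation by \<open>R0\<close>, and its pullback along \<open>A \<rightarrow> 0\<close> is the
  identity of \<open>A\<close>.
\<close>

lemma deflation_Idn:
  assumes A: "A \<in> Obj E"
  shows "deflation K (Idn E A)"
proof -
  obtain Z where Z: "is_zero E Z" using ex_zero by blast
  have ZO: "Z \<in> Obj E" by (rule is_zero_Obj[OF Z])
  have iZ: "Idn E Z \<in> Hom E Z Z" and iA: "Idn E A \<in> Hom E A A" using Idn_Hom ZO A by auto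
  have z: "Zero E A Z \<in> Hom E A Z" by (rule Zero_Hom[OF A ZO])
  have "deflation K (Idn E Z)" using R0[OF Z] HomD[OF iZ] by blast
  moreover have "is_pullback E (Idn E Z) (Zero E A Z) (Idn E A) (Zero E A Z)"
    unfolding is_pullback_def
  proof (intro conjI ballI impI)
    show "Cmp E (Idn E Z) (Zero E A Z) = Cmp E (Zero E A Z) (Idn E A)"
      using Idn_Cmp[OF z] Cmp_Idn[OF z] by simp
    fix a b assume ab: "a \<in> Arr E" "b \<in> Arr E" and h: "Dom E a = Dom E b \<and> Cod E a = Dom E (Zero E A Z) \<and>
      Cod E b = Dom E (Idn E Z) \<and> Cmp E (Idn E Z) b = Cmp E (Zero E A Z) a"
    then have a: "a \<in> Hom E (Dom E a) A" and b: "b \<in> Hom E (Dom E a) Z"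
      using HomD[OF z] HomD[OF iZ] by (auto simp: Hom_def)
    have "Cmp E (Zero E A Z) a = b" using Hom_to_zero[OF Z Cmp_Hom[OF a z]] Hom_to_zero[OF Z b] by simp
    moreover have "Dom E (Idn E A) = A" using HomD[OF iA] by simp
    ultimately show "\<exists>!u. u \<in> Hom E (Dom E a) (Dom E (Idn E A)) \<and> Cmp E (Idn E A) u = a \<and> Cmp E (Zero E A Z) u = b"
      using a Idn_Cmp[OF a] by (intro ex1I[of _ a]) (simp, metis Idn_Cmp)
  qed (use HomD[OF z] HomD[OF iZ] HomD[OF iA] in auto)
  ultimately show ?thesis by (rule R2_deflation)
qed

lemma inflation_Zero:
  assumes Z: "is_zero E Z" and X: "X \<in> Obj E"
  shows "inflation K (Zero E Z X)"
proof (rule inflation_if_kernel)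
  have ZO: "Z \<in> Obj E" by (rule is_zero_Obj[OF Z])
  have z: "Zero E Z X \<in> Hom E Z X" by (rule Zero_Hom[OF ZO X])
  show "is_kernel E (Zero E Z X) (Idn E X)"
  proof (rule kernelI[OF Idn_Hom[OF X] z])
    show "zero_arr E (Cmp E (Idn E X) (Zero E Z X))" using zero_arr_iff_Zero[OF z] Idn_Cmp[OF z] by simp
    fix T h assume h: "h \<in> Hom E T X" "zero_arr E (Cmp E (Idn E X) h)"
    have T: "T \<in> Obj E" using HomD[OF h(1)] by simp
    have "h = Zero E T X" using h zero_arr_iff_Zero[OF h(1)] Idn_Cmp[OF h(1)] by simp
    then show "\<exists>u \<in> Hom E T Z. Cmp E (Zero E Z X) u = h"
      using Zero_Hom[OF T ZO] Cmp_Zero_right[OF z T] by blast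
  next
    fix T u v assume "u \<in> Hom E T Z" "v \<in> Hom E T Z"
    then show "u = v" using Hom_to_zero[OF Z] by metis
  qed
qed

lemma inflation_Idn:
  assumes X: "X \<in> Obj E"
  shows "inflation K (Idn E X)"
proof -
  obtain Z where Z: "is_zero E Z" using ex_zero by blast
  have z: "Zero E X Z \<in> Hom E X Z" by (rule Zero_Hom[OF X is_zero_Obj[OF Z]])
  have "is_kernel E (Idn E X) (Zero E X Z)"
  proof (rule kernelI[OF z Idn_Hom[OF X]])
    show "zero_arr E (Cmp E (Zero E X Z) (Idn E X))" using zero_arr_iff_Zero[OF z] Cmp_Idn[OF z] by simp
  qed (use Idn_Cmp in auto)
  then show ?thesis by (rule inflation_if_kernel)
qed

lemma admissible_inflation:
  assumes i: "inflation K i"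
  shows "admissible E K i"
proof -
  have h: "i \<in> Hom E (Dom E i) (Cod E i)" by (rule Arr_Hom[OF inflation_arr[OF i]])
  then have o: "Dom E i \<in> Obj E" using HomD[OF h] by simp
  have "Cod E (Idn E (Dom E i)) = Dom E i" "i = Cmp E i (Idn E (Dom E i))"
    using HomD[OF Idn_Hom[OF o]] Cmp_Idn[OF h] by auto
  then show ?thesis unfolding admissible_def using deflation_Idn[OF o] i by blast
qed

lemma admissible_deflation:
  assumes p: "deflation K p"
  shows "admissible E K p"
proof -
  have h: "p \<in> Hom E (Dom E p) (Cod E p)" by (rule Arr_Hom[OF deflation_arr[OF p]])
  then have o: "Cod E p \<in> Obj E" using HomD[OF h] by simp
  have "Cod E p = Dom E (Idn E (Cod E p))" "p = Cmp E (Idn E (Cod E p)) p"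
    using HomD[OF Idn_Hom[OF o]] Idn_Cmp[OF h] by auto
  then show ?thesis unfolding admissible_def using inflation_Idn[OF o] p by blast
qed

lemma admissibleE:
  assumes "admissible E K f"
  obtains A I B C p i q where "p \<in> Hom E A I" "i \<in> Hom E I B" "q \<in> Hom E B C"
    "deflation K p" "(i, q) \<in> K" "f = Cmp E i p" "f \<in> Hom E A B"
proof -
  obtain p i where pi: "deflation K p" "inflation K i" "Cod E p = Dom E i" "f = Cmp E i p"
    using assms by (auto simp: admissible_def)
  have p: "p \<in> Hom E (Dom E p) (Dom E i)" using deflation_arr[OF pi(1)] pi(3) by (simp add: Hom_def)
  have i: "i \<in> Hom E (Dom E i) (Cod E i)" using inflation_arr[OF pi(2)] by (simp add: Hom_def)
  obtain q C where "(i, q) \<in> K" "q \<in> Hom E (Cod E i) C" by (rule inflation_conflation[OF pi(2) i])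
  then show ?thesis using that[OF p i] pi Cmp_Hom[OF p i] by blast
qed

lemma admissible_arr: "admissible E K f \<Longrightarrow> f \<in> Arr E"
  by (elim admissibleE) (simp add: Hom_def)

text \<open>
  A kernel \<open>i\<close> is an inflation and thus part of some conflation \<open>(i, p')\<close>. Any other cokernel of \<open>i\<close> is
  isomorphic to \<open>p'\<close>, and \<open>K\<close> is closed under isomorphisms.
\<close>

lemma conflation_iff:
  assumes i: "i \<in> Arr E" and p: "p \<in> Arr E"
  shows "(i, p) \<in> K \<longleftrightarrow> kernel_cokernel_pair E i p"
proof
  assume "(i, p) \<in> K" then show "kernel_cokernel_pair E i p"
    using conflation_pair by (simp add: kernel_cokernel_pair_def)
next
  assume kcp: "kernel_cokernel_pair E i p"
  then have k: "is_kernel E i p" "is_cokernel E p i" by (auto simp: kernel_cokernel_pair_def)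
  then obtain A B D where i: "i \<in> Hom E A B" and p: "p \<in> Hom E B D" by (auto simp: is_kernel_def Hom_def)
  obtain p' D' where p': "(i, p') \<in> K" "p' \<in> Hom E B D'"
    by (rule inflation_conflation[OF inflation_if_kernel[OF k(1)] i])
  note coker = cokernelD[OF k(2) p i]
  have "Cmp E p i = Zero E A D" using coker(1) zero_arr_iff_Zero[OF Cmp_Hom[OF i p]] by simp
  then obtain c where c: "c \<in> Hom E D' D" "Cmp E c p' = p" using conflation_cokernel[OF p'(1) i p'(2) p] by blast
  have "zero_arr E (Cmp E p' i)"
    using conflation_zero[OF p'(1) i p'(2)] zero_arr_iff_Zero[OF Cmp_Hom[OF i p'(2)]] by simp
  then obtain c' where c': "c' \<in> Hom E D D'" "Cmp E c' p = p'" using coker(2)[OF p'(2)] by blast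
  have o: "A \<in> Obj E" "B \<in> Obj E" "D \<in> Obj E" "D' \<in> Obj E" using HomD[OF i] HomD[OF c(1)] by auto
  have "Cmp E c c' = Idn E D"
    by (rule coker(3)[OF Cmp_Hom[OF c'(1) c(1)] Idn_Hom[OF o(3)]])
      (simp add: Cmp_assoc[OF p c'(1) c(1), symmetric] c c' Idn_Cmp[OF p])
  moreover have "Cmp E c' c = Idn E D'"
    by (rule deflation_epi'[OF p'(1) i p'(2) Cmp_Hom[OF c(1) c'(1)] Idn_Hom[OF o(4)]])
      (simp add: Cmp_assoc[OF p'(2) c(1) c'(1), symmetric] c c' Idn_Cmp[OF p'(2)])
  ultimately have "is_iso E c" using isoI[OF c(1) c'(1)] by simp
  then show "(i, p) \<in> K"
    using conflation_structure_iso[OF conflations p'(1) i p'(2) i p iso_Idn[OF o(1)] Idn_Hom[OF o(1)]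
        iso_Idn[OF o(2)] Idn_Hom[OF o(2)] _ c(1)] c(2) Idn_Cmp[OF i] Cmp_Idn[OF i] Cmp_Idn[OF p] by simp
qed

text \<open>
  Since \<open>u\<close> is mono, \<open>m\<close> kills the kernel \<open>l\<close> of the deflation \<open>d = u \<circ> m\<close>. A deflation is
  the cokernel of its kernel, so \<open>m = e \<circ> d\<close>, and \<open>e\<close> is inverse to \<open>u\<close>.
\<close>

lemma iso_if_deflation_factors:
  assumes u: "u \<in> Hom E A B" and mono: "\<And>X s. s \<in> Hom E X A \<Longrightarrow> Cmp E u s = Zero E X B \<Longrightarrow> s = Zero E X A"
    and d: "deflation K d" "d \<in> Hom E X B" and m: "m \<in> Hom E X A" "d = Cmp E u m"
  shows "is_iso E u"
proof -
  obtain l T where l: "(l, d) \<in> K" "l \<in> Hom E T X" by (rule deflation_conflation[OF d])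
  have o: "A \<in> Obj E" "B \<in> Obj E" using HomD[OF u] by auto
  have "Cmp E u (Cmp E m l) = Zero E T B"
    using conflation_zero[OF l d(2)] m(2) Cmp_assoc[OF l(2) m(1) u] by simp
  then have "Cmp E m l = Zero E T A" using mono[OF Cmp_Hom[OF l(2) m(1)]] by simp
  then obtain e where e: "e \<in> Hom E B A" "Cmp E e d = m" using conflation_cokernel[OF l d(2) m(1)] by blast
  have ue: "Cmp E u e = Idn E B"
    by (rule deflation_epi[OF d Cmp_Hom[OF e(1) u] Idn_Hom[OF o(2)]])
      (simp add: Cmp_assoc[OF d(2) e(1) u, symmetric] e(2) m(2)[symmetric] Idn_Cmp[OF d(2)])
  have "Cmp E e u = Idn E A"
    by (rule mono_if_kernel_zero[OF u mono Cmp_Hom[OF u e(1)] Idn_Hom[OF o(1)]])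
      (simp_all add: Cmp_assoc[OF u e(1) u] ue Idn_Cmp[OF u] Cmp_Idn[OF u])
  with ue show ?thesis using isoI[OF u e(1)] by simp
qed

section \<open>Admissibly presented presheaves\<close>

abbreviation "fp \<equiv> yoneda_cokernels E (Arr E)"
abbreviation "adm \<equiv> yoneda_cokernels E {f. admissible E K f}"

lemma fp_iff: "F \<in> fp \<longleftrightarrow> (\<exists>f b. presents f b F)"
  using yoneda_cokernels_iff[OF subset_refl] by (auto simp: presents_def)

lemma adm_iff: "F \<in> adm \<longleftrightarrow> (\<exists>f b. admissible E K f \<and> presents f b F)"
proof -
  have "{f. admissible E K f} \<subseteq> Arr E" using admissible_arr by blast
  from yoneda_cokernels_iff[OF this] show ?thesis by blast
qed

lemma adm_fp: "F \<in> adm \<Longrightarrow> F \<in> fp"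
  using fp_iff adm_iff by blast

lemma adm_presheaf: "F \<in> adm \<Longrightarrow> additive_presheaf E F"
  unfolding adm_iff presents_def by blast

lemma mod_fp_eq: "mod_fp E = full_subcat M fp"
  by (simp add: mod_fp_def)

lemma mod_adm_eq: "mod_adm E K = full_subcat M adm"
proof -
  have "fp \<inter> adm = adm" using adm_fp by blast
  then show ?thesis by (simp add: mod_adm_def mod_fp_eq full_subcat_full_subcat)
qed

lemma Obj_mod_adm: "F \<in> Obj (mod_adm E K) \<longleftrightarrow> F \<in> adm"
  using adm_presheaf by (auto simp: mod_adm_eq Obj_Mod)

lemma Hom_mod_adm: "t \<in> Hom (mod_adm E K) F G \<longleftrightarrow> t \<in> Hom M F G \<and> F \<in> adm \<and> G \<in> adm"
  by (auto simp: mod_adm_eq Hom_full_subcat)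

lemma Cmp_mod_adm [simp]: "Cmp (mod_adm E K) = Cmp M"
  by (simp add: mod_adm_eq)

lemma Idn_mod_adm [simp]: "Idn (mod_adm E K) = Idn M"
  by (simp add: mod_adm_eq)

lemma category_mod_adm: "category (mod_adm E K)"
  unfolding mod_adm_eq by (rule category_full_subcat[OF category_Mod])

lemma eff_iff: "F \<in> eff E K \<longleftrightarrow> (\<exists>f b. deflation K f \<and> presents f b F)"
proof -
  have "{f. deflation K f} \<subseteq> Arr E" using deflation_arr by blast
  from yoneda_cokernels_iff[OF this] show ?thesis
    unfolding eff_def using Obj_mod_adm adm_iff admissible_deflation by blast
qed

text \<open>
  \<open>\<bbbY>(X)\<close> is the cokernel of \<open>\<bbbY>(0 \<rightarrow> X)\<close>, and \<open>0 \<rightarrow> X\<close> is an inflation.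
\<close>

lemma yoneda_adm:
  assumes X: "X \<in> Obj E"
  shows "Y X \<in> adm"
proof -
  obtain Z where Z: "is_zero E Z" using ex_zero by blast
  have ZO: "Z \<in> Obj E" by (rule is_zero_Obj[OF Z])
  have z: "Zero E Z X \<in> Hom E Z X" by (rule Zero_Hom[OF ZO X])
  have "presents (Zero E Z X) (Idn E X) (Y X)"
    unfolding presents_def
  proof (intro conjI ballI)
    show "Zero E Z X \<in> Arr E" "Idn E X \<in> el (Y X) (Cod E (Zero E Z X))"
      using HomD[OF z] Idn_Hom[OF X] by auto
    show "additive_presheaf E (Y X)" by (rule additive_presheaf_yoneda[OF X])
    fix A assume A: "A \<in> Obj E"
    show "\<exists>u \<in> Hom E A (Cod E (Zero E Z X)). x = Act (Y X) u (Idn E X)" if "x \<in> el (Y X) A" for x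
      using that HomD[OF z] Idn_Cmp[of x A X] by (intro bexI[of _ x]) auto
    fix u assume "u \<in> Hom E A (Cod E (Zero E Z X))"
    then have u: "u \<in> Hom E A X" using HomD[OF z] by simp
    have "(\<exists>v \<in> Hom E A Z. u = Cmp E (Zero E Z X) v) \<longleftrightarrow> u = Zero E A X"
      using Zero_Hom[OF A ZO] Cmp_Zero_left[OF _ X] by metis
    then show "Act (Y X) u (Idn E X) = \<one>\<^bsub>Val (Y X) A\<^esub> \<longleftrightarrow>
        (\<exists>v \<in> Hom E A (Dom E (Zero E Z X)). u = Cmp E (Zero E Z X) v)"
      using HomD[OF z] Idn_Cmp[OF u] by simp
  qed
  then show ?thesis using admissible_inflation[OF inflation_Zero[OF Z X]] adm_iff by blast
qed

lemma yoneda_fp: "Y ` Obj E \<subseteq> fp"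
  using yoneda_adm adm_fp by blast

lemma adm_conflationI:
  assumes o: "F \<in> adm" "G \<in> adm" "H \<in> adm" and i: "i \<in> Hom M F G" and p: "p \<in> Hom M G H"
    and ex: "pw_inj i" "pw_exact i p" "pw_surj p"
  shows "(i, p) \<in> adm_conflations E K"
proof -
  have ip: "i \<in> Hom (full_subcat M fp) F G" "p \<in> Hom (full_subcat M fp) G H"
    using i p o adm_fp by (simp_all add: Hom_full_subcat)
  show ?thesis
    unfolding adm_conflations_def mod_fp_eq kernel_cokernel_pair_def
    using kernel_if_pw_exact[OF yoneda_fp ip ex(1,2)] cokernel_if_pw_exact[OF yoneda_fp ip ex(2,3)]
      M.HomD[OF i] M.HomD[OF p] o Obj_mod_adm by simp
qed

lemma adm_conflation_Hom:
  assumes "(i, p) \<in> adm_conflations E K"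
  obtains F G H where "F \<in> adm" "G \<in> adm" "H \<in> adm" "i \<in> Hom M F G" "p \<in> Hom M G H"
proof -
  have "is_kernel (full_subcat M fp) i p" "Dom M i \<in> adm" "Cod M i \<in> adm" "Cod M p \<in> adm"
    using assms Obj_mod_adm unfolding adm_conflations_def mod_fp_eq kernel_cokernel_pair_def by auto
  moreover from this(1) have "i \<in> Hom M (Dom M i) (Cod M i)" "p \<in> Hom M (Cod M i) (Cod M p)"
    by (auto simp: is_kernel_def Hom_def full_subcat_def)
  ultimately show ?thesis using that by blast
qed

text \<open>
  A conflation is exact on the left pointwise. On the right only the universal property of
  \<open>p\<close> is recorded, which suffices for maps into representables.
\<close>

lemma adm_conflationD:
  assumes ip: "(i, p) \<in> adm_conflations E K" and i: "i \<in> Hom M F G" and p: "p \<in> Hom M G H"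
  shows "pw_inj i" and "pw_exact i p"
    and "T \<in> adm \<Longrightarrow> h \<in> Hom M G T \<Longrightarrow>
      (\<And>A x. A \<in> Obj E \<Longrightarrow> x \<in> el F A \<Longrightarrow> app h A (app i A x) = \<one>\<^bsub>Val T A\<^esub>) \<Longrightarrow> \<exists>u \<in> Hom M H T. Cmp M u p = h"
    and "T \<in> adm \<Longrightarrow> u \<in> Hom M H T \<Longrightarrow> v \<in> Hom M H T \<Longrightarrow> Cmp M u p = Cmp M v p \<Longrightarrow> u = v"
proof -
  interpret S: category "full_subcat M fp" by (rule category_full_subcat[OF category_Mod])
  have kcp: "is_kernel (full_subcat M fp) i p" "is_cokernel (full_subcat M fp) p i"
    and o: "F \<in> fp" "G \<in> fp" "H \<in> fp"
    using ip Obj_mod_adm adm_fp M.HomD[OF i] M.HomD[OF p]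
    unfolding adm_conflations_def mod_fp_eq kernel_cokernel_pair_def by auto
  have i': "i \<in> Hom (full_subcat M fp) F G" and p': "p \<in> Hom (full_subcat M fp) G H"
    using i p o by (simp_all add: Hom_full_subcat)
  from pw_if_kernel[OF yoneda_fp i' p' kcp(1)] show "pw_inj i" "pw_exact i p" by auto
  note coker = S.cokernelD[OF kcp(2) p' i']
  show "\<exists>u \<in> Hom M H T. Cmp M u p = h" if T: "T \<in> adm" and h: "h \<in> Hom M G T"
    and z: "\<And>A x. A \<in> Obj E \<Longrightarrow> x \<in> el F A \<Longrightarrow> app h A (app i A x) = \<one>\<^bsub>Val T A\<^esub>"
  proof -
    have h': "h \<in> Hom (full_subcat M fp) G T" using h o adm_fp[OF T] by (simp add: Hom_full_subcat)
    have "zero_arr (full_subcat M fp) (Cmp (full_subcat M fp) h i)"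
      unfolding zero_arr_iff_app[OF yoneda_fp S.Cmp_Hom[OF i' h']] using app_Cmp[OF i, of _ _ h] z by simp
    then show ?thesis using coker(2)[OF h'] o adm_fp[OF T] by (simp add: Hom_full_subcat)
  qed
  show "u = v" if "T \<in> adm" "u \<in> Hom M H T" "v \<in> Hom M H T" "Cmp M u p = Cmp M v p"
    using coker(3)[of u T v] o adm_fp[OF that(1)] that(2-4) by (simp add: Hom_full_subcat)
qed

section \<open>The reflection of an admissibly presented presheaf\<close>

lemma Dom_Cod_mod_adm [simp]: "Dom (mod_adm E K) = Dom M" "Cod (mod_adm E K) = Cod M"
  by (simp_all add: mod_adm_eq)

text \<open>
  \<open>\<eta>\<close> is a weak isomorphism, universal among the maps from \<open>F\<close> to representables, and locally
  bijective when deflations are regarded as coverings: elements killed by \<open>\<eta>\<close> are killed by pulling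
  back along some deflation \<open>d\<close>, and elements of \<open>\<bbbY>(C)\<close> lift after pulling back along some \<open>d\<close>.
\<close>

definition reflection :: "('o, 'a, 'a) presheaf \<Rightarrow> 'o \<Rightarrow> ('o, 'a, 'a) presheaf_arr \<Rightarrow> bool" where
  "reflection F C \<eta> \<longleftrightarrow> C \<in> Obj E \<and> \<eta> \<in> Hom M F (Y C) \<and> \<eta> \<in> weak_isos E K \<and>
    (\<forall>X \<in> Obj E. \<forall>h \<in> Hom M F (Y X). \<exists>e \<in> Hom E C X. Cmp M (Ya e) \<eta> = h) \<and>
    (\<forall>X. \<forall>e \<in> Hom E C X. \<forall>e' \<in> Hom E C X. Cmp M (Ya e) \<eta> = Cmp M (Ya e') \<eta> \<longrightarrow> e = e') \<and>
    (\<forall>X \<in> Obj E. \<forall>x \<in> el F X. app \<eta> X x = Zero E X C \<longrightarrow>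
      (\<exists>X' d. d \<in> Hom E X' X \<and> deflation K d \<and> Act F d x = \<one>\<^bsub>Val F X'\<^esub>)) \<and>
    (\<forall>X. \<forall>w \<in> Hom E X C.
      \<exists>X' d. d \<in> Hom E X' X \<and> deflation K d \<and> (\<exists>x \<in> el F X'. app \<eta> X' x = Cmp E w d))"

text \<open>
  Every element is \<open>n \<cdot> u\<close> for the generator \<open>n\<close>, which the deflation \<open>p\<close> kills; the pullback \<open>d\<close> of
  \<open>p\<close> along \<open>u\<close> kills \<open>n \<cdot> u\<close>.
\<close>

lemma eff_locally_zero:
  assumes N: "N \<in> eff E K" and X: "X \<in> Obj E" and x: "x \<in> el N X"
  shows "\<exists>X' d. d \<in> Hom E X' X \<and> deflation K d \<and> Act N d x = \<one>\<^bsub>Val N X'\<^esub>"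
proof -
  obtain p n where p: "deflation K p" "presents p n N" using N eff_iff by blast
  obtain A B where pA: "p \<in> Hom E A B" using presents_arr[OF p(2)] by blast
  note P = presentsD[OF p(2) pA]
  obtain u where u: "u \<in> Hom E X B" "x = Act N u n" using P(3)[OF X x] by blast
  obtain X' d v where d: "d \<in> Hom E X' X" "v \<in> Hom E X' A" "deflation K d" "Cmp E p v = Cmp E u d"
    by (rule deflation_pullback[OF p(1) pA u(1)])
  have "Act N d x = Act N (Cmp E u d) n" using act_Cmp[OF P(1) d(1) u(1) P(2)] u(2) by simp
  also have "\<dots> = \<one>\<^bsub>Val N X'\<^esub>" using P(4)[OF Cmp_Hom[OF d(1) u(1)]] d(2,4) by metis
  finally show ?thesis using d(1,3) by blast
qed

text \<open>
  The image of \<open>\<bbbY>(q)\<close> is \<open>\<bbbY>(B)\<close> modulo \<open>\<bbbY>(I)\<close>, because \<open>i\<close> is the kernel of \<open>q\<close>. Thus \<open>coker \<bbbY>(i)\<close> embeds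
  into \<open>\<bbbY>(C)\<close> with cokernel \<open>N = coker \<bbbY>(q)\<close>, and \<open>N\<close> is in \<open>eff\<close>.
\<close>

lemma weak_iso_coker_inflation:
  assumes iq: "(i, q) \<in> K" and i: "i \<in> Hom E I B" and q: "q \<in> Hom E B C" and b: "presents i b G"
  shows "\<exists>m \<in> Hom M G (Y C). app m B b = q \<and> m \<in> weak_isos E K"
proof -
  note P = presentsD[OF b i]
  have o: "I \<in> Obj E" "B \<in> Obj E" "C \<in> Obj E" using HomD[OF i] HomD[OF q] by auto
  have "Act (Y C) i q = \<one>\<^bsub>Val (Y C) I\<^esub>" using conflation_zero[OF iq i q] by simp
  then obtain m where m: "m \<in> Hom M G (Y C)" "app m B b = q"
    using presents_hom[OF b i additive_presheaf_yoneda[OF o(3)], of q] q by auto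
  have m_app: "app m X (Act G u b) = Cmp E q u" if "u \<in> Hom E X B" for u X
    using presents_app[OF b i m(1) that] m(2) by simp
  obtain N z where z: "presents q z N" using presents_exists[OF q] by blast
  note Pz = presentsD[OF z q]
  obtain s where s: "s \<in> Hom M (Y C) N" "\<forall>X \<in> Obj E. \<forall>w \<in> Hom E X C. app s X w = Act N w z"
    using yoneda_elem[OF Pz(1) o(3) Pz(2)] by blast
  have defl: "deflation K q" and infl: "inflation K i" using iq by (auto simp: deflation_def inflation_def)
  have adm: "G \<in> adm" "N \<in> adm" "N \<in> eff E K"
    using adm_iff eff_iff admissible_inflation[OF infl] admissible_deflation[OF defl] defl b z by blast+
  have "pw_inj m"
    unfolding pw_inj_iff[OF m(1)]
  proof (intro ballI impI)
    fix A x assume A: "A \<in> Obj E" and x: "x \<in> el G A"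
      and mx: "app m A x = \<one>\<^bsub>Val (Y C) A\<^esub>"
    obtain u where u: "u \<in> Hom E A B" "x = Act G u b" using P(3)[OF A x] by blast
    have "Cmp E q u = Zero E A C" using mx m_app[OF u(1)] u(2) by simp
    then obtain w where "w \<in> Hom E A I" "Cmp E i w = u" using conflation_kernel[OF iq i q u(1)] by blast
    then show "x = \<one>\<^bsub>Val G A\<^esub>" using P(4)[OF u(1)] u(2) by metis
  qed
  moreover have "pw_exact m s"
    unfolding pw_exact_iff[OF s(1) m(1)]
  proof (intro ballI)
    fix A w assume A: "A \<in> Obj E" and "w \<in> el (Y C) A"
    then have w: "w \<in> Hom E A C" by simp
    have "app s A w = \<one>\<^bsub>Val N A\<^esub> \<longleftrightarrow> (\<exists>v \<in> Hom E A B. w = Cmp E q v)"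
      using Pz(4)[OF w] s(2) A w by simp
    also have "\<dots> \<longleftrightarrow> (\<exists>y \<in> el G A. app m A y = w)"
      using m_app P(3)[OF A] act_el[OF P(1) _ P(2)] by metis
    finally show "app s A w = \<one>\<^bsub>Val N A\<^esub> \<longleftrightarrow> (\<exists>y \<in> el G A. app m A y = w)" .
  qed
  moreover have "pw_surj s"
    unfolding pw_surj_iff[OF s(1)] using Pz(3) s(2) by fastforce
  ultimately have "(m, s) \<in> adm_conflations E K"
    using adm_conflationI[OF adm(1) yoneda_adm[OF o(3)] adm(2) m(1) s(1)] by blast
  then have "m \<in> weak_isos E K"
    by (rule weak_isos.infl) (use M.HomD[OF s(1)] adm(3) in simp)
  with m show ?thesis by blast
qed

text \<open>
  \<open>\<eta>\<close> is the composite of \<open>e : F \<rightarrow> coker \<bbbY>(i) = G\<close> and the map \<open>m : G \<rightarrow> \<bbbY>(C)\<close> of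
  \<open>weak_iso_coker_inflation\<close>. The kernel of \<open>e\<close> is \<open>N = coker \<bbbY>(p)\<close>: both consist of
  the elements \<open>b \<cdot> (i \<circ> w)\<close>, which vanish iff \<open>w\<close> factors through \<open>p\<close>. On elements \<open>\<eta>\<close> sends \<open>b \<cdot> u\<close> to
  \<open>q \<circ> u\<close>.
\<close>

lemma reflection_exists:
  assumes F: "F \<in> adm"
  shows "\<exists>C \<eta>. reflection F C \<eta>"
proof -
  obtain f b where fb: "admissible E K f" "presents f b F" using F adm_iff by blast
  obtain A I B C p i q where p: "p \<in> Hom E A I" and i: "i \<in> Hom E I B" and q: "q \<in> Hom E B C"
    and dp: "deflation K p" and iq: "(i, q) \<in> K" and fip: "f = Cmp E i p" and f: "f \<in> Hom E A B"
    by (rule admissibleE[OF fb(1)])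
  have o: "A \<in> Obj E" "I \<in> Obj E" "B \<in> Obj E" "C \<in> Obj E" using HomD[OF p] HomD[OF i] HomD[OF q] by auto
  obtain G b' where b': "presents i b' G" using presents_exists[OF i] by blast
  obtain N n where n: "presents p n N" using presents_exists[OF p] by blast
  note P = presentsD[OF fb(2) f] and Pi = presentsD[OF b' i] and Pp = presentsD[OF n p]
  have infl: "inflation K i" and dq: "deflation K q" using iq by (auto simp: inflation_def deflation_def)
  have adm: "G \<in> adm" "N \<in> adm" "N \<in> eff E K"
    using adm_iff eff_iff admissible_inflation[OF infl] admissible_deflation[OF dp] dp b' n by blast+
  have fb1: "Act F f b = \<one>\<^bsub>Val F A\<^esub>" using P(4)[OF f] Idn_Hom[OF o(1)] Cmp_Idn[OF f] by metis
  have ib1: "Act G i b' = \<one>\<^bsub>Val G I\<^esub>" using Pi(4)[OF i] Idn_Hom[OF o(2)] Cmp_Idn[OF i] by metis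
  have Fi: "Act F i b \<in> el F I" by (rule act_el[OF P(1) i P(2)])
  have "Act F p (Act F i b) = \<one>\<^bsub>Val F A\<^esub>" using act_Cmp[OF P(1) p i P(2)] fip fb1 by simp
  then obtain k where k: "k \<in> Hom M N F" "app k I n = Act F i b"
    using presents_hom[OF n p P(1) Fi] by blast
  have "Act G f b' = \<one>\<^bsub>Val G A\<^esub>" using act_Cmp[OF Pi(1) p i Pi(2)] fip ib1 act_one[OF Pi(1) p] by simp
  then obtain e where e: "e \<in> Hom M F G" "app e B b = b'" using presents_hom[OF fb(2) f Pi(1) Pi(2)] by blast
  have k_app: "app k X (Act N w n) = Act F (Cmp E i w) b" if "w \<in> Hom E X I" for w X
    using presents_app[OF n p k(1) that] k(2) act_Cmp[OF P(1) that i P(2)] by simp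
  have e_app: "app e X (Act F u b) = Act G u b'" if "u \<in> Hom E X B" for u X
    using presents_app[OF fb(2) f e(1) that] e(2) by simp
  have "pw_inj k"
    unfolding pw_inj_iff[OF k(1)]
  proof (intro ballI impI)
    fix X x assume X: "X \<in> Obj E" and x: "x \<in> el N X" and kx: "app k X x = \<one>\<^bsub>Val F X\<^esub>"
    obtain u where u: "u \<in> Hom E X I" "x = Act N u n" using Pp(3)[OF X x] by blast
    have "Act F (Cmp E i u) b = \<one>\<^bsub>Val F X\<^esub>" using kx k_app[OF u(1)] u(2) by simp
    then obtain v where v: "v \<in> Hom E X A" "Cmp E i u = Cmp E f v" using P(4)[OF Cmp_Hom[OF u(1) i]] by blast
    have "Cmp E i u = Cmp E i (Cmp E p v)" using v(2) fip Cmp_assoc[OF v(1) p i] by simp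
    then have "u = Cmp E p v" using inflation_mono[OF iq i q u(1) Cmp_Hom[OF v(1) p]] by simp
    then show "x = \<one>\<^bsub>Val N X\<^esub>" using Pp(4)[OF u(1)] v(1) u(2) by auto
  qed
  moreover have "pw_exact k e"
    unfolding pw_exact_iff[OF e(1) k(1)]
  proof (intro ballI)
    fix X x assume X: "X \<in> Obj E" and x: "x \<in> el F X"
    obtain u where u: "u \<in> Hom E X B" "x = Act F u b" using P(3)[OF X x] by blast
    have ki: "app e X (app k X y) = \<one>\<^bsub>Val G X\<^esub>" if y: "y \<in> el N X" for y
    proof -
      obtain w where w: "w \<in> Hom E X I" "y = Act N w n" using Pp(3)[OF X y] by blast
      note iw = Cmp_Hom[OF w(1) i]
      have "app e X (app k X y) = Act G (Cmp E i w) b'" using k_app[OF w(1)] w(2) e_app[OF iw] by simp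
      then show ?thesis using Pi(4)[OF iw] w(1) by auto
    qed
    show "app e X x = \<one>\<^bsub>Val G X\<^esub> \<longleftrightarrow> (\<exists>y \<in> el N X. app k X y = x)"
    proof
      assume "app e X x = \<one>\<^bsub>Val G X\<^esub>"
      then have "Act G u b' = \<one>\<^bsub>Val G X\<^esub>" using e_app[OF u(1)] u(2) by simp
      then obtain w where w: "w \<in> Hom E X I" "u = Cmp E i w" using Pi(4)[OF u(1)] by blast
      then have "app k X (Act N w n) = x" using k_app[OF w(1)] u(2) by simp
      then show "\<exists>y \<in> el N X. app k X y = x" using act_el[OF Pp(1) w(1) Pp(2)] by blast
    qed (use ki in auto)
  qed
  moreover have "pw_surj e"
    unfolding pw_surj_iff[OF e(1)]
  proof (intro ballI)
    fix X y assume X: "X \<in> Obj E" and y: "y \<in> el G X"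
    obtain u where u: "u \<in> Hom E X B" "y = Act G u b'" using Pi(3)[OF X y] by blast
    then show "\<exists>x \<in> el F X. app e X x = y" using e_app[OF u(1)] act_el[OF P(1) u(1) P(2)] by auto
  qed
  ultimately have "(k, e) \<in> adm_conflations E K"
    using adm_conflationI[OF adm(2) F adm(1) k(1) e(1)] by blast
  then have we: "e \<in> weak_isos E K"
    by (rule weak_isos.defl) (use M.HomD[OF k(1)] adm(3) in simp)
  obtain m where m: "m \<in> Hom M G (Y C)" "app m B b' = q" "m \<in> weak_isos E K"
    using weak_iso_coker_inflation[OF iq i q b'] by blast
  let ?\<eta> = "Cmp M m e"
  have \<eta>: "?\<eta> \<in> Hom M F (Y C)" by (rule Cmp_Mod_Hom[OF e(1) m(1)])
  have "?\<eta> \<in> weak_isos E K"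
    using weak_isos.comp[OF we m(3)] M.HomD[OF e(1)] M.HomD[OF m(1)] by simp
  moreover have \<eta>b: "app ?\<eta> B b = q" using app_Cmp[OF e(1) o(3) P(2), of m] e(2) m(2) by simp
  have \<eta>_app: "app ?\<eta> X (Act F u b) = Cmp E q u" if "u \<in> Hom E X B" for u X
    using presents_app[OF fb(2) f \<eta> that] \<eta>b by simp
  \<comment> \<open>If \<open>q \<circ> u = 0\<close> then \<open>u = i \<circ> w\<close>; lifting \<open>w\<close> locally along \<open>p\<close> makes \<open>u\<close> factor through \<open>f\<close>.\<close>
  have locally_inj: "\<exists>X' d. d \<in> Hom E X' X \<and> deflation K d \<and> Act F d x = \<one>\<^bsub>Val F X'\<^esub>"
    if X: "X \<in> Obj E" and x: "x \<in> el F X" and \<eta>x: "app ?\<eta> X x = Zero E X C" for X x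
  proof -
    obtain u where u: "u \<in> Hom E X B" "x = Act F u b" using P(3)[OF X x] by blast
    have "Cmp E q u = Zero E X C" using \<eta>x \<eta>_app[OF u(1)] u(2) by simp
    then obtain w where w: "w \<in> Hom E X I" "Cmp E i w = u" using conflation_kernel[OF iq i q u(1)] by blast
    obtain X' d v where d: "d \<in> Hom E X' X" "v \<in> Hom E X' A" "deflation K d" "Cmp E p v = Cmp E w d"
      by (rule deflation_pullback[OF dp p w(1)])
    have "Cmp E u d = Cmp E f v"
      using w(2) Cmp_assoc[OF d(1) w(1) i] Cmp_assoc[OF d(2) p i] d(4) fip by simp
    then have "Act F (Cmp E u d) b = \<one>\<^bsub>Val F X'\<^esub>" using P(4)[OF Cmp_Hom[OF d(1) u(1)]] d(2) by blast
    then have "Act F d x = \<one>\<^bsub>Val F X'\<^esub>" using act_Cmp[OF P(1) d(1) u(1) P(2)] u(2) by simp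
    then show ?thesis using d(1,3) by blast
  qed
  \<comment> \<open>An arrow to \<open>C\<close> lifts locally along the deflation \<open>q\<close>.\<close>
  have locally_surj: "\<exists>X' d. d \<in> Hom E X' X \<and> deflation K d \<and> (\<exists>x \<in> el F X'. app ?\<eta> X' x = Cmp E w d)"
    if w: "w \<in> Hom E X C" for X w
  proof -
    obtain X' d w' where d: "d \<in> Hom E X' X" "w' \<in> Hom E X' B" "deflation K d" "Cmp E q w' = Cmp E w d"
      by (rule deflation_pullback[OF dq q w])
    then show ?thesis using \<eta>_app[OF d(2)] act_el[OF P(1) d(2) P(2)] by metis
  qed
  moreover have "\<exists>g \<in> Hom E C X. Cmp M (Ya g) ?\<eta> = h" if X: "X \<in> Obj E" and h: "h \<in> Hom M F (Y X)" for X h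
  proof -
    let ?g = "app h B b"
    have g: "?g \<in> Hom E B X" using app_el[OF h o(3) P(2)] by simp
    have "Cmp E (Cmp E ?g i) p = Cmp E (Zero E I X) p"
      using app_act[OF h f P(2)] fb1 app_one[OF h o(1)] Cmp_assoc[OF p i g] fip Cmp_Zero_left[OF p X] by simp
    then have "Cmp E ?g i = Zero E I X" by (rule deflation_epi[OF dp p Cmp_Hom[OF i g] Zero_Hom[OF o(2) X]])
    then obtain g' where g': "g' \<in> Hom E C X" "Cmp E g' q = ?g" using conflation_cokernel[OF iq i q g] by blast
    have "Cmp M (Ya g') ?\<eta> = h"
      by (rule presents_eqI[OF fb(2) f Cmp_Mod_Hom[OF \<eta> yoneda_arr_Hom[OF g'(1)]] h])
        (simp add: app_Cmp[OF \<eta> o(3) P(2)] \<eta>b app_yoneda_arr[OF g'(1) q] g'(2))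
    with g'(1) show ?thesis by blast
  qed
  moreover have "g = g'" if g: "g \<in> Hom E C X" "g' \<in> Hom E C X" "Cmp M (Ya g) ?\<eta> = Cmp M (Ya g') ?\<eta>" for X g g'
  proof (rule deflation_epi[OF dq q g(1,2)])
    have "app (Cmp M (Ya g) ?\<eta>) B b = app (Cmp M (Ya g') ?\<eta>) B b" using g(3) by simp
    then show "Cmp E g q = Cmp E g' q"
      unfolding app_Cmp[OF \<eta> o(3) P(2)] \<eta>b app_yoneda_arr[OF g(1) q] app_yoneda_arr[OF g(2) q] .
  qed
  ultimately have "reflection F C ?\<eta>"
    unfolding reflection_def using o(4) \<eta> locally_inj locally_surj by blast
  then show ?thesis by blast
qed

lemma reflectionD:
  assumes "reflection F C \<eta>"
  shows "C \<in> Obj E" "\<eta> \<in> Hom M F (Y C)" "\<eta> \<in> weak_isos E K"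
    and reflection_factor: "X \<in> Obj E \<Longrightarrow> h \<in> Hom M F (Y X) \<Longrightarrow> \<exists>e \<in> Hom E C X. Cmp M (Ya e) \<eta> = h"
    and reflection_unique: "e \<in> Hom E C X \<Longrightarrow> e' \<in> Hom E C X \<Longrightarrow> Cmp M (Ya e) \<eta> = Cmp M (Ya e') \<eta> \<Longrightarrow> e = e'"
  using assms unfolding reflection_def by blast+

lemma reflection_loc_inj:
  assumes "reflection F C \<eta>" "X \<in> Obj E" "x \<in> el F X" "app \<eta> X x = Zero E X C"
  obtains X' d where "d \<in> Hom E X' X" "deflation K d" "Act F d x = \<one>\<^bsub>Val F X'\<^esub>"
  using assms unfolding reflection_def by blast

lemma reflection_loc_surj:
  assumes "reflection F C \<eta>" "w \<in> Hom E X C"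
  obtains X' d x where "d \<in> Hom E X' X" "deflation K d" "x \<in> el F X'" "app \<eta> X' x = Cmp E w d"
  using assms unfolding reflection_def by blast

lemma yoneda_arr_Cmp: "f \<in> Hom E A B \<Longrightarrow> g \<in> Hom E B D \<Longrightarrow> Ya (Cmp E g f) = Cmp M (Ya g) (Ya f)"
  using cat_functor.Fa_Cmp[OF cat_functor.intro[OF is_functor_yoneda]] .

text \<open>
  \<open>u\<close> is the arrow of \<open>E\<close> that \<open>s : F \<rightarrow> G\<close> induces between the representing objects.
\<close>

definition refl_square where
  "refl_square F C \<eta> G D \<theta> s u \<longleftrightarrow> reflection F C \<eta> \<and> reflection G D \<theta> \<and> s \<in> Hom M F G \<and>
    u \<in> Hom E C D \<and> Cmp M (Ya u) \<eta> = Cmp M \<theta> s"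

lemma refl_square_exists:
  assumes \<eta>: "reflection F C \<eta>" and \<theta>: "reflection G D \<theta>" and s: "s \<in> Hom M F G"
  shows "\<exists>u. refl_square F C \<eta> G D \<theta> s u"
  using reflection_factor[OF \<eta> reflectionD(1)[OF \<theta>] Cmp_Mod_Hom[OF s reflectionD(2)[OF \<theta>]]] assms
  unfolding refl_square_def by blast

context
  fixes F C \<eta> G D \<theta> s u
  assumes square: "refl_square F C \<eta> G D \<theta> s u"
begin

lemma refl_squareD:
  shows "reflection F C \<eta>" "reflection G D \<theta>" "s \<in> Hom M F G" "u \<in> Hom E C D"
    "Cmp M (Ya u) \<eta> = Cmp M \<theta> s"
  using square by (auto simp: refl_square_def)

lemma refl_square_app:
  assumes X: "X \<in> Obj E" and x: "x \<in> el F X"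
  shows "Cmp E u (app \<eta> X x) = app \<theta> X (app s X x)"
proof -
  note S = refl_squareD and R = reflectionD[OF refl_squareD(1)]
  have "app \<eta> X x \<in> Hom E X C" using app_el[OF R(2) X x] by simp
  then show ?thesis
    using app_Cmp[OF R(2) X x, of "Ya u"] app_Cmp[OF S(3) X x, of \<theta>] S(5) app_yoneda_arr[OF S(4)] by simp
qed

lemma refl_square_Cmp:
  assumes e: "e \<in> Hom E D T"
  shows "Cmp M (Cmp M (Ya e) \<theta>) s = Cmp M (Ya (Cmp E e u)) \<eta>"
  using M.Cmp_assoc[OF refl_squareD(3) reflectionD(2)[OF refl_squareD(2)] yoneda_arr_Hom[OF e]]
    M.Cmp_assoc[OF reflectionD(2)[OF refl_squareD(1)] yoneda_arr_Hom[OF refl_squareD(4)] yoneda_arr_Hom[OF e]]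
    refl_squareD(5) yoneda_arr_Cmp[OF refl_squareD(4) e] by simp

text \<open>
  Let \<open>u \<circ> w = 0\<close>. Locally \<open>w\<close> is \<open>\<eta> x\<close>, and then \<open>s x\<close> is killed by \<open>\<theta>\<close>, hence locally zero; so \<open>x\<close>
  is locally zero. This gives \<open>w\<close> composed with two deflations, which can be cancelled.
\<close>

lemma refl_square_mono:
  assumes inj: "pw_inj s" and w: "w \<in> Hom E X C" "Cmp E u w = Zero E X D"
  shows "w = Zero E X C"
proof -
  note S = refl_squareD and R = reflectionD[OF refl_squareD(1)] and R' = reflectionD[OF refl_squareD(2)]
  have F: "additive_presheaf E F" using Hom_presheaf[OF S(3)] by simp
  have X: "X \<in> Obj E" using HomD[OF w(1)] by simp
  obtain X' d x where d: "d \<in> Hom E X' X" "deflation K d" "x \<in> el F X'" "app \<eta> X' x = Cmp E w d"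
    by (rule reflection_loc_surj[OF S(1) w(1)])
  have X': "X' \<in> Obj E" using HomD[OF d(1)] by simp
  have "app \<theta> X' (app s X' x) = Zero E X' D"
    using refl_square_app[OF X' d(3)] d(4) Cmp_assoc[OF d(1) w(1) S(4)] w(2) Cmp_Zero_left[OF d(1) R'(1)] by simp
  then obtain X'' d' where d': "d' \<in> Hom E X'' X'" "deflation K d'"
      "Act G d' (app s X' x) = \<one>\<^bsub>Val G X''\<^esub>"
    by (rule reflection_loc_inj[OF S(2) X' app_el[OF S(3) X' d(3)]])
  have X'': "X'' \<in> Obj E" using HomD[OF d'(1)] by simp
  have "app s X'' (Act F d' x) = \<one>\<^bsub>Val G X''\<^esub>" using app_act[OF S(3) d'(1) d(3)] d'(3) by simp
  then have "Act F d' x = \<one>\<^bsub>Val F X''\<^esub>"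
    using inj X'' act_el[OF F d'(1) d(3)] unfolding pw_inj_iff[OF S(3)] by simp
  then have "Cmp E (Cmp E w d) d' = Cmp E (Cmp E (Zero E X C) d) d'"
    using app_act[OF R(2) d'(1) d(3)] d(4) app_one[OF R(2) X'']
      Cmp_Zero_left[OF d(1) R(1)] Cmp_Zero_left[OF d'(1) R(1)] by simp
  then have "Cmp E w d = Cmp E (Zero E X C) d"
    by (rule deflation_epi[OF d'(2,1) Cmp_Hom[OF d(1) w(1)] Cmp_Hom[OF d(1) Zero_Hom[OF X R(1)]]])
  then show ?thesis by (rule deflation_epi[OF d(2,1) w(1) Zero_Hom[OF X R(1)]])
qed

end

section \<open>Weak isomorphisms\<close>

text \<open>
  The identity of \<open>D\<close> lifts locally along \<open>\<theta>\<close> to some \<open>y\<close>, that is, \<open>\<theta> y = d\<close> for a deflation \<open>d\<close>. As the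
  cokernel of \<open>i\<close> is locally zero, \<open>y\<close> comes from \<open>F\<close> after a further pullback along \<open>d'\<close>. So
  the deflation \<open>d \<circ> d'\<close> factors through the monomorphism \<open>u\<close>.
\<close>

lemma weak_iso_infl_reflects_iso:
  assumes ip: "(i, p) \<in> adm_conflations E K" and eff: "Cod M p \<in> eff E K"
    and square: "refl_square F C \<eta> G D \<theta> i u"
  shows "is_iso E u"
proof -
  note S = refl_squareD[OF square]
  note i = S(3) and u = S(4) and R = reflectionD[OF S(1)] and R' = reflectionD[OF S(2)]
  obtain F' G' H where "i \<in> Hom M F' G'" "p \<in> Hom M G' H" by (rule adm_conflation_Hom[OF ip])
  then have p: "p \<in> Hom M G H" using Hom_fst_snd[OF i] Hom_fst_snd[of i F' G'] by simp
  note ex = adm_conflationD(1,2)[OF ip i p]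
  have H: "H \<in> eff E K" using eff M.HomD[OF p] by simp
  have G: "additive_presheaf E G" using Hom_presheaf[OF i] by simp
  obtain X d y where d: "d \<in> Hom E X D" "deflation K d" "y \<in> el G X" "app \<theta> X y = Cmp E (Idn E D) d"
    by (rule reflection_loc_surj[OF S(2) Idn_Hom[OF R'(1)]])
  have X: "X \<in> Obj E" using HomD[OF d(1)] by simp
  obtain X' d' where d': "d' \<in> Hom E X' X" "deflation K d'" "Act H d' (app p X y) = \<one>\<^bsub>Val H X'\<^esub>"
    using eff_locally_zero[OF H X app_el[OF p X d(3)]] by blast
  have X': "X' \<in> Obj E" using HomD[OF d'(1)] by simp
  have "app p X' (Act G d' y) = \<one>\<^bsub>Val H X'\<^esub>" using app_act[OF p d'(1) d(3)] d'(3) by simp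
  then obtain x where x: "x \<in> el F X'" "app i X' x = Act G d' y"
    using pw_exactD[OF i p ex(2) X' act_el[OF G d'(1) d(3)]] by blast
  have \<eta>x: "app \<eta> X' x \<in> Hom E X' C" using app_el[OF R(2) X' x(1)] by simp
  have "Cmp E d d' = Cmp E u (app \<eta> X' x)"
    using refl_square_app[OF square X' x(1)] x(2) app_act[OF R'(2) d'(1) d(3)] d(4) Idn_Cmp[OF d(1)] by simp
  then show ?thesis
    using iso_if_deflation_factors[OF u refl_square_mono[OF square ex(1)]
      deflation_Cmp[OF d'(2) d(2) d'(1) d(1)] Cmp_Hom[OF d'(1) d(1)] \<eta>x] by blast
qed

text \<open>
  Elements of \<open>N\<close> are locally zero, whereas an arrow that vanishes on a deflation is zero.
\<close>

lemma eff_hom_yoneda: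
  assumes N: "N \<in> eff E K" and h: "h \<in> Hom M N (Y X)" and X: "X \<in> Obj E" and A: "A \<in> Obj E" "x \<in> el N A"
  shows "app h A x = Zero E A X"
proof -
  obtain A' d where d: "d \<in> Hom E A' A" "deflation K d" "Act N d x = \<one>\<^bsub>Val N A'\<^esub>"
    using eff_locally_zero[OF N A] by blast
  have A': "A' \<in> Obj E" using HomD[OF d(1)] by simp
  have hx: "app h A x \<in> Hom E A X" using app_el[OF h A] by simp
  have "Cmp E (app h A x) d = Cmp E (Zero E A X) d"
    using app_act[OF h d(1) A(2)] d(3) app_one[OF h A'] Cmp_Zero_left[OF d(1) X] by simp
  then show ?thesis by (rule deflation_epi[OF d(2,1) hx Zero_Hom[OF A(1) X]])
qed

text \<open>
  The induction over the generation of weak isomorphisms. For an inflation \<open>i\<close> the maps \<open>F \<rightarrow> \<bbbY>(X)\<close>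
  and \<open>G \<rightarrow> \<bbbY>(X)\<close> are the arrows \<open>C \<rightarrow> X\<close> and \<open>D \<rightarrow> X\<close>, and composition with \<open>i\<close> becomes
  composition with the isomorphism \<open>u\<close>. For a deflation the claim is the universal property of the
  cokernel, since every map from its kernel to \<open>\<bbbY>(X)\<close> is zero.
\<close>

lemma weak_iso_local:
  assumes "s \<in> weak_isos E K"
  shows "\<exists>F G. F \<in> adm \<and> G \<in> adm \<and> s \<in> Hom M F G \<and>
    (\<forall>X \<in> Obj E. \<forall>h \<in> Hom M F (Y X). \<exists>!h'. h' \<in> Hom M G (Y X) \<and> Cmp M h' s = h)"
  using assms
proof (induction rule: weak_isos.induct)
  case (ident F)
  then have F: "F \<in> adm" by (simp add: Obj_mod_adm)
  then have I: "Idn M F \<in> Hom M F F" by (rule Idn_Mod_Hom[OF adm_presheaf])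
  have *: "\<exists>!h'. h' \<in> Hom M F (Y X) \<and> Cmp M h' (Idn M F) = h" if "h \<in> Hom M F (Y X)" for X h
    using M.Cmp_Idn that by metis
  show ?case unfolding Idn_mod_adm by (intro exI[of _ F] conjI F I ballI *)
next
  case (infl i p)
  obtain F G H where FG: "F \<in> adm" "G \<in> adm" "H \<in> adm" "i \<in> Hom M F G" "p \<in> Hom M G H"
    by (rule adm_conflation_Hom[OF infl(1)])
  have eff: "Cod M p \<in> eff E K" using infl(2) by simp
  obtain C \<eta> where \<eta>: "reflection F C \<eta>" using reflection_exists[OF FG(1)] by blast
  obtain D \<theta> where \<theta>: "reflection G D \<theta>" using reflection_exists[OF FG(2)] by blast
  note R = reflectionD[OF \<eta>] and R' = reflectionD[OF \<theta>]
  obtain u where square: "refl_square F C \<eta> G D \<theta> i u" using refl_square_exists[OF \<eta> \<theta> FG(4)] by blast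
  note u = refl_squareD(4)[OF square] and uC = refl_square_Cmp[OF square]
  have iso: "is_iso E u" by (rule weak_iso_infl_reflects_iso[OF infl(1) eff square])
  obtain v where v: "v \<in> Hom E D C" "Cmp E v u = Idn E C" using isoE[OF iso u] by blast
  have "\<exists>!h'. h' \<in> Hom M G (Y X) \<and> Cmp M h' i = h" if X: "X \<in> Obj E" and h: "h \<in> Hom M F (Y X)" for X h
  proof -
    obtain e where e: "e \<in> Hom E C X" "Cmp M (Ya e) \<eta> = h" using R(4)[OF X h] by blast
    note ev = Cmp_Hom[OF v(1) e(1)]
    show ?thesis
    proof (rule ex1I[of _ "Cmp M (Ya (Cmp E e v)) \<theta>"], intro conjI)
      show "Cmp M (Ya (Cmp E e v)) \<theta> \<in> Hom M G (Y X)" by (rule Cmp_Mod_Hom[OF R'(2) yoneda_arr_Hom[OF ev]])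
      show ev_h: "Cmp M (Cmp M (Ya (Cmp E e v)) \<theta>) i = h"
        using uC[OF ev] Cmp_assoc[OF u v(1) e(1)] v(2) Cmp_Idn[OF e(1)] e(2) by simp
      fix h' assume h': "h' \<in> Hom M G (Y X) \<and> Cmp M h' i = h"
      then obtain e' where e': "e' \<in> Hom E D X" "Cmp M (Ya e') \<theta> = h'" using R'(4)[OF X] by blast
      have "Cmp M (Ya (Cmp E e' u)) \<eta> = Cmp M (Ya (Cmp E (Cmp E e v) u)) \<eta>"
        using uC[OF e'(1)] uC[OF ev] e'(2) h' ev_h by simp
      then have "Cmp E e' u = Cmp E (Cmp E e v) u"
        by (rule R(5)[OF Cmp_Hom[OF u e'(1)] Cmp_Hom[OF u ev]])
      then have "e' = Cmp E e v" by (rule iso_cancel_right[OF iso u e'(1) ev])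
      then show "h' = Cmp M (Ya (Cmp E e v)) \<theta>" using e'(2) by simp
    qed
  qed
  then show ?case using FG by blast
next
  case (defl i p)
  obtain F G H where FG: "F \<in> adm" "G \<in> adm" "H \<in> adm" "i \<in> Hom M F G" "p \<in> Hom M G H"
    by (rule adm_conflation_Hom[OF defl(1)])
  have F: "F \<in> eff E K" using defl(2) M.HomD[OF FG(4)] by simp
  note C = adm_conflationD(3,4)[OF defl(1) FG(4,5)]
  have "\<exists>!h'. h' \<in> Hom M H (Y X) \<and> Cmp M h' p = h" if X: "X \<in> Obj E" and h: "h \<in> Hom M G (Y X)" for X h
  proof -
    have "\<exists>u \<in> Hom M H (Y X). Cmp M u p = h"
    proof (rule C(1)[OF yoneda_adm[OF X] h])
      fix A x assume A: "A \<in> Obj E" "x \<in> el F A"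
      then show "app h A (app i A x) = \<one>\<^bsub>Val (Y X) A\<^esub>"
        using eff_hom_yoneda[OF F Cmp_Mod_Hom[OF FG(4) h] X A] app_Cmp[OF FG(4) A, of h] by simp
    qed
    then show ?thesis using C(2)[OF yoneda_adm[OF X]] by metis
  qed
  then show ?case using FG by blast
next
  case (comp s t)
  obtain F G where s: "F \<in> adm" "s \<in> Hom M F G"
    "\<forall>X \<in> Obj E. \<forall>h \<in> Hom M F (Y X). \<exists>!h'. h' \<in> Hom M G (Y X) \<and> Cmp M h' s = h"
    using comp.IH(1) by blast
  obtain G' H where t: "H \<in> adm" "t \<in> Hom M G' H"
    "\<forall>X \<in> Obj E. \<forall>h \<in> Hom M G' (Y X). \<exists>!h'. h' \<in> Hom M H (Y X) \<and> Cmp M h' t = h"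
    using comp.IH(2) by blast
  have GG': "G' = G" using comp.hyps(3) M.HomD[OF s(2)] M.HomD[OF t(2)] by simp
  note t = t[unfolded GG']
  note st = Cmp_Mod_Hom[OF s(2) t(2)]
  have "\<exists>!h'. h' \<in> Hom M H (Y X) \<and> Cmp M h' (Cmp M t s) = h" if X: "X \<in> Obj E" and h: "h \<in> Hom M F (Y X)" for X h
  proof -
    obtain h1 where h1: "h1 \<in> Hom M G (Y X)" "Cmp M h1 s = h" using s(3) X h by blast
    obtain h2 where h2: "h2 \<in> Hom M H (Y X)" "Cmp M h2 t = h1" using t(3) X h1(1) by blast
    show ?thesis
    proof (rule ex1I[of _ h2], intro conjI)
      show "h2 \<in> Hom M H (Y X)" by (rule h2(1))
      show "Cmp M h2 (Cmp M t s) = h" using M.Cmp_assoc[OF s(2) t(2) h2(1)] h1(2) h2(2) by simp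
      fix h' assume h': "h' \<in> Hom M H (Y X) \<and> Cmp M h' (Cmp M t s) = h"
      then have "Cmp M (Cmp M h' t) s = h" using M.Cmp_assoc[OF s(2) t(2), of h'] by auto
      moreover have "Cmp M h' t \<in> Hom M G (Y X)" using Cmp_Mod_Hom[OF t(2)] h' by blast
      ultimately have "Cmp M h' t = h1" using s(3) X h h1 by blast
      then show "h' = h2" using t(3) X h1(1) h2 h' by blast
    qed
  qed
  then show ?case unfolding Cmp_mod_adm using s(1) t(1) st by blast
qed

sublocale Q: localizing "mod_adm E K" "weak_isos E K"
proof (intro localizing.intro localizing_axioms.intro category_mod_adm subsetI)
  fix s assume "s \<in> weak_isos E K"
  then obtain F G where "F \<in> adm" "G \<in> adm" "s \<in> Hom M F G" using weak_iso_local by blast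
  then have "s \<in> Hom (mod_adm E K) F G" by (simp add: Hom_mod_adm)
  then show "s \<in> Arr (mod_adm E K)" by (simp add: Hom_def)
qed

lemma local_obj_yoneda:
  assumes X: "X \<in> Obj E"
  shows "Q.local_obj (Y X)"
  unfolding Q.local_obj_def
proof (intro conjI ballI)
  show "Y X \<in> Obj (mod_adm E K)" using yoneda_adm[OF X] Obj_mod_adm by blast
  fix s h assume s: "s \<in> weak_isos E K" and h: "h \<in> Hom (mod_adm E K) (Dom (mod_adm E K) s) (Y X)"
  obtain F G where FG: "F \<in> adm" "G \<in> adm" "s \<in> Hom M F G"
    "\<forall>X \<in> Obj E. \<forall>h \<in> Hom M F (Y X). \<exists>!h'. h' \<in> Hom M G (Y X) \<and> Cmp M h' s = h"
    using weak_iso_local[OF s] by blast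
  have "h \<in> Hom M F (Y X)" using h M.HomD[OF FG(3)] by (simp add: Hom_mod_adm)
  then have "\<exists>!h'. h' \<in> Hom M G (Y X) \<and> Cmp M h' s = h" using FG(4) X by blast
  then show "\<exists>!h'. h' \<in> Hom (mod_adm E K) (Cod (mod_adm E K) s) (Y X) \<and> Cmp (mod_adm E K) h' s = h"
    using M.HomD[OF FG(3)] FG(2) yoneda_adm[OF X] by (simp add: Hom_mod_adm)
qed

section \<open>The equivalence\<close>

lemma is_functor_yoneda_adm: "is_functor E (mod_adm E K) Y Ya"
  using is_functor_yoneda category_mod_adm yoneda_adm Dom_Obj Cod_Obj
  by (simp add: is_functor_def Obj_mod_adm Hom_mod_adm)

abbreviation "\<Phi>o \<equiv> Q_obj \<circ> Y"
abbreviation "\<Phi>a \<equiv> Q_arr E K \<circ> Ya"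

sublocale \<Phi>: ff_es_functor E "quot E K" \<Phi>o \<Phi>a
  unfolding quot_def Q_obj_def Q_arr_def
proof (rule Q.ff_es_functor_loc[OF is_functor_yoneda_adm])
  show "\<exists>f \<in> Hom E A B. Ya f = g" if "A \<in> Obj E" "B \<in> Obj E" "g \<in> Hom (mod_adm E K) (Y A) (Y B)" for A B g
    using yoneda_full that by (simp add: Hom_mod_adm)
  show "f = f'" if "f \<in> Hom E A B" "f' \<in> Hom E A B" "Ya f = Ya f'" for A B f f'
    using yoneda_faithful that by blast
  show "Q.local_obj (Y A)" if "A \<in> Obj E" for A by (rule local_obj_yoneda[OF that])
  fix F assume "F \<in> Obj (mod_adm E K)"
  then have F: "F \<in> adm" by (simp add: Obj_mod_adm)
  then obtain C \<eta> where "reflection F C \<eta>" using reflection_exists by blast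
  note R = reflectionD[OF this]
  show "\<exists>A \<in> Obj E. \<exists>\<eta> \<in> Hom (mod_adm E K) F (Y A). \<eta> \<in> weak_isos E K"
  proof (intro bexI)
    show "\<eta> \<in> Hom (mod_adm E K) F (Y C)" using R(2) F yoneda_adm[OF R(1)] by (simp add: Hom_mod_adm)
  qed (use R(1,3) in auto)
qed

lemma Q_arr_Hom: "t \<in> Hom M F G \<Longrightarrow> F \<in> adm \<Longrightarrow> G \<in> adm \<Longrightarrow> Q_arr E K t \<in> Hom (quot E K) F G"
  using Q.loc.Fa_Hom[of t F G] by (simp add: Hom_mod_adm Q_arr_def quot_def loc_obj_def)

lemma Q_arr_Cmp:
  "t \<in> Hom M F G \<Longrightarrow> s \<in> Hom M G H \<Longrightarrow> F \<in> adm \<Longrightarrow> G \<in> adm \<Longrightarrow> H \<in> adm \<Longrightarrow>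
    Q_arr E K (Cmp M s t) = Cmp (quot E K) (Q_arr E K s) (Q_arr E K t)"
  using Q.loc.Fa_Cmp[of t F G s H] by (simp add: Hom_mod_adm Q_arr_def quot_def)

lemma Q_arr_iso: "s \<in> weak_isos E K \<Longrightarrow> is_iso (quot E K) (Q_arr E K s)"
  using Q.is_iso_loc[of s] by (simp add: Q_arr_def quot_def)

text \<open>
  That \<open>v\<close> is a cokernel is formal, because reflections preserve colimits. That \<open>u\<close> is a kernel is the
  exactness of sheafification: an arrow \<open>w\<close> with \<open>v \<circ> w = 0\<close> lifts locally to an element \<open>y\<close> of \<open>G\<close>
  that goes to zero in \<open>H\<close> after a further pullback, hence comes from some \<open>z\<close> in \<open>F\<close>. This factors
  \<open>w \<circ> d \<circ> d'\<close> through \<open>u\<close>, and the factorization descends along the deflation \<open>d \<circ> d'\<close> because \<open>u\<close> is mono.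
\<close>

lemma kernel_cokernel_pair_reflection:
  assumes ip: "(i, p) \<in> adm_conflations E K"
    and squ: "refl_square F C \<eta> G D \<theta> i u" and sqv: "refl_square G D \<theta> H B \<zeta> p v"
  shows "kernel_cokernel_pair E u v"
proof -
  note Su = refl_squareD[OF squ] and Sv = refl_squareD[OF sqv]
  note \<eta> = Su(1) and \<theta> = Su(2) and \<zeta> = Sv(2) and ipH = Su(3) Sv(3)
  note u = Su(4) refl_square_app[OF squ] and v = Sv(4) refl_square_app[OF sqv] refl_square_Cmp[OF sqv]
  note R1 = reflectionD[OF \<eta>] and R2 = reflectionD[OF \<theta>] and R3 = reflectionD[OF \<zeta>]
  have G: "additive_presheaf E G" using Hom_presheaf[OF ipH(1)] by simp
  note ex = adm_conflationD(1,2)[OF ip ipH] and factor = adm_conflationD(3)[OF ip ipH]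
    and epi = adm_conflationD(4)[OF ip ipH]
  have vu0: "Cmp E v u = Zero E C B"
  proof (rule R1(5)[OF Cmp_Hom[OF u(1) v(1)] Zero_Hom[OF R1(1) R3(1)]])
    have z: "Zero E C B \<in> Hom E C B" by (rule Zero_Hom[OF R1(1) R3(1)])
    note vu = Cmp_Hom[OF u(1) v(1)]
    show "Cmp M (Ya (Cmp E v u)) \<eta> = Cmp M (Ya (Zero E C B)) \<eta>"
    proof (rule Hom_Mod_eqI[OF Cmp_Mod_Hom[OF R1(2) yoneda_arr_Hom[OF vu]]
          Cmp_Mod_Hom[OF R1(2) yoneda_arr_Hom[OF z]]])
      fix X x assume X: "X \<in> Obj E" and x: "x \<in> el F X"
      have \<eta>x: "app \<eta> X x \<in> Hom E X C" using app_el[OF R1(2) X x] by simp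
      have "Cmp E (Cmp E v u) (app \<eta> X x) = app \<zeta> X (app p X (app i X x))"
        using Cmp_assoc[OF \<eta>x u(1) v(1)] u(2)[OF X x] v(2)[OF X app_el[OF ipH(1) X x]] by simp
      also have "\<dots> = Zero E X B" using pw_exact_Cmp[OF ipH ex(2) X x] app_one[OF R3(2) X] by simp
      also have "\<dots> = Cmp E (Zero E C B) (app \<eta> X x)" using Cmp_Zero_left[OF \<eta>x R3(1)] by simp
      finally show "app (Cmp M (Ya (Cmp E v u)) \<eta>) X x = app (Cmp M (Ya (Zero E C B)) \<eta>) X x"
        using app_Cmp[OF R1(2) X x] app_yoneda_arr[OF vu \<eta>x] app_yoneda_arr[OF z \<eta>x] by simp
    qed
  qed
  then have zero: "zero_arr E (Cmp E v u)" using zero_arr_iff_Zero[OF Cmp_Hom[OF u(1) v(1)]] by simp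
  have "is_kernel E u v"
  proof (rule kernelI[OF v(1) u(1) zero])
    fix X w assume w: "w \<in> Hom E X D" "zero_arr E (Cmp E v w)"
    then have vw: "Cmp E v w = Zero E X B" using zero_arr_iff_Zero[OF Cmp_Hom[OF w(1) v(1)]] by simp
    obtain X1 d y where d: "d \<in> Hom E X1 X" "deflation K d" "y \<in> el G X1" "app \<theta> X1 y = Cmp E w d"
      by (rule reflection_loc_surj[OF \<theta> w(1)])
    have X1: "X1 \<in> Obj E" using HomD[OF d(1)] by simp
    have "app \<zeta> X1 (app p X1 y) = Zero E X1 B"
      using v(2)[OF X1 d(3)] d(4) Cmp_assoc[OF d(1) w(1) v(1)] vw Cmp_Zero_left[OF d(1) R3(1)] by simp
    then obtain X2 d' where d': "d' \<in> Hom E X2 X1" "deflation K d'" "Act H d' (app p X1 y) = \<one>\<^bsub>Val H X2\<^esub>"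
      by (rule reflection_loc_inj[OF \<zeta> X1 app_el[OF ipH(2) X1 d(3)]])
    have X2: "X2 \<in> Obj E" using HomD[OF d'(1)] by simp
    have "app p X2 (Act G d' y) = \<one>\<^bsub>Val H X2\<^esub>" using app_act[OF ipH(2) d'(1) d(3)] d'(3) by simp
    then obtain z where z: "z \<in> el F X2" "app i X2 z = Act G d' y"
      using pw_exactD[OF ipH ex(2) X2 act_el[OF G d'(1) d(3)]] by blast
    let ?t = "app \<eta> X2 z" and ?e = "Cmp E d d'"
    have t: "?t \<in> Hom E X2 C" using app_el[OF R1(2) X2 z(1)] by simp
    have e: "?e \<in> Hom E X2 X" "deflation K ?e"
      using Cmp_Hom[OF d'(1) d(1)] deflation_Cmp[OF d'(2) d(2) d'(1) d(1)] by auto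
    have ut: "Cmp E u ?t = Cmp E w ?e"
      using u(2)[OF X2 z(1)] z(2) app_act[OF R2(2) d'(1) d(3)] d(4) Cmp_assoc[OF d'(1) d(1) w(1)] by simp
    obtain l T where l: "(l, ?e) \<in> K" "l \<in> Hom E T X2" by (rule deflation_conflation[OF e(2,1)])
    have T: "T \<in> Obj E" using HomD[OF l(2)] by simp
    have utl: "Cmp E u (Cmp E ?t l) = Zero E T D"
      using Cmp_assoc[OF l(2) t u(1)] ut Cmp_assoc[OF l(2) e(1) w(1)] conflation_zero[OF l e(1)]
        Cmp_Zero_right[OF w(1) T] by simp
    have "Cmp E ?t l = Zero E T C"
      by (rule refl_square_mono[OF squ ex(1) Cmp_Hom[OF l(2) t] utl])
    then obtain t' where t': "t' \<in> Hom E X C" "Cmp E t' ?e = ?t" using conflation_cokernel[OF l e(1) t] by blast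
    have "Cmp E u t' = w"
      by (rule deflation_epi[OF e(2,1) Cmp_Hom[OF t'(1) u(1)] w(1)])
        (use Cmp_assoc[OF e(1) t'(1) u(1)] t'(2) ut in simp)
    with t'(1) show "\<exists>t \<in> Hom E X C. Cmp E u t = w" by blast
  next
    fix X a b assume ab: "a \<in> Hom E X C" "b \<in> Hom E X C" "Cmp E u a = Cmp E u b"
    show "a = b"
      by (rule mono_if_kernel_zero[OF u(1) refl_square_mono[OF squ ex(1)] ab])
  qed
  moreover have "is_cokernel E v u"
  proof (rule cokernelI[OF u(1) v(1) zero])
    fix X t assume t: "t \<in> Hom E D X" "zero_arr E (Cmp E t u)"
    then have tu: "Cmp E t u = Zero E C X" using zero_arr_iff_Zero[OF Cmp_Hom[OF u(1) t(1)]] by simp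
    have X: "X \<in> Obj E" using HomD[OF t(1)] by simp
    let ?h = "Cmp M (Ya t) \<theta>"
    have h: "?h \<in> Hom M G (Y X)" by (rule Cmp_Mod_Hom[OF R2(2) yoneda_arr_Hom[OF t(1)]])
    have "\<exists>k \<in> Hom M H (Y X). Cmp M k p = ?h"
    proof (rule factor[OF yoneda_adm[OF X] h])
      fix A x assume A: "A \<in> Obj E" and x: "x \<in> el F A"
      have ix: "app i A x \<in> el G A" by (rule app_el[OF ipH(1) A x])
      have \<eta>x: "app \<eta> A x \<in> Hom E A C" using app_el[OF R1(2) A x] by simp
      have \<theta>ix: "app \<theta> A (app i A x) \<in> Hom E A D" using app_el[OF R2(2) A ix] by simp
      have "app ?h A (app i A x) = Cmp E t (app \<theta> A (app i A x))"
        using app_Cmp[OF R2(2) A ix, of "Ya t"] app_yoneda_arr[OF t(1) \<theta>ix] by simp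
      also have "\<dots> = Zero E A X"
        using u(2)[OF A x] Cmp_assoc[OF \<eta>x u(1) t(1)] tu Cmp_Zero_left[OF \<eta>x X] by simp
      finally show "app ?h A (app i A x) = \<one>\<^bsub>Val (Y X) A\<^esub>" by simp
    qed
    then obtain k where k: "k \<in> Hom M H (Y X)" "Cmp M k p = ?h" by blast
    obtain t' where t': "t' \<in> Hom E B X" "Cmp M (Ya t') \<zeta> = k" using R3(4)[OF X k(1)] by blast
    have "Cmp E t' v = t"
      by (rule R2(5)[OF Cmp_Hom[OF v(1) t'(1)] t(1)]) (use v(3)[OF t'(1)] t'(2) k(2) in simp)
    with t'(1) show "\<exists>t' \<in> Hom E B X. Cmp E t' v = t" by blast
  next
    fix X a b assume ab: "a \<in> Hom E B X" "b \<in> Hom E B X" "Cmp E a v = Cmp E b v"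
    have X: "X \<in> Obj E" using HomD[OF ab(1)] by simp
    have "Cmp M (Ya a) \<zeta> = Cmp M (Ya b) \<zeta>"
      by (rule epi[OF yoneda_adm[OF X] Cmp_Mod_Hom[OF R3(2) yoneda_arr_Hom[OF ab(1)]]
            Cmp_Mod_Hom[OF R3(2) yoneda_arr_Hom[OF ab(2)]]])
        (use v(3)[OF ab(1)] v(3)[OF ab(2)] ab(3) in simp)
    then show "a = b" by (rule R3(5)[OF ab(1,2)])
  qed
  ultimately show ?thesis by (simp add: kernel_cokernel_pair_def)
qed

text \<open>
  The reflections become isomorphisms in the quotient and identify the image of a conflation
  with that of the kernel-cokernel pair it induces in \<open>E\<close>.
\<close>

lemma kernel_cokernel_pair_Q:
  assumes ip: "(i, p) \<in> adm_conflations E K"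
  shows "kernel_cokernel_pair (quot E K) (Q_arr E K i) (Q_arr E K p)"
proof -
  interpret q: category "quot E K" by (rule \<Phi>.categories)
  obtain Z where Z: "is_zero E Z" using ex_zero by blast
  obtain F G H where FGH: "F \<in> adm" "G \<in> adm" "H \<in> adm" and ipH: "i \<in> Hom M F G" "p \<in> Hom M G H"
    by (rule adm_conflation_Hom[OF ip])
  obtain C \<eta> where \<eta>: "reflection F C \<eta>" using reflection_exists[OF FGH(1)] by blast
  obtain D \<theta> where \<theta>: "reflection G D \<theta>" using reflection_exists[OF FGH(2)] by blast
  obtain B \<zeta> where \<zeta>: "reflection H B \<zeta>" using reflection_exists[OF FGH(3)] by blast
  obtain u where squ: "refl_square F C \<eta> G D \<theta> i u" using refl_square_exists[OF \<eta> \<theta> ipH(1)] by blast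
  obtain v where sqv: "refl_square G D \<theta> H B \<zeta> p v" using refl_square_exists[OF \<theta> \<zeta> ipH(2)] by blast
  note u = refl_squareD(4,5)[OF squ] and v = refl_squareD(4,5)[OF sqv]
  note R1 = reflectionD(1-3)[OF \<eta>] and R2 = reflectionD(1-3)[OF \<theta>] and R3 = reflectionD(1-3)[OF \<zeta>]
  note Y1 = yoneda_adm[OF R1(1)] and Y2 = yoneda_adm[OF R2(1)] and Y3 = yoneda_adm[OF R3(1)]
  have "kernel_cokernel_pair E u v"
    by (rule kernel_cokernel_pair_reflection[OF ip squ sqv])
  then have kcp: "kernel_cokernel_pair (quot E K) (Q_arr E K (Ya u)) (Q_arr E K (Ya v))"
    using \<Phi>.kernel_cokernel_pair_image[OF Z u(1) v(1)] by simp
  show ?thesis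
  proof (rule q.kernel_cokernel_pair_iso[OF kcp Q_arr_Hom[OF yoneda_arr_Hom[OF u(1)] Y1 Y2]
        Q_arr_Hom[OF yoneda_arr_Hom[OF v(1)] Y2 Y3] Q_arr_Hom[OF ipH(1) FGH(1,2)] Q_arr_Hom[OF ipH(2) FGH(2,3)]
        Q_arr_iso[OF R1(3)] Q_arr_Hom[OF R1(2) FGH(1) Y1] Q_arr_iso[OF R2(3)] Q_arr_Hom[OF R2(2) FGH(2) Y2]
        Q_arr_iso[OF R3(3)] Q_arr_Hom[OF R3(2) FGH(3) Y3]])
    show "Cmp (quot E K) (Q_arr E K \<theta>) (Q_arr E K i) = Cmp (quot E K) (Q_arr E K (Ya u)) (Q_arr E K \<eta>)"
      using Q_arr_Cmp[OF ipH(1) R2(2) FGH(1,2) Y2] Q_arr_Cmp[OF R1(2) yoneda_arr_Hom[OF u(1)] FGH(1) Y1 Y2]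
        u(2) by simp
    show "Cmp (quot E K) (Q_arr E K \<zeta>) (Q_arr E K p) = Cmp (quot E K) (Q_arr E K (Ya v)) (Q_arr E K \<theta>)"
      using Q_arr_Cmp[OF ipH(2) R3(2) FGH(2,3) Y3] Q_arr_Cmp[OF R2(2) yoneda_arr_Hom[OF v(1)] FGH(2) Y2 Y3]
        v(2) by simp
  qed
qed

lemma quot_conflations_kernel_cokernel_pair:
  assumes "(i, p) \<in> quot_conflations E K"
  shows "kernel_cokernel_pair (quot E K) i p"
proof -
  have "conflation_structure (quot E K) {(i, p). kernel_cokernel_pair (quot E K) i p}"
    by (rule category.conflation_structure_kernel_cokernel_pairs[OF \<Phi>.categories(2)])
  moreover have "map_prod (Q_arr E K) (Q_arr E K) ` adm_conflations E K
      \<subseteq> {(i, p). kernel_cokernel_pair (quot E K) i p}"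
    using kernel_cokernel_pair_Q by auto
  ultimately show ?thesis
    using assms unfolding quot_conflations_def smallest_conflation_structure_def by blast
qed

text \<open>
  \<open>\<bbbY>(A) \<rightarrow> \<bbbY>(B) \<rightarrow> G\<close> with \<open>G = coker \<bbbY>(i)\<close> is a conflation of \<open>mod_adm\<close>. In the quotient the weak
  isomorphism \<open>m : G \<rightarrow> \<bbbY>(C)\<close> identifies it with the image of \<open>(i, p)\<close>, so every conflation structure
  that contains the first pair contains the second.
\<close>

lemma conflation_image:
  assumes ip: "(i, p) \<in> K"
  shows "(\<Phi>a i, \<Phi>a p) \<in> quot_conflations E K"
  unfolding quot_conflations_def smallest_conflation_structure_def
proof (rule InterI, clarify)
  interpret q: category "quot E K" by (rule \<Phi>.categories)
  fix S assume S: "conflation_structure (quot E K) S"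
    and sub: "map_prod (Q_arr E K) (Q_arr E K) ` adm_conflations E K \<subseteq> S"
  obtain A B C where i: "i \<in> Hom E A B" and p: "p \<in> Hom E B C"
    using conflation_Hom[OF ip] by blast
  have o: "A \<in> Obj E" "B \<in> Obj E" "C \<in> Obj E" using HomD[OF i] HomD[OF p] by auto
  note Yadm = yoneda_adm[OF o(1)] yoneda_adm[OF o(2)] yoneda_adm[OF o(3)]
  obtain G where "\<exists>b. presents i b G" using presents_exists[OF i] by blast
  then obtain c where c: "c \<in> Hom M (Y B) G" "pw_surj c" "pw_exact (Ya i) c"
    using presents_cokernel[OF i] by blast
  let ?b = "app c B (Idn E B)"
  have b: "presents i ?b G" by (rule presents_if_cokernel[OF i c])
  have infl: "inflation K i" using ip by (auto simp: inflation_def)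
  have G: "G \<in> adm" using adm_iff admissible_inflation[OF infl] b by blast
  obtain m where m: "m \<in> Hom M G (Y C)" "app m B ?b = p" "m \<in> weak_isos E K"
    using weak_iso_coker_inflation[OF ip i p b] by blast
  have inj: "pw_inj (Ya i)"
    unfolding pw_inj_iff[OF yoneda_arr_Hom[OF i]]
  proof (intro ballI impI)
    fix X u assume X: "X \<in> Obj E" and "u \<in> el (Y A) X" and z: "app (Ya i) X u = \<one>\<^bsub>Val (Y B) X\<^esub>"
    then have u: "u \<in> Hom E X A" by simp
    have "Cmp E i u = Cmp E i (Zero E X A)"
      using z app_yoneda_arr[OF i u] Cmp_Zero_right[OF i X] by simp
    then show "u = \<one>\<^bsub>Val (Y A) X\<^esub>" using inflation_mono[OF ip i p u Zero_Hom[OF X o(1)]] by simp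
  qed
  have "(Ya i, c) \<in> adm_conflations E K"
    by (rule adm_conflationI[OF Yadm(1,2) G yoneda_arr_Hom[OF i] c(1) inj c(3,2)])
  then have mem: "(Q_arr E K (Ya i), Q_arr E K c) \<in> S" using sub by force
  have mc: "Cmp M m c = Ya p"
  proof -
    have I: "Idn E B \<in> el (Y B) B" using Idn_Hom[OF o(2)] by simp
    show ?thesis
      by (rule yoneda_eqI[OF Cmp_Mod_Hom[OF c(1) m(1)] yoneda_arr_Hom[OF p]])
        (simp add: app_Cmp[OF c(1) o(2) I] m(2) app_yoneda_arr[OF p Idn_Hom[OF o(2)]] Cmp_Idn[OF p])
  qed
  note hi = Q_arr_Hom[OF yoneda_arr_Hom[OF i] Yadm(1,2)] and hc = Q_arr_Hom[OF c(1) Yadm(2) G]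
    and hp = Q_arr_Hom[OF yoneda_arr_Hom[OF p] Yadm(2,3)] and hm = Q_arr_Hom[OF m(1) G Yadm(3)]
  have qo: "Y A \<in> Obj (quot E K)" "Y B \<in> Obj (quot E K)" using q.HomD[OF hi] by auto
  have "Cmp (quot E K) (Idn (quot E K) (Y B)) (Q_arr E K (Ya i))
      = Cmp (quot E K) (Q_arr E K (Ya i)) (Idn (quot E K) (Y A))"
    using q.Idn_Cmp[OF hi] q.Cmp_Idn[OF hi] by simp
  moreover have "Cmp (quot E K) (Q_arr E K m) (Q_arr E K c)
      = Cmp (quot E K) (Q_arr E K (Ya p)) (Idn (quot E K) (Y B))"
    using Q_arr_Cmp[OF c(1) m(1) Yadm(2) G Yadm(3)] mc q.Cmp_Idn[OF hp] by simp
  ultimately have "(Q_arr E K (Ya i), Q_arr E K (Ya p)) \<in> S"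
    by (rule q.conflation_structure_iso[OF S mem hi hc hi hp q.iso_Idn[OF qo(1)] q.Idn_Hom[OF qo(1)]
          q.iso_Idn[OF qo(2)] q.Idn_Hom[OF qo(2)] Q_arr_iso[OF m(3)] hm])
  then show "(\<Phi>a i, \<Phi>a p) \<in> S" by simp
qed

text \<open>
  The identity of \<open>A\<close> is an arrow to no other object than \<open>A\<close>. This makes arrows of \<open>E\<close> composable if
  their images are.
\<close>

lemma yoneda_obj_inj:
  assumes A: "A \<in> Obj E" and eq: "Y A = Y B"
  shows "A = B"
proof -
  have "Idn E A \<in> el (Y A) A" using Idn_Hom[OF A] by simp
  then have "Idn E A \<in> Hom E A B" unfolding eq by simp
  then show ?thesis using HomD[OF Idn_Hom[OF A]] by (simp add: Hom_def)
qed

lemma conflation_iff_image: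
  assumes i: "i \<in> Arr E" and p: "p \<in> Arr E"
  shows "(i, p) \<in> K \<longleftrightarrow> (\<Phi>a i, \<Phi>a p) \<in> quot_conflations E K"
proof
  show "(i, p) \<in> K \<Longrightarrow> (\<Phi>a i, \<Phi>a p) \<in> quot_conflations E K" by (rule conflation_image)
  assume "(\<Phi>a i, \<Phi>a p) \<in> quot_conflations E K"
  then have kcp: "kernel_cokernel_pair (quot E K) (\<Phi>a i) (\<Phi>a p)"
    by (rule quot_conflations_kernel_cokernel_pair)
  interpret q: category "quot E K" by (rule \<Phi>.categories)
  obtain Z where Z: "is_zero E Z" using ex_zero by blast
  note hi = \<Phi>.Fa_Hom[OF Arr_Hom[OF i]] and hp = \<Phi>.Fa_Hom[OF Arr_Hom[OF p]]
  have "Cod (quot E K) (\<Phi>a i) = Dom (quot E K) (\<Phi>a p)"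
    using kcp by (simp add: kernel_cokernel_pair_def is_kernel_def)
  then have "Y (Cod E i) = Y (Dom E p)" using q.HomD[OF hi] q.HomD[OF hp] by (simp add: Q_obj_def loc_obj_def)
  then have "Cod E i = Dom E p" using yoneda_obj_inj Cod_Obj[OF i] by blast
  then have p': "p \<in> Hom E (Cod E i) (Cod E p)" using Arr_Hom[OF p] by simp
  have "kernel_cokernel_pair E i p"
    using kcp \<Phi>.kernel_cokernel_pair_image[OF Z Arr_Hom[OF i] p'] by blast
  then show "(i, p) \<in> K" using conflation_iff[OF i p] by blast
qed

end

theorem theorem7p20:
  fixes E :: "('o, 'a) addcat" and K :: "('a \<times> 'a) set"
  assumes "deflation_exact E K"
    and "has_admissible_kernels E K"
  shows "is_equivalence E (quot E K) (Q_obj \<circ> yoneda_obj E) (Q_arr E K \<circ> yoneda_arr E) \<and>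
    (\<forall>i \<in> Arr E. \<forall>p \<in> Arr E. (i, p) \<in> K \<longleftrightarrow>
      ((Q_arr E K \<circ> yoneda_arr E) i, (Q_arr E K \<circ> yoneda_arr E) p) \<in> quot_conflations E K)"
proof -
  interpret deflation_exact_kernels E K
    using assms by (intro deflation_exact_kernels.intro deflation_exact_kernels_axioms.intro)
  show ?thesis using \<Phi>.is_equivalence conflation_iff_image by blast
qed

end
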